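(* Let $(\mathcal{A},m)$ be a multiarrangement in $V=\mathbb{K}^\ell$ with a heavy hyperplane $H_0\in\mathcal{A}$. The following are equivalent: (i) $(\mathcal{A},m)$ is free. (ii) The Euler–Ziegler restriction $(\mathcal{A}^{H_0},m^{H_0})$ is free and the restriction map $\mathrm{res}^1_{H_0}:D_0(\mathcal{A},m)\to D(\mathcal{A}^{H_0},m^{H_0})$, $\delta\mapsto\delta|_{H_0}$, is surjective.
   Context: Let $\mathbb{K}$ be a field and $S=\mathbb{K}[x_1,\dots,x_\ell]$. A multiarrangement $(\mathcal{A},m)$ is a finite set of linear hyperplanes $H=\ker\alpha_H$ with $m:\mathcal{A}\to\mathbb{Z}_{>0}$, and $|m|=\sum_Hm(H)$. $D(\mathcal{A},m)=\{\theta\in\mathrm{Der}_{\mathbb{K}}(S):\theta(\alpha_H)\in\alpha_H^{m(H)}S\ \forall H\}$; freeness means this is a free $S$-module. $H_0$ is heavy if $2m(H_0)\ge|m|$. $D_0(\mathcal{A},m)=\{\delta\in D(\mathcal{A},m):\delta(\alpha_{H_0})=0\}$. For such $\delta$, $\delta|_{H_0}$ is the induced derivation of $\bar S=S/\alpha_{H_0}S$, given by $\bar f\mapsto\overline{\delta(f)}$. The Euler–Ziegler restriction is $\mathcal{A}^{H_0}=\{H_0\cap H:H\in\mathcal{A}\setminus\{H_0\}\}$, an arrangement in $H_0$, with $m^{H_0}(X)=\sum_{H\in\mathcal{A}_X\setminus\{H_0\}}m(H)$, where $\mathcal{A}_X=\{H:X\subseteq H\}$. $D(\mathcal{A}^{H_0},m^{H_0})$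 is defined analogously over $\bar S$; it is known that $\delta|_{H_0}\in D(\mathcal{A}^{H_0},m^{H_0})$. *)

theory Defs
  imports "HOL-Library.Poly_Mapping"
begin

text \<open>The polynomial ring S = K[x_i | i :: 'n] (the finite type 'n indexes the coordinates,
  so l = CARD('n)); a polynomial is a finitely supported map from monomials
  (exponent vectors) to coefficients.\<close>
type_synonym ('n, 'a) pol = "('n \<Rightarrow>\<^sub>0 nat) \<Rightarrow>\<^sub>0 'a"

definition Cst :: "'a::field \<Rightarrow> ('n, 'a) pol" where
  "Cst c = Poly_Mapping.single 0 c"

definition linf :: "('n::finite \<Rightarrow> 'a::field) \<Rightarrow> ('n, 'a) pol" where
  "linf a = (\<Sum>i\<in>UNIV. Poly_Mapping.single (Poly_Mapping.single i 1) (a i))"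

text \<open>A K-derivation theta of S is determined by the images theta(x_i); we represent it by
  the tuple of these images (Der_K(S) is the free S-module with basis the partials).
  Applying theta to a linear form.\<close>
definition der_app :: "('n::finite \<Rightarrow> ('n, 'a::field) pol) \<Rightarrow> ('n \<Rightarrow> 'a) \<Rightarrow> ('n, 'a) pol" where
  "der_app \<theta> a = (\<Sum>i\<in>UNIV. Cst (a i) * \<theta> i)"

definition hyperplane :: "('n::finite \<Rightarrow> 'a::field) set \<Rightarrow> bool" where
  "hyperplane H \<longleftrightarrow> (\<exists>a. (\<exists>i. a i \<noteq> 0) \<and> H = {v. (\<Sum>i\<in>UNIV. a i * v i) = 0})"

definition defform :: "('n::finite \<Rightarrow> 'a::field) set \<Rightarrow> ('n \<Rightarrow> 'a)" where
  "defform H = (SOME a. (\<exists>i. a i \<noteq> 0) \<and> H = {v. (\<Sum>i\<in>UNIV. a i * v i) = 0})"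

definition multiarrangement ::
  "('n::finite \<Rightarrow> 'a::field) set set \<Rightarrow> (('n \<Rightarrow> 'a) set \<Rightarrow> nat) \<Rightarrow> bool" where
  "multiarrangement A m \<longleftrightarrow> finite A \<and> (\<forall>H\<in>A. hyperplane H) \<and> (\<forall>H\<in>A. m H > 0)"

definition total_mult :: "('n \<Rightarrow> 'a) set set \<Rightarrow> (('n \<Rightarrow> 'a) set \<Rightarrow> nat) \<Rightarrow> nat" where
  "total_mult A m = (\<Sum>H\<in>A. m H)"

definition heavy ::
  "('n \<Rightarrow> 'a) set set \<Rightarrow> (('n \<Rightarrow> 'a) set \<Rightarrow> nat) \<Rightarrow> ('n \<Rightarrow> 'a) set \<Rightarrow> bool" where
  "heavy A m H0 \<longleftrightarrow> H0 \<in> A \<and> 2 * m H0 \<ge> total_mult A m"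

definition Dmod :: "('n::finite \<Rightarrow> 'a::field) set set \<Rightarrow> (('n \<Rightarrow> 'a) set \<Rightarrow> nat)
    \<Rightarrow> ('n \<Rightarrow> ('n, 'a) pol) set" where
  "Dmod A m = {\<theta>. \<forall>H\<in>A. (linf (defform H)) ^ (m H) dvd der_app \<theta> (defform H)}"

definition D0mod :: "('n::finite \<Rightarrow> 'a::field) set set \<Rightarrow> (('n \<Rightarrow> 'a) set \<Rightarrow> nat)
    \<Rightarrow> ('n \<Rightarrow> 'a) set \<Rightarrow> ('n \<Rightarrow> ('n, 'a) pol) set" where
  "D0mod A m H0 = {\<delta> \<in> Dmod A m. der_app \<delta> (defform H0) = 0}"

definition cong_der :: "('n, 'a::field) pol \<Rightarrow> ('n \<Rightarrow> ('n, 'a) pol) \<Rightarrow> ('n \<Rightarrow> ('n, 'a) pol) \<Rightarrow> bool" where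
  "cong_der q \<theta> \<theta>' \<longleftrightarrow> (\<forall>i. q dvd (\<theta> i - \<theta>' i))"

text \<open>Freeness of a module M (given by representatives) over S/qS: M has a basis B, i.e. every
  element is (modulo q) a finite S/qS-linear combination of elements of B, and B is linearly
  independent over S/qS. For q = 0 this is freeness over S itself.\<close>
definition free_mod_over :: "('n, 'a::field) pol \<Rightarrow> ('n \<Rightarrow> ('n, 'a) pol) set \<Rightarrow> bool" where
  "free_mod_over q M \<longleftrightarrow> (\<exists>B \<subseteq> M.
     (\<forall>\<theta>\<in>M. \<exists>B' \<subseteq> B. finite B' \<and> (\<exists>c. cong_der q \<theta> (\<lambda>i. \<Sum>b\<in>B'. c b * b i))) \<and>
     (\<forall>B' \<subseteq> B. finite B' \<longrightarrow> (\<forall>c. cong_der q (\<lambda>i. \<Sum>b\<in>B'. c b * b i) (\<lambda>i. 0)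
         \<longrightarrow> (\<forall>b\<in>B'. q dvd c b))))"

definition free_multiarr :: "('n::finite \<Rightarrow> 'a::field) set set \<Rightarrow> (('n \<Rightarrow> 'a) set \<Rightarrow> nat) \<Rightarrow> bool" where
  "free_multiarr A m \<longleftrightarrow> free_mod_over 0 (Dmod A m)"

definition restr :: "('n \<Rightarrow> 'a) set set \<Rightarrow> ('n \<Rightarrow> 'a) set \<Rightarrow> ('n \<Rightarrow> 'a) set set" where
  "restr A H0 = (\<lambda>H. H0 \<inter> H) ` (A - {H0})"

definition restr_mult :: "('n \<Rightarrow> 'a) set set \<Rightarrow> (('n \<Rightarrow> 'a) set \<Rightarrow> nat) \<Rightarrow> ('n \<Rightarrow> 'a) set
    \<Rightarrow> ('n \<Rightarrow> 'a) set \<Rightarrow> nat" where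
  "restr_mult A m H0 X = (\<Sum>H\<in>{H\<in>A - {H0}. X \<subseteq> H}. m H)"

text \<open>A defining form of X in A^{H0} on H0: (the image in S/alpha_{H0} S of) alpha_H for some
  H in A - {H0} with X = H0 \<inter> H.\<close>
definition restr_form :: "('n::finite \<Rightarrow> 'a::field) set set \<Rightarrow> ('n \<Rightarrow> 'a) set \<Rightarrow> ('n \<Rightarrow> 'a) set
    \<Rightarrow> ('n \<Rightarrow> 'a)" where
  "restr_form A H0 X = defform (SOME H. H \<in> A - {H0} \<and> H0 \<inter> H = X)"

text \<open>D(A^{H0}, m^{H0}), a module over Sbar = S / alpha_{H0} S, given by representatives:
  derivations of Sbar are exactly the classes modulo alpha_{H0} Der(S) of derivations theta of S
  with theta(alpha_{H0}) in alpha_{H0} S; the condition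
  thetabar(betabar_X) in betabar_X^{m^{H0}(X)} Sbar is lifted to S.\<close>
definition Dres :: "('n::finite \<Rightarrow> 'a::field) set set \<Rightarrow> (('n \<Rightarrow> 'a) set \<Rightarrow> nat)
    \<Rightarrow> ('n \<Rightarrow> 'a) set \<Rightarrow> ('n \<Rightarrow> ('n, 'a) pol) set" where
  "Dres A m H0 = {\<theta>. linf (defform H0) dvd der_app \<theta> (defform H0) \<and>
     (\<forall>X\<in>restr A H0. \<exists>g h.
        der_app \<theta> (restr_form A H0 X) =
          (linf (restr_form A H0 X)) ^ (restr_mult A m H0 X) * g + linf (defform H0) * h)}"

definition free_restr :: "('n::finite \<Rightarrow> 'a::field) set set \<Rightarrow> (('n \<Rightarrow> 'a) set \<Rightarrow> nat)
    \<Rightarrow> ('n \<Rightarrow> 'a) set \<Rightarrow> bool" where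
  "free_restr A m H0 \<longleftrightarrow> free_mod_over (linf (defform H0)) (Dres A m H0)"

definition res_surj :: "('n::finite \<Rightarrow> 'a::field) set set \<Rightarrow> (('n \<Rightarrow> 'a) set \<Rightarrow> nat)
    \<Rightarrow> ('n \<Rightarrow> 'a) set \<Rightarrow> bool" where
  "res_surj A m H0 \<longleftrightarrow>
     (\<forall>\<theta>\<in>Dres A m H0. \<exists>\<delta>\<in>D0mod A m H0. cong_der (linf (defform H0)) \<delta> \<theta>)"

end

(*
  Put S = K[x_1, ..., x_l], let alpha be the form of H0, m0 = m(H0), and Q0 the product of the
  alpha_H^m(H) over H distinct from H0.

  (i) implies (ii). A free D(A,m) has a homogeneous basis, and by Saito's criterion its determinant is
  a unit times alpha^m0 Q0, so the degrees add up to |m| <= 2 m0. A basis element theta with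
  theta(alpha) nonzero has degree at least m0. Either one of these has degree exactly m0, or there is
  only one of them; in both cases theta(alpha) = c alpha^m0 for some theta, and the remaining basis
  elements can be moved into D_0. Modulo alpha their determinant is a unit times the defining
  polynomial of the restriction, so by Cramer's rule they form a basis of D(A^H0, m^H0).

  (ii) implies (i). A homogeneous basis of D(A^H0, m^H0) lifts to a basis of D_0 by graded Nakayama.
  Let I be the ideal of all f such that theta(alpha) = f alpha^m0 for some theta in D(A,m). Because H0
  is heavy, interpolation in two variables shows that I has codimension at least three. Hence
  Ext^1(I, D_0) = Ext^2(S/I, D_0) = 0, the sequence D_0 -> D(A,m) -> I splits, and I is reflexive,
  that is I = S. The vanishing of Ext is proved by hand, comparing with D_0 / Q0 D_0.
*)
theory Submission
  imports
    Defs
    "HOL-Analysis.Determinants"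
    "HOL-Computational_Algebra.Polynomial"
    "HOL-Library.Function_Algebras"
begin

section \<open>Substitution and linear forms\<close>

text \<open>The implication from (ii) to (i) is reduced to a problem on coordinates. Fix a constant
  vector v with value 1 on alpha and put E = alpha^m0 Q0 v. If theta in D(A,m) has theta(alpha) = f
  alpha^m0, then Q0 theta - f E lies in D_0, and its coordinates in a basis of D_0 depend, modulo
  Q0, on f alone. This homomorphism from I is the obstruction: if it is multiplication by a vector
  x, then E corrected by x is divisible by Q0, and the quotient has value alpha^m0 on alpha. Modulo
  alpha_H the candidate for x is a fraction whose denominator is a product of other forms alpha_H';
  a member of I outside the ideal (alpha_H, alpha_H') cancels one factor alpha_H'. So codimension
  three enters only through pairs of forms. Interpolation costs degree |m| - m0 at most, while
  homogeneity demands degree m0; this is the second use of heaviness. The freeness predicate admits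
  infinite bases. Finiteness is recovered because pw A, respectively Q0, multiplies the module into
  a finitely generated submodule.\<close>

lemma pol_induct [case_names add single]:
  assumes "\<And>f g. P f \<Longrightarrow> P g \<Longrightarrow> P (f + g)" and "\<And>t c. P (Poly_Mapping.single t c)"
  shows "P (f :: 'k \<Rightarrow>\<^sub>0 'b::comm_monoid_add)"
proof (induction f rule: update_induct)
  case const
  show ?case using assms(2)[of undefined 0] by simp
next
  case (update f a b)
  have "Poly_Mapping.update a b f = f + Poly_Mapping.single a b"
    using update by (intro poly_mapping_eqI)
      (auto simp: lookup_update lookup_add lookup_single when_def in_keys_iff)
  then show ?case using assms update by metis
qed

text \<open>Evaluation of a polynomial along a map of coefficients and values of the variables. The
  target ring is arbitrary because the same map yields both the embedding into polynomials with
  numbered variables and the endomorphism \<open>elim\<close>.\<close>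

definition subst :: "('a \<Rightarrow> 'b) \<Rightarrow> ('n \<Rightarrow> 'b) \<Rightarrow> ('n::finite, 'a::field) pol \<Rightarrow> 'b::comm_ring_1" where
  "subst \<kappa> \<sigma> f = (\<Sum>t\<in>Poly_Mapping.keys f. \<kappa> (Poly_Mapping.lookup f t) * (\<Prod>i\<in>UNIV. \<sigma> i ^ Poly_Mapping.lookup t i))"

locale coeff_hom =
  fixes \<kappa> :: "'a::field \<Rightarrow> 'b::comm_ring_1"
  assumes hom_add: "\<kappa> (a + b) = \<kappa> a + \<kappa> b"
    and hom_mult: "\<kappa> (a * b) = \<kappa> a * \<kappa> b"
    and hom_one: "\<kappa> 1 = 1"
begin

lemma hom_zero: "\<kappa> 0 = 0"
  using hom_add[of 0 0] by simp

lemma subst_superset: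
  assumes "finite T" "Poly_Mapping.keys f \<subseteq> T"
  shows "subst \<kappa> \<sigma> f = (\<Sum>t\<in>T. \<kappa> (Poly_Mapping.lookup f t) * (\<Prod>i\<in>UNIV. \<sigma> i ^ Poly_Mapping.lookup t i))"
  unfolding subst_def using assms
  by (intro sum.mono_neutral_left) (auto simp: in_keys_iff hom_zero)

lemma subst_add: "subst \<kappa> \<sigma> (f + g) = subst \<kappa> \<sigma> f + subst \<kappa> \<sigma> g"
proof -
  let ?T = "Poly_Mapping.keys f \<union> Poly_Mapping.keys g"
  have "subst \<kappa> \<sigma> h = (\<Sum>t\<in>?T. \<kappa> (Poly_Mapping.lookup h t) * (\<Prod>i\<in>UNIV. \<sigma> i ^ Poly_Mapping.lookup t i))"
    if "h \<in> {f, g, f + g}" for h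
    using that keys_add[of f g] by (intro subst_superset) auto
  then show ?thesis
    by (simp add: lookup_add hom_add distrib_right sum.distrib)
qed

lemma subst_single: "subst \<kappa> \<sigma> (Poly_Mapping.single t c) = \<kappa> c * (\<Prod>i\<in>UNIV. \<sigma> i ^ Poly_Mapping.lookup t i)"
  by (subst subst_superset[of "{t}"]) auto

lemma subst_mult: "subst \<kappa> \<sigma> (f * g) = subst \<kappa> \<sigma> f * subst \<kappa> \<sigma> g"
proof (induction f rule: pol_induct)
  case (add f1 f2)
  then show ?case by (simp add: distrib_right subst_add)
next
  case (single t c)
  show ?case
  proof (induction g rule: pol_induct)
    case (add f1 f2)
    then show ?case by (simp add: distrib_left subst_add)
  next
    case (single s d)
    show ?case
      by (simp add: mult_single subst_single hom_mult lookup_add power_add prod.distrib mult_ac)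
  qed
qed

lemma subst_zero: "subst \<kappa> \<sigma> 0 = 0"
  by (simp add: subst_def)

lemma subst_one: "subst \<kappa> \<sigma> 1 = 1"
  by (simp flip: single_one add: subst_single hom_one)

lemma subst_Cst: "subst \<kappa> \<sigma> (Cst c) = \<kappa> c"
  by (simp add: Cst_def subst_single)

lemma subst_var: "subst \<kappa> \<sigma> (Poly_Mapping.single (Poly_Mapping.single i 1) c) = \<kappa> c * \<sigma> i"
proof -
  have "(\<Prod>j\<in>UNIV. \<sigma> j ^ Poly_Mapping.lookup (Poly_Mapping.single i 1) j) = (\<Prod>j\<in>UNIV. if j = i then \<sigma> i else 1)"
    by (intro prod.cong) (auto simp: lookup_single when_def)
  then show ?thesis by (simp add: subst_single)
qed

lemma subst_sum: "subst \<kappa> \<sigma> (sum g I) = (\<Sum>i\<in>I. subst \<kappa> \<sigma> (g i))"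
  by (induction I rule: infinite_finite_induct) (auto simp: subst_add subst_zero)

lemma subst_linf: "subst \<kappa> \<sigma> (linf a) = (\<Sum>i\<in>UNIV. \<kappa> (a i) * \<sigma> i)"
  unfolding linf_def subst_sum by (rule sum.cong[OF refl subst_var])

end

section \<open>The polynomial ring is an integral domain\<close>

lemma single_var_power:
  "Poly_Mapping.single (Poly_Mapping.single i 1) 1 ^ k = Poly_Mapping.single (Poly_Mapping.single i k) (1::'b::comm_ring_1)"
proof (induction k)
  case (Suc k)
  have "Poly_Mapping.single i 1 + Poly_Mapping.single i k = Poly_Mapping.single i (Suc k)"
    by (metis plus_1_eq_Suc single_add)
  then show ?case using Suc by (simp add: mult_single)
qed simp

lemma prod_single_one:
  "(\<Prod>i\<in>I. Poly_Mapping.single (h i) (1::'b::comm_ring_1)) = Poly_Mapping.single (\<Sum>i\<in>I. h i) 1"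
  by (induction I rule: infinite_finite_induct) (simp_all add: mult_single)

text \<open>The library proves that polynomials form a domain only for linearly ordered sets of monomials,
  hence the embedding of the coordinates into the natural numbers.\<close>

lemma pol_mult_eq_0_iff [simp]:
  fixes f g :: "('n::finite, 'a::field) pol"
  shows "f * g = 0 \<longleftrightarrow> f = 0 \<or> g = 0"
proof -
  obtain e :: "'n \<Rightarrow> nat" where e: "inj e"
    using finite_imp_inj_to_nat_seg[of "UNIV :: 'n set"] by auto
  define \<kappa> :: "'a \<Rightarrow> (nat \<Rightarrow>\<^sub>0 nat) \<Rightarrow>\<^sub>0 'a" where "\<kappa> = Poly_Mapping.single 0"
  define \<sigma> :: "'n \<Rightarrow> (nat \<Rightarrow>\<^sub>0 nat) \<Rightarrow>\<^sub>0 'a" where "\<sigma> i = Poly_Mapping.single (Poly_Mapping.single (e i) 1) 1" for i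
  \<comment> \<open>\<open>E\<close> relabels exponent vectors along the injection \<open>e\<close>.
    The substitution turns out to do nothing else to the monomials, hence it is an injective ring
    homomorphism.\<close>
  define E :: "('n \<Rightarrow>\<^sub>0 nat) \<Rightarrow> (nat \<Rightarrow>\<^sub>0 nat)" where "E t = (\<Sum>i\<in>UNIV. Poly_Mapping.single (e i) (Poly_Mapping.lookup t i))" for t
  interpret coeff_hom \<kappa>
    by standard (simp_all add: \<kappa>_def single_add mult_single)
  have pow: "\<sigma> i ^ k = Poly_Mapping.single (Poly_Mapping.single (e i) k) 1" for i k
    unfolding \<sigma>_def by (rule single_var_power)
  have lookup_E: "Poly_Mapping.lookup (E t) (e i) = Poly_Mapping.lookup t i" for t i
  proof -
    have "Poly_Mapping.lookup (E t) (e i) = (\<Sum>j\<in>UNIV. if j = i then Poly_Mapping.lookup t i else 0)"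
      unfolding E_def lookup_sum
      by (intro sum.cong refl) (auto simp: lookup_single when_def dest: injD[OF e])
    then show ?thesis by simp
  qed
  have inj_E: "E s = E t \<longleftrightarrow> s = t" for s t
    by (metis lookup_E poly_mapping_eqI)
  have val: "subst \<kappa> \<sigma> f = (\<Sum>t\<in>Poly_Mapping.keys f. Poly_Mapping.single (E t) (Poly_Mapping.lookup f t))"
    for f :: "('n, 'a) pol"
    unfolding subst_def pow prod_single_one \<kappa>_def E_def by (simp add: mult_single)
  have coeff: "Poly_Mapping.lookup (subst \<kappa> \<sigma> f) (E t) = Poly_Mapping.lookup f t" for f :: "('n, 'a) pol" and t
  proof -
    have "Poly_Mapping.lookup (subst \<kappa> \<sigma> f) (E t)
        = (\<Sum>s\<in>Poly_Mapping.keys f. if s = t then Poly_Mapping.lookup f t else 0)"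
      unfolding val lookup_sum
      by (intro sum.cong refl) (auto simp: lookup_single when_def inj_E)
    then show ?thesis by (simp add: in_keys_iff)
  qed
  have inj: "subst \<kappa> \<sigma> f = 0 \<longleftrightarrow> f = 0" for f :: "('n, 'a) pol"
    using coeff by (metis lookup_zero poly_mapping_eqI subst_zero)
  have "f * g = 0 \<longleftrightarrow> subst \<kappa> \<sigma> f * subst \<kappa> \<sigma> g = 0"
    using inj[of "f * g"] by (simp add: subst_mult)
  then show ?thesis by (simp add: inj)
qed

lemma pol_mult_left_cancel:
  fixes f g h :: "('n::finite, 'a::field) pol"
  assumes "f \<noteq> 0" shows "f * g = f * h \<longleftrightarrow> g = h"
  using pol_mult_eq_0_iff[of f "g - h"] assms by (simp add: right_diff_distrib)

lemma pol_dvd_mult_cancel_left: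
  fixes f g h :: "('n::finite, 'a::field) pol"
  assumes "f \<noteq> 0" shows "f * g dvd f * h \<longleftrightarrow> g dvd h"
  using assms by (auto simp: dvd_def mult.assoc pol_mult_left_cancel)

lemma pol_power_eq_0_iff [simp]:
  "f ^ n = 0 \<longleftrightarrow> (f :: ('n::finite, 'a::field) pol) = 0 \<and> n \<noteq> 0"
  by (induction n) auto

lemma pol_prod_eq_0_iff:
  "finite I \<Longrightarrow> prod f I = 0 \<longleftrightarrow> (\<exists>i\<in>I. f i = (0 :: ('n::finite, 'a::field) pol))"
  by (induction I rule: finite_induct) auto

interpretation Cst: coeff_hom "Cst :: 'a::field \<Rightarrow> ('n::finite, 'a) pol"
  by standard (simp_all add: Cst_def single_add mult_single)

lemma Cst_simps:
  "Cst 0 = (0 :: ('n::finite, 'a::field) pol)" "Cst 1 = (1 :: ('n, 'a) pol)"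
  "Cst (a + b) = (Cst a + Cst b :: ('n, 'a) pol)" "Cst (a * b) = (Cst a * Cst b :: ('n, 'a) pol)"
  "Cst (- a) = (- Cst a :: ('n, 'a) pol)" "Cst (a - b) = (Cst a - Cst b :: ('n, 'a) pol)"
  by (simp_all add: Cst.hom_zero Cst.hom_one Cst.hom_add Cst.hom_mult)
     (simp_all add: Cst_def single_uminus single_diff)

lemma Cst_eq_0_iff [simp]: "(Cst c :: ('n::finite, 'a::field) pol) = 0 \<longleftrightarrow> c = 0"
  by (metis Cst_def lookup_single_eq lookup_zero single_zero)

lemma Cst_inverse: "c \<noteq> 0 \<Longrightarrow> Cst c * Cst (inverse c) = (1 :: ('n::finite, 'a::field) pol)"
  by (metis Cst_simps(2,4) right_inverse)

lemma Cst_dvd_one: "c \<noteq> 0 \<Longrightarrow> Cst c dvd (1 :: ('n::finite, 'a::field) pol)"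
  by (metis Cst_inverse dvd_triv_left)

lemma linf_diff_scale: "linf (\<lambda>j. b j - s * a j) = linf b - Cst s * linf a"
  by (simp add: linf_def Cst_def sum_distrib_left mult_single single_diff sum_subtractf)

lemma linf_add: "linf (\<lambda>j. a j + b j) = linf a + linf b"
  by (simp add: linf_def single_add sum.distrib)

lemma linf_scale: "linf (\<lambda>j. s * a j) = Cst s * linf a"
  by (simp add: linf_def Cst_def sum_distrib_left mult_single)

lemma single_one_eq_iff: "Poly_Mapping.single i (1::nat) = Poly_Mapping.single j 1 \<longleftrightarrow> i = j"
  by (metis lookup_single_eq lookup_single_not_eq one_neq_zero)

lemma lookup_linf: "Poly_Mapping.lookup (linf a) (Poly_Mapping.single i 1) = a i"
proof -
  have "Poly_Mapping.lookup (linf a) (Poly_Mapping.single i 1) = (\<Sum>j\<in>UNIV. if j = i then a i else 0)"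
    unfolding linf_def lookup_sum
    by (intro sum.cong refl) (auto simp: lookup_single when_def single_one_eq_iff[simplified])
  then show ?thesis by simp
qed

lemma linf_eq_0_iff: "linf a = 0 \<longleftrightarrow> (\<forall>i. a i = 0)"
proof
  show "linf a = 0 \<Longrightarrow> \<forall>i. a i = 0" by (metis lookup_linf lookup_zero)
qed (simp add: linf_def)

text \<open>Elimination of a variable: a retraction of the polynomial ring whose kernel is generated by
  the given linear form. It turns congruences modulo the form into equations.\<close>

definition elim_idx :: "('n::finite \<Rightarrow> 'a::field) \<Rightarrow> 'n" where
  "elim_idx a = (SOME p. a p \<noteq> 0)"

text \<open>The multiple of a that has to be subtracted from b to clear the pivot entry.\<close>

definition elim_coeff :: "('n::finite \<Rightarrow> 'a::field) \<Rightarrow> ('n \<Rightarrow> 'a) \<Rightarrow> 'a" where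
  "elim_coeff a b = b (elim_idx a) / a (elim_idx a)"

definition elim :: "('n::finite \<Rightarrow> 'a::field) \<Rightarrow> ('n, 'a) pol \<Rightarrow> ('n, 'a) pol" where
  "elim a = subst Cst (\<lambda>i. linf (\<lambda>j. of_bool (i = j) - elim_coeff a (\<lambda>k. of_bool (i = k)) * a j))"

lemma elim_add: "elim a (f + g) = elim a f + elim a g"
  and elim_mult: "elim a (f * g) = elim a f * elim a g"
  and elim_zero: "elim a 0 = 0"
  and elim_one: "elim a 1 = 1"
  and elim_Cst: "elim a (Cst c) = Cst c"
  and elim_sum: "elim a (sum h I) = (\<Sum>i\<in>I. elim a (h i))"
  by (simp_all add: elim_def Cst.subst_add Cst.subst_mult Cst.subst_zero Cst.subst_one
      Cst.subst_Cst Cst.subst_sum)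

lemma elim_diff: "elim a (f - g) = elim a f - elim a g"
  by (metis add_diff_cancel_right' diff_add_cancel elim_add)

lemma elim_power: "elim a (f ^ k) = elim a f ^ k"
  by (induction k) (simp_all add: elim_one elim_mult)

lemma elim_prod: "elim a (prod h I) = (\<Prod>i\<in>I. elim a (h i))"
  by (induction I rule: infinite_finite_induct) (simp_all add: elim_one elim_mult)

lemma linf_sum: "linf (\<lambda>j. \<Sum>i\<in>I. h i j) = (\<Sum>i\<in>I. linf (h i))"
  by (induction I rule: infinite_finite_induct) (simp_all add: linf_add, simp_all add: linf_def)

lemma elim_linf: "elim a (linf b) = linf (\<lambda>j. b j - elim_coeff a b * a j)"
proof -
  have "elim a (linf b) = linf (\<lambda>j. \<Sum>i\<in>UNIV. b i * (of_bool (i = j) - elim_coeff a (\<lambda>k. of_bool (i = k)) * a j))"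
    unfolding elim_def Cst.subst_linf linf_sum linf_scale ..
  also have "(\<lambda>j. \<Sum>i\<in>UNIV. b i * (of_bool (i = j) - elim_coeff a (\<lambda>k. of_bool (i = k)) * a j))
      = (\<lambda>j. b j - elim_coeff a b * a j)"
  proof
    fix j
    have "b i * (of_bool (i = j) - elim_coeff a (\<lambda>k. of_bool (i = k)) * a j)
        = (if i = j then b j else 0) - (if i = elim_idx a then elim_coeff a b * a j else 0)" for i
      by (simp add: elim_coeff_def)
    then show "(\<Sum>i\<in>UNIV. b i * (of_bool (i = j) - elim_coeff a (\<lambda>k. of_bool (i = k)) * a j)) = b j - elim_coeff a b * a j"
      by (simp add: sum_subtractf)
  qed
  finally show ?thesis .
qed

text \<open>Since \<open>elim\<close> is a ring homomorphism, the polynomials congruent to their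
  image are closed under sums and products; variables and constants are among them.\<close>

lemma linf_dvd_minus_elim: "linf a dvd f - elim a f"
proof (induction f rule: pol_induct)
  case (add f g)
  then show ?case by (metis elim_add add_diff_add dvd_add)
next
  case (single t c)
  have mul: "linf a dvd f * g - elim a (f * g)" if "linf a dvd f - elim a f" "linf a dvd g - elim a g" for f g
  proof -
    have "f * g - elim a (f * g) = f * (g - elim a g) + (f - elim a f) * elim a g"
      by (simp add: elim_mult algebra_simps)
    then show ?thesis using that by simp
  qed
  have pow: "linf a dvd f ^ k - elim a (f ^ k)" if "linf a dvd f - elim a f" for f and k :: nat
    using that by (induction k) (simp_all add: mul elim_one)
  have prd: "linf a dvd prod h I - elim a (prod h I)" if "\<And>i. i \<in> I \<Longrightarrow> linf a dvd h i - elim a (h i)"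
    for h :: "'a \<Rightarrow> ('a, 'b) pol" and I
    using that by (induction I rule: infinite_finite_induct) (simp_all add: mul elim_one)
  define x where "x i = linf (\<lambda>k. of_bool (i = k) :: 'b)" for i :: 'a
  have x_eq: "x i = Poly_Mapping.single (Poly_Mapping.single i 1) (1::'b)" for i
  proof -
    have "x i = (\<Sum>k\<in>UNIV. if k = i then Poly_Mapping.single (Poly_Mapping.single i 1) (1::'b) else 0)"
      unfolding x_def linf_def by (intro sum.cong refl) auto
    then show ?thesis by simp
  qed
  have var: "linf a dvd x i - elim a (x i)" for i
    unfolding x_def elim_linf by (simp add: linf_diff_scale)
  have pw: "x i ^ k = Poly_Mapping.single (Poly_Mapping.single i k) 1" for i k
    unfolding x_eq by (rule single_var_power)
  have t: "(\<Sum>i\<in>UNIV. Poly_Mapping.single i (Poly_Mapping.lookup t i)) = t"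
    by (intro poly_mapping_eqI) (simp add: lookup_sum lookup_single when_def)
  have "Poly_Mapping.single t c = Cst c * (\<Prod>i\<in>UNIV. x i ^ Poly_Mapping.lookup t i)"
    by (simp add: pw prod_single_one t Cst_def mult_single)
  moreover have "linf a dvd Cst c - elim a (Cst c)" by (simp add: elim_Cst)
  ultimately show ?case
    by (auto intro!: mul prd pow var)
qed

lemma elim_self: assumes "\<exists>i. a i \<noteq> 0" shows "elim a (linf a) = 0"
proof -
  have "a (elim_idx a) \<noteq> 0" unfolding elim_idx_def by (rule someI_ex[OF assms])
  then show ?thesis unfolding elim_linf by (simp add: elim_coeff_def linf_eq_0_iff)
qed

section \<open>Linear forms as prime elements\<close>

lemma linf_dvd_iff_elim:
  assumes "\<exists>i. a i \<noteq> 0" shows "linf a dvd f \<longleftrightarrow> elim a f = 0"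
proof
  assume "linf a dvd f"
  then show "elim a f = 0" using elim_self[OF assms] by (auto simp: dvd_def elim_mult)
next
  assume "elim a f = 0"
  then show "linf a dvd f" using linf_dvd_minus_elim[of a f] by simp
qed

lemma elim_elim: assumes "\<exists>i. a i \<noteq> 0" shows "elim a (elim a f) = elim a f"
  using linf_dvd_minus_elim[of a f] unfolding linf_dvd_iff_elim[OF assms] by (simp add: elim_diff)

text \<open>The kernel of a homomorphism into a domain is a prime ideal.\<close>

lemma linf_prime:
  assumes "\<exists>i. a i \<noteq> 0" shows "linf a dvd f * g \<longleftrightarrow> linf a dvd f \<or> linf a dvd g"
  by (simp add: linf_dvd_iff_elim[OF assms] elim_mult)

lemma linf_dvd_prod:
  assumes "\<exists>i. a i \<noteq> 0" "finite I" shows "linf a dvd prod h I \<longleftrightarrow> (\<exists>i\<in>I. linf a dvd h i)"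
  using assms(2,1)
  by (induction rule: finite_induct)
     (simp_all add: linf_prime, simp add: linf_dvd_iff_elim elim_one)

lemma linf_dvd_power: 
  assumes "\<exists>i. a i \<noteq> 0" "linf a dvd f ^ k" shows "linf a dvd f"
  using assms by (simp add: linf_dvd_iff_elim elim_power)

lemma linf_dvd_linf:
  assumes "\<exists>i. a i \<noteq> 0" "linf a dvd linf b" shows "\<exists>s. \<forall>i. b i = s * a i"
  using assms by (auto simp: linf_dvd_iff_elim elim_linf linf_eq_0_iff)

lemma linf_power_dvd_mult:
  assumes "\<exists>i. a i \<noteq> 0" "\<not> linf a dvd f" "linf a ^ k dvd f * g"
  shows "linf a ^ k dvd g"
  using assms(3)
proof (induction k arbitrary: g)
  case (Suc k)
  have nz: "linf a \<noteq> 0" using assms(1) by (simp add: linf_eq_0_iff)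
  have "linf a dvd f * g" using Suc.prems by (metis dvd_mult_left power_Suc)
  then obtain h where h: "g = linf a * h" using assms linf_prime by (metis dvdE)
  then have "linf a * linf a ^ k dvd linf a * (f * h)" using Suc.prems by (simp add: mult_ac)
  then have "linf a ^ k dvd f * h" using pol_dvd_mult_cancel_left[OF nz] by blast
  then have "linf a ^ k dvd h" by (rule Suc.IH)
  then show ?case unfolding h by (simp add: mult_dvd_mono)
qed simp

text \<open>Stands in for unique factorization: forms that do not divide one another are different
  primes, so each power passes to the cofactor left by the previous ones.\<close>

lemma prod_linf_power_dvd:
  assumes "finite I" "\<And>i. i \<in> I \<Longrightarrow> \<exists>k. a i k \<noteq> 0"
    and "\<And>i j. i \<in> I \<Longrightarrow> j \<in> I \<Longrightarrow> i \<noteq> j \<Longrightarrow> \<not> linf (a i) dvd linf (a j)"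
    and "\<And>i. i \<in> I \<Longrightarrow> linf (a i) ^ e i dvd f"
  shows "(\<Prod>i\<in>I. linf (a i) ^ e i) dvd f"
  using assms
proof (induction I rule: finite_induct)
  case (insert i I)
  have "(\<Prod>i\<in>I. linf (a i) ^ e i) dvd f"
    by (rule insert.IH) (use insert.prems in blast)+
  then obtain g where g: "f = (\<Prod>i\<in>I. linf (a i) ^ e i) * g" by (rule dvdE)
  have ai: "\<exists>k. a i k \<noteq> 0" using insert.prems(1) by simp
  have "\<not> linf (a i) dvd (\<Prod>i\<in>I. linf (a i) ^ e i)"
  proof
    assume "linf (a i) dvd (\<Prod>i\<in>I. linf (a i) ^ e i)"
    then obtain j where "j \<in> I" "linf (a i) dvd linf (a j) ^ e j"
      unfolding linf_dvd_prod[OF ai insert.hyps(1)] by blast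
    moreover have "i \<noteq> j" using \<open>j \<in> I\<close> insert.hyps(2) by blast
    ultimately show False
      using linf_dvd_power[OF ai] insert.prems(2)[of i j] by blast
  qed
  moreover have "linf (a i) ^ e i dvd (\<Prod>i\<in>I. linf (a i) ^ e i) * g"
    using insert.prems(3)[of i] g by simp
  ultimately have "linf (a i) ^ e i dvd g"
    by (rule linf_power_dvd_mult[OF ai])
  then have "(\<Prod>i\<in>I. linf (a i) ^ e i) * linf (a i) ^ e i dvd f"
    unfolding g by (rule mult_dvd_mono[OF dvd_refl])
  then show ?case using insert.hyps by (simp add: mult.commute)
qed simp

text \<open>If g c equals a product containing a prime l that does not divide g, then l divides c
  and can be cancelled. After all factors are cancelled, g divides 1.\<close>

lemma coprime_to_prod_imp_unit:
  assumes "finite I" "\<And>i. i \<in> I \<Longrightarrow> \<exists>k. a i k \<noteq> 0"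
    and "\<And>i. i \<in> I \<Longrightarrow> \<not> linf (a i) dvd g"
    and "g dvd (\<Prod>i\<in>I. linf (a i) ^ e i)"
  shows "g dvd 1"
  using assms
proof (induction I rule: finite_induct)
  case (insert i I)
  have "g dvd h" if "g dvd linf (a i) ^ k * h" for k h
    using that
  proof (induction k)
    case (Suc k)
    from Suc.prems obtain c where "linf (a i) ^ Suc k * h = g * c" by (rule dvdE)
    then have c: "linf (a i) * (linf (a i) ^ k * h) = g * c" by (simp add: mult.assoc)
    have ai: "\<exists>l. a i l \<noteq> 0" and ng: "\<not> linf (a i) dvd g" using insert.prems(1,2) by simp_all
    have "linf (a i) dvd g * c" unfolding c[symmetric] by simp
    then have "linf (a i) dvd c" using ng unfolding linf_prime[OF ai] by blast
    then obtain d where "c = linf (a i) * d" ..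
    then have "linf (a i) * (linf (a i) ^ k * h) = linf (a i) * (g * d)" using c by (simp add: mult_ac)
    moreover have "linf (a i) \<noteq> 0" using ai by (simp add: linf_eq_0_iff)
    ultimately have "linf (a i) ^ k * h = g * d" using pol_mult_left_cancel by blast
    then have "g dvd linf (a i) ^ k * h" by simp
    then show ?case by (rule Suc.IH)
  qed simp
  moreover have "g dvd linf (a i) ^ e i * (\<Prod>i\<in>I. linf (a i) ^ e i)"
    using insert.prems(3) insert.hyps by simp
  ultimately have "g dvd (\<Prod>i\<in>I. linf (a i) ^ e i)" .
  then show ?case using insert.IH insert.prems(1,2) by blast
qed simp

section \<open>Homogeneous components\<close>

definition mdeg :: "('n::finite \<Rightarrow>\<^sub>0 nat) \<Rightarrow> nat" where
  "mdeg t = (\<Sum>i\<in>UNIV. Poly_Mapping.lookup t i)"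

lemma mdeg_add: "mdeg (s + t) = mdeg s + mdeg t"
  by (simp add: mdeg_def lookup_add sum.distrib)

lemma mdeg_eq_0_iff: "mdeg t = 0 \<longleftrightarrow> t = 0"
  by (auto simp: mdeg_def intro!: poly_mapping_eqI)

lemma mdeg_single: "mdeg (Poly_Mapping.single i k) = k"
  by (simp add: mdeg_def lookup_single when_def)

definition hcomp :: "nat \<Rightarrow> ('n::finite, 'a::field) pol \<Rightarrow> ('n, 'a) pol" where
  "hcomp d f = Poly_Mapping.mapp (\<lambda>t c. c when mdeg t = d) f"

lemma lookup_hcomp:
  "Poly_Mapping.lookup (hcomp d f) t = (if mdeg t = d then Poly_Mapping.lookup f t else 0)"
  by (simp add: hcomp_def lookup_mapp when_def in_keys_iff)

text \<open>The zero polynomial is homogeneous of every degree, which keeps sums free of case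
  distinctions. Statements that read off a degree therefore assume a nonzero polynomial.\<close>

definition homog :: "nat \<Rightarrow> ('n::finite, 'a::field) pol \<Rightarrow> bool" where
  "homog d f \<longleftrightarrow> hcomp d f = f"

lemma homog_iff: "homog d f \<longleftrightarrow> (\<forall>t. Poly_Mapping.lookup f t \<noteq> 0 \<longrightarrow> mdeg t = d)"
  by (auto simp: homog_def poly_mapping_eq_iff fun_eq_iff lookup_hcomp)

lemma hcomp_add: "hcomp d (f + g) = hcomp d f + hcomp d g"
  and hcomp_diff: "hcomp d (f - g) = hcomp d f - hcomp d g"
  and hcomp_zero: "hcomp d 0 = 0"
  by (auto intro!: poly_mapping_eqI simp: lookup_hcomp lookup_add lookup_minus)

lemma hcomp_sum: "hcomp d (sum h I) = (\<Sum>i\<in>I. hcomp d (h i))"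
  by (induction I rule: infinite_finite_induct) (simp_all add: hcomp_add hcomp_zero)

lemma hcomp_homog: "homog d f \<Longrightarrow> hcomp e f = (if e = d then f else 0)"
  by (auto simp: homog_iff lookup_hcomp intro!: poly_mapping_eqI)

lemma homog_hcomp: "homog d (hcomp d f)"
  by (simp add: homog_iff lookup_hcomp)

lemma homog_add: "homog d f \<Longrightarrow> homog d g \<Longrightarrow> homog d (f + g)"
  and homog_diff: "homog d f \<Longrightarrow> homog d g \<Longrightarrow> homog d (f - g)"
  and homog_zero: "homog d 0"
  by (simp_all add: homog_def hcomp_add hcomp_diff hcomp_zero)

lemma homog_uminus: "homog d f \<Longrightarrow> homog d (- f)"
  using homog_diff[OF homog_zero] by force

lemma homog_sum: "(\<And>i. i \<in> I \<Longrightarrow> homog d (h i)) \<Longrightarrow> homog d (sum h I)"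
  by (induction I rule: infinite_finite_induct) (simp_all add: homog_add homog_zero)

lemma homog_mult: assumes "homog d f" "homog e g" shows "homog (d + e) (f * g)"
  unfolding homog_iff
proof (intro allI impI)
  fix t assume "Poly_Mapping.lookup (f * g) t \<noteq> 0"
  then have "t \<in> Poly_Mapping.keys (f * g)" by (simp add: in_keys_iff)
  then obtain r s where "t = r + s" "r \<in> Poly_Mapping.keys f" "s \<in> Poly_Mapping.keys g"
    using keys_mult[of f g] by blast
  then show "mdeg t = d + e" using assms by (auto simp: homog_iff in_keys_iff mdeg_add)
qed

lemma homog_Cst: "homog 0 (Cst c)"
  by (auto simp: homog_iff Cst_def lookup_single when_def mdeg_def)

lemma homog_linf: "homog 1 (linf a)"
  unfolding linf_def
  by (intro homog_sum) (auto simp: homog_iff lookup_single when_def mdeg_single)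

lemma homog_one: "homog 0 1"
  using homog_Cst[of 1] by (simp add: Cst_simps)

lemma homog_power: "homog d f \<Longrightarrow> homog (k * d) (f ^ k)"
  by (induction k) (simp_all add: homog_one homog_mult)

lemma homog_prod: "(\<And>i. i \<in> I \<Longrightarrow> homog (d i) (h i)) \<Longrightarrow> homog (sum d I) (prod h I)"
  by (induction I rule: infinite_finite_induct) (simp_all add: homog_one homog_mult)

lemma homog_0_Cst: assumes "homog 0 f" shows "f = Cst (Poly_Mapping.lookup f 0)"
  using assms
  by (intro poly_mapping_eqI) (auto simp: homog_iff Cst_def lookup_single when_def mdeg_eq_0_iff)

lemma hcomp_0: "hcomp 0 f = Cst (Poly_Mapping.lookup f 0)"
  using homog_0_Cst[OF homog_hcomp] by (metis lookup_hcomp mdeg_eq_0_iff)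

text \<open>Claimed for all large bounds M, so that one bound can serve several polynomials or be
  raised above a given degree.\<close>

lemma sum_hcomp: obtains N where "\<And>M. M \<ge> N \<Longrightarrow> (\<Sum>d\<le>M. hcomp d f) = f"
proof
  fix M assume M: "(\<Sum>t\<in>Poly_Mapping.keys f. mdeg t) \<le> M"
  show "(\<Sum>d\<le>M. hcomp d f) = f"
  proof (intro poly_mapping_eqI)
    fix t
    have "mdeg t \<le> M" if "Poly_Mapping.lookup f t \<noteq> 0"
      using M member_le_sum[of t "Poly_Mapping.keys f" mdeg] that by (auto simp: in_keys_iff)
    then show "Poly_Mapping.lookup (\<Sum>d\<le>M. hcomp d f) t = Poly_Mapping.lookup f t"
      by (auto simp: lookup_sum lookup_hcomp)
  qed
qed

lemma hcomp_eqI: assumes "\<And>d. hcomp d f = hcomp d g" shows "f = g"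
proof (intro poly_mapping_eqI)
  fix t
  show "Poly_Mapping.lookup f t = Poly_Mapping.lookup g t"
    using assms[of "mdeg t"] lookup_hcomp[of "mdeg t" f t] lookup_hcomp[of "mdeg t" g t] by simp
qed

lemma hcomp_mult_homog:
  assumes "homog e g"
  shows "hcomp d (f * g) = (if d < e then 0 else hcomp (d - e) f * g)"
proof -
  obtain N where "\<And>M. M \<ge> N \<Longrightarrow> (\<Sum>k\<le>M. hcomp k f) = f" using sum_hcomp by blast
  then have f: "(\<Sum>k\<le>max N d. hcomp k f) = f" by simp
  have "hcomp d (f * g) = (\<Sum>k\<le>max N d. hcomp d (hcomp k f * g))"
    by (subst f[symmetric]) (simp add: sum_distrib_right hcomp_sum)
  also have "\<dots> = (\<Sum>k\<le>max N d. if k = d - e \<and> e \<le> d then hcomp (d - e) f * g else 0)"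
    by (intro sum.cong refl) (auto simp: hcomp_homog[OF homog_mult[OF homog_hcomp assms]])
  also have "\<dots> = (if d < e then 0 else hcomp (d - e) f * g)"
    by (cases "e \<le> d") (auto simp: le_max_iff_disj)
  finally show ?thesis .
qed

lemma hcomp_mult: "hcomp d (f * g) = (\<Sum>k\<le>d. hcomp k f * hcomp (d - k) g)"
proof -
  obtain N where "\<And>M. M \<ge> N \<Longrightarrow> (\<Sum>k\<le>M. hcomp k f) = f" using sum_hcomp by blast
  then have f: "(\<Sum>k\<le>max N d. hcomp k f) = f" by simp
  have "f * g = (\<Sum>k\<le>max N d. g * hcomp k f)"
    unfolding sum_distrib_left[symmetric] f by (rule mult.commute)
  then have "hcomp d (f * g) = (\<Sum>k\<le>max N d. hcomp d (g * hcomp k f))"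
    by (simp add: hcomp_sum)
  also have "\<dots> = (\<Sum>k\<le>max N d. if k \<le> d then hcomp k f * hcomp (d - k) g else 0)"
    by (intro sum.cong refl) (auto simp: hcomp_mult_homog[OF homog_hcomp] mult.commute)
  also have "\<dots> = (\<Sum>k\<le>d. hcomp k f * hcomp (d - k) g)"
    by (rule sum.mono_neutral_cong_right) auto
  finally show ?thesis .
qed

lemma hcomp_Cst_mult: "hcomp d (Cst c * f) = Cst c * hcomp d f"
  using hcomp_mult_homog[OF homog_Cst[of c], of d f] by (simp add: mult.commute)

lemma dvd_hcomp: assumes "homog e q" "q dvd f" shows "q dvd hcomp d f"
  using assms(2) by (auto simp: dvd_def mult.commute[of q] hcomp_mult_homog[OF assms(1)] intro: exI[of _ 0])

text \<open>The component of degree d of f * g is a component of f times g; comparing it with f * g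
  and cancelling g gives both claims. The inequality makes the truncated subtraction
  \<open>d - e\<close> meaningful.\<close>

lemma homog_quotient:
  assumes "homog d (f * g)" "homog e g" "f * g \<noteq> 0"
  shows "e \<le> d" "homog (d - e) f"
proof -
  have *: "f * g = (if d < e then 0 else hcomp (d - e) f * g)"
    using assms(1) hcomp_mult_homog[OF assms(2), of d f] by (simp add: homog_def)
  then show "e \<le> d" using assms(3) by (auto split: if_splits)
  then have "g * f = g * hcomp (d - e) f" using * by (simp add: mult.commute)
  then show "homog (d - e) f"
    using pol_mult_left_cancel[of g f "hcomp (d - e) f"] assms(3) by (auto simp: homog_def)
qed

lemma homog_unit:
  assumes "homog d f" "f dvd 1"
  obtains c where "c \<noteq> 0" "f = Cst c" "d = 0"
proof -
  obtain g where g: "g * f = 1" using assms(2) by (auto simp: mult.commute elim!: dvdE)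
  have "d = 0"
    using homog_quotient(1)[of 0 g f d] assms(1) by (simp add: g homog_one)
  then have f: "f = Cst (Poly_Mapping.lookup f 0)" using assms(1) homog_0_Cst by blast
  moreover have "Poly_Mapping.lookup f 0 \<noteq> 0" using f g by (metis Cst_eq_0_iff mult_zero_right zero_neq_one)
  ultimately show ?thesis using \<open>d = 0\<close> that by blast
qed

section \<open>Determinants of families of derivations\<close>

text \<open>Rows are functions rather than vectors, so that \<open>\<eta>(k := x)\<close> replaces a
  derivation in a family.\<close>

definition dt :: "('n::finite \<Rightarrow> 'n \<Rightarrow> 'r::comm_ring_1) \<Rightarrow> 'r" where
  "dt \<eta> = det (\<chi> i j. \<eta> i j)"

lemma dt_row_sum:
  assumes "finite I"
  shows "dt (\<eta>(k := (\<lambda>j. \<Sum>i\<in>I. x i * u i j))) = (\<Sum>i\<in>I. x i * dt (\<eta>(k := u i)))"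
proof -
  have "dt (\<eta>(k := (\<lambda>j. \<Sum>i\<in>I. x i * u i j)))
      = det (\<chi> l. if l = k then (\<Sum>i\<in>I. x i *s vec_lambda (u i)) else vec_lambda (\<eta> l))"
    unfolding dt_def by (rule arg_cong[of _ _ det]) (simp add: vec_eq_iff sum_component)
  also have "\<dots> = (\<Sum>i\<in>I. x i * det (\<chi> l. if l = k then vec_lambda (u i) else vec_lambda (\<eta> l)))"
    unfolding det_linear_row_sum[OF assms] by (rule sum.cong[OF refl det_row_mul])
  also have "\<dots> = (\<Sum>i\<in>I. x i * dt (\<eta>(k := u i)))"
    unfolding dt_def
    by (rule sum.cong[OF refl], rule arg_cong[of _ _ "\<lambda>M. _ * det M"]) (simp add: vec_eq_iff)
  finally show ?thesis .
qed

lemma dt_row_lincomb: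
  "dt (\<eta>(k := (\<lambda>j. x * u j + y * w j))) = x * dt (\<eta>(k := u)) + y * dt (\<eta>(k := w))"
  using dt_row_sum[of UNIV \<eta> k "\<lambda>b. if b then x else y" "\<lambda>b. if b then u else w"]
  by (simp add: UNIV_bool add.commute)

lemma dt_row_mult: "dt (\<eta>(k := (\<lambda>j. x * u j))) = x * dt (\<eta>(k := u))"
  using dt_row_lincomb[of \<eta> k x u 0 u] by simp

lemma dt_eq_rows: assumes "i \<noteq> k" "\<eta> i = \<eta> k" shows "dt \<eta> = 0"
  unfolding dt_def by (rule det_identical_rows[OF assms(1)]) (simp add: row_def assms(2))

lemma dt_cramer_row: "dt (\<eta>(k := (\<lambda>j. \<Sum>i\<in>UNIV. x i * \<eta> i j))) = x k * dt \<eta>"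
proof -
  have "x i * dt (\<eta>(k := \<eta> i)) = (if i = k then x k * dt \<eta> else 0)" for i
    using dt_eq_rows[of i k "\<eta>(k := \<eta> i)"] by simp
  then show ?thesis unfolding dt_row_sum[OF finite] by simp
qed

lemma dt_transpose: "dt (\<lambda>i j. \<eta> j i) = dt \<eta>"
  using det_transpose[of "\<chi> i j. \<eta> i j"] by (simp add: dt_def transpose_def)

lemma dt_cramer_col: "dt (\<lambda>i j. if j = k then (\<Sum>l\<in>UNIV. x l * \<eta> i l) else \<eta> i j) = x k * dt \<eta>"
proof -
  have "dt (\<lambda>i j. if j = k then (\<Sum>l\<in>UNIV. x l * \<eta> i l) else \<eta> i j)
      = dt ((\<lambda>i j. \<eta> j i)(k := (\<lambda>j. \<Sum>i\<in>UNIV. x i * \<eta> j i)))"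
    by (subst dt_transpose[symmetric]) (rule arg_cong[of _ _ dt], auto simp: fun_eq_iff)
  also have "\<dots> = x k * dt \<eta>"
    unfolding dt_cramer_row[of "\<lambda>i j. \<eta> j i"] dt_transpose[of \<eta>] ..
  finally show ?thesis .
qed

lemma dt_mult: "dt (\<lambda>i j. \<Sum>k\<in>UNIV. c i k * \<eta> k j) = dt c * dt \<eta>"
  unfolding dt_def det_mul[symmetric] matrix_matrix_mult_def by simp

lemma dt_rows_mult: "dt (\<lambda>i j. x i * \<eta> i j) = prod x UNIV * dt \<eta>"
proof -
  have "dt (\<lambda>i j. x i * \<eta> i j) = det (\<chi> i. x i *s (\<chi> j. \<eta> i j))"
    unfolding dt_def by (rule arg_cong[of _ _ det]) (simp add: vec_eq_iff)
  then show ?thesis unfolding det_rows_mul by (simp add: dt_def)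
qed

text \<open>Steinitz exchange by determinants: expanding one row at a time in the spanning family
  writes a nonzero determinant as a combination of determinants, one of which must be
  nonzero.\<close>

lemma dt_exchange:
  assumes "finite I" "dt \<eta> \<noteq> 0" "\<And>i. \<eta> i = (\<lambda>j. \<Sum>b\<in>I. c i b * u b j)"
  obtains f where "\<forall>i. f i \<in> I" "dt (\<lambda>i. u (f i)) \<noteq> 0"
proof -
  have "\<exists>f. (\<forall>i\<in>T. f i \<in> I) \<and> dt (\<lambda>i. if i \<in> T then u (f i) else \<eta> i) \<noteq> 0" for T
    using finite[of T]
  proof (induction T rule: finite_induct)
    case empty
    then show ?case using assms(2) by simp
  next
    case (insert k T)
    then obtain f where f: "\<forall>i\<in>T. f i \<in> I" "dt (\<lambda>i. if i \<in> T then u (f i) else \<eta> i) \<noteq> 0" by blast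
    define \<xi> where "\<xi> = (\<lambda>i. if i \<in> T then u (f i) else \<eta> i)"
    have eq: "\<xi> = \<xi>(k := (\<lambda>j. \<Sum>b\<in>I. c k b * u b j))"
      using assms(3)[of k] insert.hyps(2) by (simp add: \<xi>_def fun_eq_iff)
    have "dt \<xi> = (\<Sum>b\<in>I. c k b * dt (\<xi>(k := u b)))"
      unfolding dt_row_sum[OF assms(1), symmetric] by (rule arg_cong[OF eq])
    then have "(\<Sum>b\<in>I. c k b * dt (\<xi>(k := u b))) \<noteq> 0"
      using f(2) unfolding \<xi>_def by simp
    then obtain b where "b \<in> I" "c k b * dt (\<xi>(k := u b)) \<noteq> 0"
      by (rule sum.not_neutral_contains_not_neutral)
    then have b: "b \<in> I" "dt (\<xi>(k := u b)) \<noteq> 0" by auto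
    have "\<xi>(k := u b) = (\<lambda>i. if i \<in> insert k T then u ((f(k := b)) i) else \<eta> i)"
      by (auto simp: \<xi>_def fun_eq_iff)
    then show ?case using b f(1) by (intro exI[of _ "f(k := b)"]) simp
  qed
  from this[of UNIV] show ?thesis using that by auto
qed

lemma dt_dvd_col: assumes "\<And>i. g dvd \<eta> i k" shows "g dvd dt \<eta>"
  unfolding dt_def det_def
proof (intro dvd_sum dvd_mult)
  fix p assume "p \<in> {p. p permutes (UNIV :: 'a set)}"
  then have "p (inv p k) = k" using permutes_inverses(1)[of p UNIV k] by simp
  then have "g dvd \<eta> (inv p k) (p (inv p k))" using assms by simp
  then show "g dvd (\<Prod>i\<in>UNIV. (\<chi> i j. \<eta> i j) $ i $ p i)"
    by (simp add: dvd_prod_eqI[of _ "inv p k"] dvd_trans[OF _ dvd_prodI])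
qed

lemma dt_one: "dt (\<lambda>i j :: 'n::finite. of_bool (i = j) :: 'r::comm_ring_1) = 1"
proof -
  have "(\<chi> i j. of_bool (i = j)) = (mat 1 :: 'r^'n^'n)" by (simp add: mat_def vec_eq_iff)
  then show ?thesis unfolding dt_def by simp
qed

lemma homog_dt:
  fixes \<eta> :: "'n::finite \<Rightarrow> 'n \<Rightarrow> ('n, 'a::field) pol"
  assumes "\<And>i j. homog (d i) (\<eta> i j)" shows "homog (sum d UNIV) (dt \<eta>)"
  unfolding dt_def det_def
proof (intro homog_sum)
  fix p :: "'n \<Rightarrow> 'n"
  have "homog (sum d UNIV) (\<Prod>i\<in>UNIV. (\<chi> i j. \<eta> i j) $ i $ p i)"
    using assms by (intro homog_prod) simp
  then show "homog (sum d UNIV) (of_int (sign p) * (\<Prod>i\<in>UNIV. (\<chi> i j. \<eta> i j) $ i $ p i))"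
    by (cases p rule: sign_cases) (simp_all add: homog_uminus)
qed

text \<open>Both sides are the cofactor at (k, j): in either Leibniz sum only the permutations with
  p k = j contribute.\<close>

lemma dt_cofactor:
  fixes \<eta> :: "'n::finite \<Rightarrow> 'n \<Rightarrow> 'r::comm_ring_1"
  shows "dt (\<eta>(k := (\<lambda>l. of_bool (l = j)))) = dt (\<lambda>i l. if l = j then of_bool (i = k) else \<eta> i l)"
  unfolding dt_def det_def
proof (rule sum.cong[OF refl])
  fix p :: "'n \<Rightarrow> 'n" assume "p \<in> {p. p permutes UNIV}"
  then have inj: "p i = p i' \<longleftrightarrow> i = i'" and surj: "\<exists>i. p i = i'" for i i'
    using permutes_inj[of p UNIV] permutes_surj[of p UNIV] by (auto dest: injD) (metis surjD)
  have "(\<Prod>i\<in>UNIV. (\<eta>(k := (\<lambda>l. of_bool (l = j)))) i (p i))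
      = (\<Prod>i\<in>UNIV. if p i = j then of_bool (i = k) else \<eta> i (p i))"
  proof (cases "p k = j")
    case True
    then show ?thesis using inj by (intro prod.cong) auto
  next
    case False
    obtain i where "p i = j" using surj by blast
    then have "(\<Prod>i\<in>UNIV. if p i = j then of_bool (i = k) else \<eta> i (p i)) = 0"
      using False by (intro prod_zero) auto
    moreover have "(\<Prod>i\<in>UNIV. (\<eta>(k := (\<lambda>l. of_bool (l = j)))) i (p i)) = 0"
      using False by (intro prod_zero bexI[of _ k]) auto
    ultimately show ?thesis by simp
  qed
  then show "of_int (sign p) * (\<Prod>i\<in>UNIV. (\<chi> i l. (\<eta>(k := (\<lambda>l. of_bool (l = j)))) i l) $ i $ p i)
      = of_int (sign p) * (\<Prod>i\<in>UNIV. (\<chi> i l. if l = j then of_bool (i = k) else \<eta> i l) $ i $ p i)"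
    by simp
qed

lemma sum_of_bool_mult:
  fixes x :: "'n::finite \<Rightarrow> 'r::comm_ring_1"
  shows "(\<Sum>j\<in>UNIV. x j * of_bool (l = j)) = x l"
proof -
  have "(\<Sum>j\<in>UNIV. x j * of_bool (l = j)) = (\<Sum>j\<in>UNIV. if j = l then x l else 0)"
    by (rule sum.cong) auto
  then show ?thesis by simp
qed

text \<open>Cramer's rule without division. Expanding the replaced row in unit vectors produces
  cofactors, which are read as row replacements in the transpose; summed against a column they give
  the determinant itself or one with two equal rows.\<close>

lemma dt_adjugate:
  fixes \<eta> :: "'n::finite \<Rightarrow> 'n \<Rightarrow> 'r::comm_ring_1"
  shows "(\<Sum>k\<in>UNIV. dt (\<eta>(k := x)) * \<eta> k l) = dt \<eta> * x l"
proof -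
  define \<theta> where "\<theta> = (\<lambda>i j. \<eta> j i)"
  have row: "dt (\<eta>(k := x)) = (\<Sum>j\<in>UNIV. x j * dt (\<theta>(j := (\<lambda>i. of_bool (i = k)))))" for k
  proof -
    have "dt (\<eta>(k := x)) = (\<Sum>j\<in>UNIV. x j * dt (\<eta>(k := (\<lambda>l. of_bool (l = j)))))"
      unfolding dt_row_sum[OF finite, symmetric] sum_of_bool_mult ..
    moreover have "dt (\<eta>(k := (\<lambda>l. of_bool (l = j)))) = dt (\<theta>(j := (\<lambda>i. of_bool (i = k))))" for j
    proof -
      have "(\<lambda>i l. (\<theta>(j := (\<lambda>i. of_bool (i = k)))) l i) = (\<lambda>i l. if l = j then of_bool (i = k) else \<eta> i l)"
        by (auto simp: \<theta>_def fun_eq_iff)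
      from arg_cong[OF this, of dt]
      have eq: "dt (\<theta>(j := (\<lambda>i. of_bool (i = k)))) = dt (\<lambda>i l. if l = j then of_bool (i = k) else \<eta> i l)"
        by (simp only: dt_transpose[of "\<theta>(j := (\<lambda>i. of_bool (i = k)))"])
      show ?thesis unfolding eq by (rule dt_cofactor)
    qed
    ultimately show ?thesis by simp
  qed
  have col: "(\<Sum>k\<in>UNIV. \<eta> k l * dt (\<theta>(j := (\<lambda>i. of_bool (i = k))))) = (if j = l then dt \<eta> else 0)" for j
  proof -
    have "(\<Sum>k\<in>UNIV. \<eta> k l * dt (\<theta>(j := (\<lambda>i. of_bool (i = k))))) = dt (\<theta>(j := (\<lambda>i. \<eta> i l)))"
      unfolding dt_row_sum[OF finite, symmetric] sum_of_bool_mult ..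
    also have "dt (\<theta>(j := (\<lambda>i. \<eta> i l))) = (if j = l then dt \<eta> else 0)"
    proof (cases "j = l")
      case True
      have "dt \<theta> = dt \<eta>" unfolding \<theta>_def by (rule dt_transpose)
      moreover have "\<theta>(l := (\<lambda>i. \<eta> i l)) = \<theta>" by (auto simp: \<theta>_def)
      ultimately show ?thesis using True by simp
    next
      case False
      then show ?thesis using dt_eq_rows[of l j "\<theta>(j := \<theta> l)"] by (simp add: \<theta>_def)
    qed
    finally show ?thesis .
  qed
  have "(\<Sum>k\<in>UNIV. dt (\<eta>(k := x)) * \<eta> k l)
      = (\<Sum>j\<in>UNIV. \<Sum>k\<in>UNIV. x j * (\<eta> k l * dt (\<theta>(j := (\<lambda>i. of_bool (i = k))))))"
    unfolding row sum_distrib_right by (subst sum.swap) (simp only: mult_ac)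
  also have "\<dots> = (\<Sum>j\<in>UNIV. x j * (if j = l then dt \<eta> else 0))"
    unfolding sum_distrib_left[symmetric] col ..
  also have "\<dots> = (\<Sum>j\<in>UNIV. if j = l then dt \<eta> * x l else 0)"
    by (rule sum.cong) auto
  finally show ?thesis by simp
qed

lemma dt_elementary:
  fixes x :: "'n::finite \<Rightarrow> 'r::comm_ring_1"
  shows "dt (\<lambda>i j. if j = p then x i else of_bool (i = j)) = x p"
proof -
  have "dt (\<lambda>i j. if j = p then (\<Sum>l\<in>UNIV. x l * of_bool (i = l)) else of_bool (i = j)) = x p * dt (\<lambda>i j :: 'n. of_bool (i = j))"
    by (rule dt_cramer_col)
  then show ?thesis unfolding sum_of_bool_mult dt_one by simp
qed

section \<open>Derivations and linear forms\<close>

definition dot :: "('n::finite \<Rightarrow> 'a::field) \<Rightarrow> ('n \<Rightarrow> 'a) \<Rightarrow> 'a" where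
  "dot a v = (\<Sum>i\<in>UNIV. a i * v i)"

lemma dot_ker_subset:
  assumes "\<exists>i. a i \<noteq> 0" "\<And>v. dot a v = 0 \<Longrightarrow> dot b v = 0"
  obtains s where "\<And>i. b i = s * a i"
proof -
  obtain p where p: "a p \<noteq> 0" using assms(1) by blast
  have "b j = b p / a p * a j" for j
  proof -
    \<comment> \<open>The vector e_j - (a_j / a_p) e_p of the kernel of a; testing b on it yields
      the entry b_j.\<close>
    define v where "v i = of_bool (i = j) - (if i = p then a j / a p else 0)" for i
    have dv: "dot c v = c j - c p * (a j / a p)" for c
    proof -
      have "c i * v i = (if i = j then c j else 0) - (if i = p then c p * (a j / a p) else 0)" for i
        by (simp add: v_def right_diff_distrib)
      then show ?thesis by (simp add: dot_def sum_subtractf)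
    qed
    show ?thesis using assms(2)[of v] p unfolding dv by (simp add: field_simps)
  qed
  then show ?thesis using that by blast
qed

lemma der_app_add: "der_app (\<lambda>i. \<theta> i + \<phi> i) a = der_app \<theta> a + der_app \<phi> a"
  and der_app_diff: "der_app (\<lambda>i. \<theta> i - \<phi> i) a = der_app \<theta> a - der_app \<phi> a"
  and der_app_mult: "der_app (\<lambda>i. f * \<theta> i) a = f * der_app \<theta> a"
  by (simp_all add: der_app_def distrib_left right_diff_distrib sum.distrib sum_subtractf
      sum_distrib_left mult.left_commute)

lemma der_app_sum: "der_app (\<lambda>i. \<Sum>j\<in>J. \<theta> j i) a = (\<Sum>j\<in>J. der_app (\<theta> j) a)"
  unfolding der_app_def sum_distrib_left by (rule sum.swap)

lemma der_app_form_scale: "der_app \<theta> (\<lambda>i. s * a i) = Cst s * der_app \<theta> a"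
  and der_app_form_add: "der_app \<theta> (\<lambda>i. a i + b i) = der_app \<theta> a + der_app \<theta> b"
  by (simp_all add: der_app_def Cst_simps sum_distrib_left mult.assoc distrib_right sum.distrib)

lemma der_app_const: "der_app (\<lambda>i. Cst (v i)) a = Cst (dot a v)"
proof -
  have "(\<Sum>i\<in>I. (Cst (h i) :: ('a, 'b) pol)) = Cst (sum h I)" for h :: "'a \<Rightarrow> 'b" and I
    by (induction I rule: infinite_finite_induct) (simp_all add: Cst_simps)
  then show ?thesis by (simp add: der_app_def dot_def flip: Cst_simps(4))
qed

lemma hcomp_der_app: "hcomp d (der_app \<theta> a) = der_app (\<lambda>i. hcomp d (\<theta> i)) a"
  by (simp add: der_app_def hcomp_sum hcomp_Cst_mult)

lemma dt_der_app_col: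
  "dt (\<lambda>i j. if j = k then der_app (\<eta> i) a else \<eta> i j) = Cst (a k) * dt \<eta>"
  unfolding der_app_def by (rule dt_cramer_col)

text \<open>Replacing a column k with a_k nonzero by the column of values on the form a changes the
  determinant only by the unit a_k. This is the source of every divisibility of determinants
  below.\<close>

lemma dvd_dt_if_dvd_der_app:
  assumes "\<exists>i. a i \<noteq> 0" "\<And>i. g dvd der_app (\<eta> i) a" shows "g dvd dt \<eta>"
proof -
  obtain k where k: "a k \<noteq> 0" using assms(1) by blast
  have "g dvd Cst (a k) * dt \<eta>"
    unfolding dt_der_app_col[symmetric] using assms(2) by (intro dt_dvd_col[of _ _ k]) simp
  then have "g dvd Cst (inverse (a k)) * (Cst (a k) * dt \<eta>)" by (rule dvd_mult)
  also have "\<dots> = Cst (a k) * Cst (inverse (a k)) * dt \<eta>" by (simp only: mult_ac)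
  finally show ?thesis unfolding Cst_inverse[OF k] by simp
qed

lemma dt_eq_0_if_der_app:
  assumes "\<exists>i. a i \<noteq> 0" "\<And>i. der_app (\<eta> i) a = 0" shows "dt \<eta> = 0"
  using dvd_dt_if_dvd_der_app[of a 0 \<eta>] assms by simp

lemma elim_dt:
  fixes a :: "'n::finite \<Rightarrow> 'a::field"
  shows "elim a (dt \<eta>) = dt (\<lambda>i j :: 'k::finite. elim a (\<eta> i j))"
proof -
  have sg: "elim a (of_int (sign p) * f) = of_int (sign p) * elim a f" for p :: "'k \<Rightarrow> 'k" and f
    by (cases p rule: sign_cases) (simp_all add: elim_diff[of a 0, simplified elim_zero, simplified])
  show ?thesis unfolding dt_def det_def by (simp add: elim_sum sg elim_prod)
qed

lemma elim_der_app: "elim a (der_app \<theta> b) = der_app (\<lambda>i. elim a (\<theta> i)) b"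
  by (simp add: der_app_def elim_sum elim_mult elim_Cst)

lemma dot_add: "dot a (\<lambda>i. u i + w i) = dot a u + dot a w"
  and dot_scale: "dot a (\<lambda>i. s * u i) = s * dot a u"
  and dot_form_add: "dot (\<lambda>i. a i + b i) u = dot a u + dot b u"
  and dot_form_scale: "dot (\<lambda>i. s * a i) u = s * dot a u"
  by (simp_all add: dot_def distrib_left distrib_right sum.distrib sum_distrib_left mult_ac)

lemma form_lincomb:
  assumes "\<forall>i. c i = x * a i + y * b i"
  shows "dot c v = x * dot a v + y * dot b v"
    and "linf c = Cst x * linf a + Cst y * linf b"
    and "der_app \<theta> c = Cst x * der_app \<theta> a + Cst y * der_app \<theta> b"
proof -
  have c: "c = (\<lambda>i. x * a i + y * b i)" using assms by blast
  show "dot c v = x * dot a v + y * dot b v" unfolding c dot_form_add dot_form_scale ..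
  show "linf c = Cst x * linf a + Cst y * linf b" unfolding c linf_add linf_scale ..
  show "der_app \<theta> c = Cst x * der_app \<theta> a + Cst y * der_app \<theta> b"
    unfolding c der_app_form_add der_app_form_scale ..
qed

lemma dot_unit: "dot a (\<lambda>j. of_bool (i = j)) = a i"
  unfolding dot_def by (rule sum_of_bool_mult)

text \<open>The vectors u and w are dual to a and b, so e_i - a_i u - b_i w lies in both kernels,
  and c vanishes on it.\<close>

lemma form_in_span:
  fixes a b c u w :: "'n::finite \<Rightarrow> 'k::field"
  assumes u: "dot a u = 1" "dot b u = 0" and w: "dot a w = 0" "dot b w = 1"
    and ker: "\<And>v. dot a v = 0 \<Longrightarrow> dot b v = 0 \<Longrightarrow> dot c v = 0"
  shows "c i = dot c u * a i + dot c w * b i"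
proof -
  define e where "e j = (of_bool (i = j) :: 'k)" for j
  define v where "v j = e j + (- a i * u j + - b i * w j)" for j
  have dv: "dot d v = d i - a i * dot d u - b i * dot d w" for d
    unfolding v_def dot_add dot_scale by (simp add: e_def dot_unit)
  have "dot c v = 0" using u w by (intro ker) (simp_all add: dv)
  then show ?thesis by (simp add: dv algebra_simps)
qed

text \<open>After subtracting a(x) v from x, all rows annihilate the nonzero form a, so the
  determinant vanishes. Hence the determinant depends on row k only through its value on a.\<close>

lemma dt_eval:
  assumes a: "\<exists>i. a i \<noteq> 0" and rows: "\<And>i. i \<noteq> k \<Longrightarrow> der_app (\<eta> i) a = 0" and v: "der_app v a = 1"
  shows "dt (\<eta>(k := x)) = der_app x a * dt (\<eta>(k := v))"
proof -
  have "dt (\<eta>(k := (\<lambda>j. 1 * x j + - der_app x a * v j))) = 0"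
  proof (rule dt_eq_0_if_der_app[OF a])
    fix i
    have "der_app (\<lambda>j. 1 * x j + - der_app x a * v j) a = 0"
      unfolding der_app_add der_app_mult v by simp
    then show "der_app ((\<eta>(k := (\<lambda>j. 1 * x j + - der_app x a * v j))) i) a = 0"
      using rows by simp
  qed
  then show ?thesis unfolding dt_row_lincomb by simp
qed

section \<open>Homogeneous bases\<close>

lemma sum_hcomp_fun:
  fixes \<theta> :: "'n::finite \<Rightarrow> ('n, 'a::field) pol"
  obtains N where "\<And>i. (\<Sum>d\<le>N. hcomp d (\<theta> i)) = \<theta> i"
proof -
  have "\<exists>N. \<forall>M\<ge>N. (\<Sum>d\<le>M. hcomp d (\<theta> i)) = \<theta> i" for i
    using sum_hcomp[of "\<theta> i"] by metis
  then obtain N where N: "\<And>i M. M \<ge> N i \<Longrightarrow> (\<Sum>d\<le>M. hcomp d (\<theta> i)) = \<theta> i" by metis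
  have "(\<Sum>d\<le>Max (range N). hcomp d (\<theta> i)) = \<theta> i" for i by (rule N) simp
  then show ?thesis using that by blast
qed

definition homogT :: "nat \<Rightarrow> ('n::finite \<Rightarrow> ('n, 'a::field) pol) \<Rightarrow> bool" where
  "homogT d \<theta> \<longleftrightarrow> (\<forall>i. homog d (\<theta> i))"

lemma homogT_hcomp: "homogT d (\<lambda>i. hcomp d (\<theta> i))"
  by (simp add: homogT_def homog_hcomp)

text \<open>Intended for finite B; a sum over an infinite set is 0 by convention.\<close>

definition spn :: "('n::finite, 'a::field) pol \<Rightarrow> ('n \<Rightarrow> ('n, 'a) pol) set \<Rightarrow> ('n \<Rightarrow> ('n, 'a) pol) set" where
  "spn q B = {\<theta>. \<exists>c. cong_der q \<theta> (\<lambda>i. \<Sum>b\<in>B. c b * b i)}"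

lemma cong_der_refl: "cong_der q \<theta> \<theta>"
  by (simp add: cong_der_def)

lemma cong_der_sym: "cong_der q \<theta> \<phi> \<Longrightarrow> cong_der q \<phi> \<theta>"
  unfolding cong_der_def by (metis dvd_minus_iff minus_diff_eq)

lemma cong_der_trans [trans]:
  assumes "cong_der q \<theta> \<phi>" "cong_der q \<phi> \<xi>" shows "cong_der q \<theta> \<xi>"
  unfolding cong_der_def
proof
  fix i
  have "q dvd (\<theta> i - \<phi> i) + (\<phi> i - \<xi> i)"
    using assms unfolding cong_der_def by (intro dvd_add) simp_all
  then show "q dvd \<theta> i - \<xi> i" by simp
qed

lemma cong_der_add: "cong_der q \<theta> \<phi> \<Longrightarrow> cong_der q \<theta>' \<phi>' \<Longrightarrow> cong_der q (\<lambda>i. \<theta> i + \<theta>' i) (\<lambda>i. \<phi> i + \<phi>' i)"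
  by (simp add: cong_der_def add_diff_add)

lemma cong_der_diff: "cong_der q \<theta> \<phi> \<Longrightarrow> cong_der q \<theta>' \<phi>' \<Longrightarrow> cong_der q (\<lambda>i. \<theta> i - \<theta>' i) (\<lambda>i. \<phi> i - \<phi>' i)"
  unfolding cong_der_def
proof
  fix i assume "\<forall>i. q dvd \<theta> i - \<phi> i" "\<forall>i. q dvd \<theta>' i - \<phi>' i"
  then have "q dvd (\<theta> i - \<phi> i) - (\<theta>' i - \<phi>' i)" by simp
  then show "q dvd \<theta> i - \<theta>' i - (\<phi> i - \<phi>' i)" by (simp add: algebra_simps)
qed

lemma cong_der_mult: "cong_der q \<theta> \<phi> \<Longrightarrow> cong_der q (\<lambda>i. f * \<theta> i) (\<lambda>i. f * \<phi> i)"
  by (simp add: cong_der_def flip: right_diff_distrib)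

lemma cong_der_sum:
  "(\<And>j. j \<in> J \<Longrightarrow> cong_der q (\<theta> j) (\<phi> j)) \<Longrightarrow> cong_der q (\<lambda>i. \<Sum>j\<in>J. \<theta> j i) (\<lambda>i. \<Sum>j\<in>J. \<phi> j i)"
  by (simp add: cong_der_def dvd_sum flip: sum_subtractf)

lemma cong_der_0: "cong_der 0 \<theta> \<phi> \<longleftrightarrow> \<theta> = \<phi>"
  by (auto simp: cong_der_def fun_eq_iff)

lemma spn_zero: "(\<lambda>i. 0) \<in> spn q B"
  unfolding spn_def by (intro CollectI exI[of _ "\<lambda>b. 0"]) (simp add: cong_der_def)

lemma spn_add: assumes "\<theta> \<in> spn q B" "\<phi> \<in> spn q B" shows "(\<lambda>i. \<theta> i + \<phi> i) \<in> spn q B"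
proof -
  obtain c d where "cong_der q \<theta> (\<lambda>i. \<Sum>b\<in>B. c b * b i)" "cong_der q \<phi> (\<lambda>i. \<Sum>b\<in>B. d b * b i)"
    using assms unfolding spn_def by blast
  then have "cong_der q (\<lambda>i. \<theta> i + \<phi> i) (\<lambda>i. \<Sum>b\<in>B. (c b + d b) * b i)"
    unfolding distrib_right sum.distrib by (rule cong_der_add)
  then show ?thesis unfolding spn_def by (intro CollectI exI[of _ "\<lambda>b. c b + d b"])
qed

lemma spn_mult: assumes "\<theta> \<in> spn q B" shows "(\<lambda>i. f * \<theta> i) \<in> spn q B"
proof -
  obtain c where "cong_der q \<theta> (\<lambda>i. \<Sum>b\<in>B. c b * b i)"
    using assms unfolding spn_def by blast
  then have "cong_der q (\<lambda>i. f * \<theta> i) (\<lambda>i. \<Sum>b\<in>B. (f * c b) * b i)"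
    unfolding mult.assoc sum_distrib_left[symmetric] by (rule cong_der_mult)
  then show ?thesis unfolding spn_def by (intro CollectI exI[of _ "\<lambda>b. f * c b"])
qed

lemma spn_sum: "(\<And>j. j \<in> J \<Longrightarrow> \<theta> j \<in> spn q B) \<Longrightarrow> (\<lambda>i. \<Sum>j\<in>J. \<theta> j i) \<in> spn q B"
  by (induction J rule: infinite_finite_induct) (simp_all add: spn_zero spn_add)

lemma spn_cong: "cong_der q \<theta> \<phi> \<Longrightarrow> \<phi> \<in> spn q B \<Longrightarrow> \<theta> \<in> spn q B"
  unfolding spn_def by (blast intro: cong_der_trans)

lemma spn_base: assumes "finite B" "b \<in> B" shows "b \<in> spn q B"
proof -
  have "(\<lambda>i. \<Sum>x\<in>B. of_bool (x = b) * x i) = b"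
  proof
    fix i
    have "(\<Sum>x\<in>B. of_bool (x = b) * x i) = (\<Sum>x\<in>B. if x = b then b i else 0)"
      by (rule sum.cong) auto
    then show "(\<Sum>x\<in>B. of_bool (x = b) * x i) = b i" using assms by simp
  qed
  then show ?thesis
    unfolding spn_def by (intro CollectI exI[of _ "\<lambda>x. of_bool (x = b)"]) (simp only: cong_der_refl)
qed

lemma spn_trans: assumes "G \<subseteq> spn q B" "\<theta> \<in> spn q G" shows "\<theta> \<in> spn q B"
proof -
  obtain c where c: "cong_der q \<theta> (\<lambda>i. \<Sum>b\<in>G. c b * b i)"
    using assms(2) unfolding spn_def by blast
  show ?thesis
    by (rule spn_cong[OF c]) (use assms(1) in \<open>intro spn_sum spn_mult; blast\<close>)
qed

lemma spn_mono: assumes "finite B'" "B \<subseteq> B'" shows "spn q B \<subseteq> spn q B'"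
  using spn_trans[of B q B'] spn_base[OF assms(1)] assms(2) by blast

text \<open>The finite counterpart of \<open>free_mod_over\<close>. Independence is asked for B as a
  whole; for a subset, pad the coefficients by 0.\<close>

definition is_basis :: "('n::finite, 'a::field) pol \<Rightarrow> ('n \<Rightarrow> ('n, 'a) pol) set \<Rightarrow> ('n \<Rightarrow> ('n, 'a) pol) set \<Rightarrow> bool" where
  "is_basis q M B \<longleftrightarrow> finite B \<and> B \<subseteq> M \<and> M \<subseteq> spn q B \<and>
     (\<forall>c. cong_der q (\<lambda>i. \<Sum>b\<in>B. c b * b i) (\<lambda>i. 0) \<longrightarrow> (\<forall>b\<in>B. q dvd c b))"

lemma is_basis_imp_free:
  assumes "is_basis q M B" shows "free_mod_over q M"
  unfolding free_mod_over_def
proof (rule exI[of _ B], intro conjI allI impI ballI)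
  show "B \<subseteq> M" using assms by (simp add: is_basis_def)
  show "\<exists>B'\<subseteq>B. finite B' \<and> (\<exists>c. cong_der q \<theta> (\<lambda>i. \<Sum>b\<in>B'. c b * b i))" if "\<theta> \<in> M" for \<theta>
    using assms that unfolding is_basis_def spn_def by blast
  fix B' c b
  assume B': "B' \<subseteq> B" "cong_der q (\<lambda>i. \<Sum>b\<in>B'. c b * b i) (\<lambda>i. 0)" "b \<in> B'"
  define c' where "c' b = (if b \<in> B' then c b else 0)" for b
  have fin: "finite B" using assms by (simp add: is_basis_def)
  have "(\<Sum>b\<in>B. c' b * b i) = (\<Sum>b\<in>B'. c b * b i)" for i
    using B'(1) fin by (intro sum.mono_neutral_cong_right) (auto simp: c'_def)
  then have "cong_der q (\<lambda>i. \<Sum>b\<in>B. c' b * b i) (\<lambda>i. 0)" using B'(2) by simp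
  then have "q dvd c' b" using assms B' unfolding is_basis_def by blast
  then show "q dvd c b" using B'(3) by (simp add: c'_def)
qed

text \<open>Only finitely many basis elements C occur in the expansions of G. For any further basis
  element b, the expansion of s b over C would be a relation with coefficient s at b, although q
  does not divide s.\<close>

lemma free_imp_is_basis:
  assumes free: "free_mod_over q M" and G: "finite G" "G \<subseteq> M"
    and s: "\<not> q dvd s" "\<And>\<theta>. \<theta> \<in> M \<Longrightarrow> (\<lambda>i. s * \<theta> i) \<in> spn q G"
  obtains B where "is_basis q M B"
proof -
  obtain B where B: "B \<subseteq> M"
    and span: "\<And>\<theta>. \<theta> \<in> M \<Longrightarrow> \<exists>B'\<subseteq>B. finite B' \<and> \<theta> \<in> spn q B'"
    and indep: "\<And>B' c. B' \<subseteq> B \<Longrightarrow> finite B' \<Longrightarrow> cong_der q (\<lambda>i. \<Sum>b\<in>B'. c b * b i) (\<lambda>i. 0)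
         \<Longrightarrow> \<forall>b\<in>B'. q dvd c b"
  proof -
    from free[unfolded free_mod_over_def] obtain B where
      "B \<subseteq> M \<and> (\<forall>\<theta>\<in>M. \<exists>B' \<subseteq> B. finite B' \<and> (\<exists>c. cong_der q \<theta> (\<lambda>i. \<Sum>b\<in>B'. c b * b i))) \<and>
        (\<forall>B' \<subseteq> B. finite B' \<longrightarrow> (\<forall>c. cong_der q (\<lambda>i. \<Sum>b\<in>B'. c b * b i) (\<lambda>i. 0) \<longrightarrow> (\<forall>b\<in>B'. q dvd c b)))" ..
    then show thesis by (intro that[of B]) (auto simp: spn_def)
  qed
  have "\<forall>g\<in>G. \<exists>B'\<subseteq>B. finite B' \<and> g \<in> spn q B'"
    using span G(2) by blast
  then obtain Bg where Bg: "\<And>g. g \<in> G \<Longrightarrow> Bg g \<subseteq> B \<and> finite (Bg g) \<and> g \<in> spn q (Bg g)"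
    by metis
  define C where "C = (\<Union>g\<in>G. Bg g)"
  have C: "finite C" "C \<subseteq> B" using Bg G(1) by (auto simp: C_def)
  have "g \<in> spn q C" if "g \<in> G" for g
    using spn_mono[OF C(1), of "Bg g" q] Bg[OF that] that by (auto simp: C_def)
  then have sC: "(\<lambda>i. s * \<theta> i) \<in> spn q C" if "\<theta> \<in> M" for \<theta>
    using spn_trans[of G q C] s(2)[OF that] by blast
  have "b \<in> C" if "b \<in> B" for b
  proof (rule ccontr)
    assume b: "b \<notin> C"
    obtain c where c: "cong_der q (\<lambda>i. s * b i) (\<lambda>i. \<Sum>x\<in>C. c x * x i)"
      using sC[of b] B \<open>b \<in> B\<close> by (auto simp: spn_def)
    define c' where "c' = (\<lambda>x. - c x)(b := s)"
    have sum_eq: "(\<Sum>x\<in>insert b C. c' x * x i) = s * b i - (\<Sum>x\<in>C. c x * x i)" for i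
    proof -
      have "(\<Sum>x\<in>C. c' x * x i) = (\<Sum>x\<in>C. - (c x * x i))"
        using b by (intro sum.cong) (auto simp: c'_def)
      then show ?thesis using b C(1) by (simp add: c'_def sum_negf)
    qed
    have "cong_der q (\<lambda>i. \<Sum>x\<in>insert b C. c' x * x i) (\<lambda>i. 0)"
      unfolding sum_eq using c by (simp add: cong_der_def)
    then have "q dvd c' b" using indep[of "insert b C" c'] C \<open>b \<in> B\<close> by blast
    then show False using s(1) by (simp add: c'_def)
  qed
  then have "B = C" using C(2) by blast
  have "M \<subseteq> spn q B"
    using span spn_mono[OF C(1)] unfolding \<open>B = C\<close> by blast
  then have "is_basis q M B"
    using indep[of B] C(1) B unfolding is_basis_def \<open>B = C\<close> by blast
  then show ?thesis using that by blast
qed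

lemma lookup_Cst_mult: "Poly_Mapping.lookup (Cst c * f) t = c * Poly_Mapping.lookup f t"
  by (simp add: Cst_def Poly_Mapping.map.rep_eq when_def flip: mult_map_scale_conv_mult)

text \<open>The vectors of constant terms of the coordinates of homogeneous elements span the constant
  vectors; a maximal linearly independent subset of them lifts to a homogeneous basis, by comparing
  components of lowest degree and by a graded version of Nakayama's lemma. The map \<open>\<psi>\<close>
  embeds the quotient by q linearly into the polynomials.\<close>

lemma homogeneous_basis:
  fixes q :: "('n::finite, 'a::field) pol" and M :: "('n \<Rightarrow> ('n, 'a) pol) set"
  assumes q: "homog 1 q" and psi: "\<And>f. q dvd f \<longleftrightarrow> \<psi> f = 0"
    and psi_add: "\<And>f g. \<psi> (f + g) = \<psi> f + \<psi> g" and psi_mult: "\<And>c f. \<psi> (Cst c * f) = Cst c * (\<psi> f :: ('n, 'a) pol)"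
    and M_hcomp: "\<And>\<theta> d. \<theta> \<in> M \<Longrightarrow> (\<lambda>i. hcomp d (\<theta> i)) \<in> M"
    and basis: "is_basis q M B"
  obtains B' where "is_basis q M B'" "\<And>b. b \<in> B' \<Longrightarrow> \<exists>d. homogT d b"
proof -
  have fin: "finite B" and BM: "B \<subseteq> M" and span: "M \<subseteq> spn q B"
    and indep: "\<And>c b. cong_der q (\<lambda>i. \<Sum>b\<in>B. c b * b i) (\<lambda>i. 0) \<Longrightarrow> b \<in> B \<Longrightarrow> q dvd c b"
    using basis unfolding is_basis_def by auto
  obtain cf where cf: "\<And>\<theta>. \<theta> \<in> M \<Longrightarrow> cong_der q \<theta> (\<lambda>i. \<Sum>b\<in>B. cf \<theta> b * b i)"
  proof -
    have "\<forall>\<theta>\<in>M. \<exists>c. cong_der q \<theta> (\<lambda>i. \<Sum>b\<in>B. c b * b i)"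
      using span by (auto simp: spn_def)
    from bchoice[OF this] show thesis using that by blast
  qed
  have psi_sum: "\<psi> (sum h I) = (\<Sum>i\<in>I. \<psi> (h i))" for h :: "(('n \<Rightarrow> ('n, 'a) pol) \<Rightarrow> 'a) \<Rightarrow> ('n, 'a) pol" and I
    using psi[of 0] by (induction I rule: infinite_finite_induct) (simp_all add: psi_add)
  let ?sc = "\<lambda>(c::'a) (v :: ('n \<Rightarrow> ('n, 'a) pol) \<Rightarrow> 'a) b. c * v b"
  interpret vs: vector_space ?sc
    by standard (auto simp: fun_eq_iff algebra_simps)
  \<comment> \<open>The class of \<theta> modulo the ideal of the variables, in coordinates with
    respect to B and for the chosen expansion \<open>cf\<close>.\<close>
  define vec where "vec \<theta> = (\<lambda>b. if b \<in> B then Poly_Mapping.lookup (cf \<theta> b) 0 else 0)" for \<theta>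
  define W where "W = vec ` {\<theta> \<in> M. \<exists>d. homogT d \<theta>}"
  have sum_app: "(\<Sum>v\<in>I. h v) b = (\<Sum>v\<in>I. h v b)" for h :: "'x \<Rightarrow> ('n \<Rightarrow> ('n, 'a) pol) \<Rightarrow> 'a" and I b
    by (induction I rule: infinite_finite_induct) auto
  obtain V where V: "V \<subseteq> W" "vs.independent V" "W \<subseteq> vs.span V"
    using vs.maximal_independent_subset by blast
  have "v \<in> vs.span ((\<lambda>b x. of_bool (x = b)) ` B)" if "v \<in> W" for v
  proof -
    have "v = (\<Sum>b\<in>B. ?sc (v b) (\<lambda>x. of_bool (x = b)))"
    proof
      fix x
      have "(\<Sum>b\<in>B. v b * of_bool (x = b)) = (\<Sum>b\<in>B. if b = x then v x else 0)"
        by (rule sum.cong) auto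
      also have "\<dots> = v x" using that fin by (auto simp: W_def vec_def)
      finally show "v x = (\<Sum>b\<in>B. ?sc (v b) (\<lambda>x. of_bool (x = b))) x" by (simp add: sum_app)
    qed
    moreover have "(\<Sum>b\<in>B. ?sc (v b) (\<lambda>x. of_bool (x = b))) \<in> vs.span ((\<lambda>b x. of_bool (x = b)) ` B)"
      by (intro vs.span_sum vs.span_scale vs.span_base) auto
    ultimately show ?thesis by simp
  qed
  then have finV: "finite V"
    using vs.independent_span_bound[of "(\<lambda>b x. of_bool (x = b)) ` B" V] V fin by blast
  have "\<forall>v\<in>V. \<exists>\<theta>. \<theta> \<in> M \<and> (\<exists>d. homogT d \<theta>) \<and> vec \<theta> = v"
    using V(1) unfolding W_def by blast
  then obtain \<eta> where \<eta>: "\<And>v. v \<in> V \<Longrightarrow> \<eta> v \<in> M" "\<And>v. v \<in> V \<Longrightarrow> \<exists>d. homogT d (\<eta> v)"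
    "\<And>v. v \<in> V \<Longrightarrow> vec (\<eta> v) = v" by metis
  have inj: "inj_on \<eta> V" using \<eta>(3) by (metis inj_onI)
  have lookup_vec: "Poly_Mapping.lookup (cf (\<eta> v) b) 0 = v b" if "v \<in> V" "b \<in> B" for v b
    using fun_cong[OF \<eta>(3)[OF that(1)], of b] that(2) by (simp add: vec_def)
  have V_out: "v b = 0" if "v \<in> V" "b \<notin> B" for v b
    using fun_cong[OF \<eta>(3)[OF that(1)], of b] that(2) by (simp add: vec_def)
  have comb: "cong_der q (\<lambda>i. \<Sum>v\<in>V. c v * \<eta> v i) (\<lambda>i. \<Sum>b\<in>B. (\<Sum>v\<in>V. c v * cf (\<eta> v) b) * b i)" for c
  proof -
    have "cong_der q (\<lambda>i. \<Sum>v\<in>V. c v * \<eta> v i) (\<lambda>i. \<Sum>v\<in>V. c v * (\<Sum>b\<in>B. cf (\<eta> v) b * b i))"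
      by (intro cong_der_sum cong_der_mult cf \<eta>(1))
    also have "(\<lambda>i. \<Sum>v\<in>V. c v * (\<Sum>b\<in>B. cf (\<eta> v) b * b i)) = (\<lambda>i. \<Sum>b\<in>B. (\<Sum>v\<in>V. c v * cf (\<eta> v) b) * b i)"
      unfolding sum_distrib_left sum_distrib_right mult.assoc by (rule ext, rule sum.swap)
    finally show ?thesis .
  qed
  have indep': "q dvd c v" if c: "cong_der q (\<lambda>i. \<Sum>v\<in>V. c v * \<eta> v i) (\<lambda>i. 0)" and v: "v \<in> V" for c v
  proof -
    have dv: "q dvd (\<Sum>v\<in>V. c v * cf (\<eta> v) b)" if "b \<in> B" for b
      using indep[OF cong_der_trans[OF cong_der_sym[OF comb] c] that] .
    have "\<forall>v\<in>V. q dvd hcomp e (c v)" for e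
    \<comment> \<open>In degree e the component of c v of degree e meets only the constant terms of
      \<open>cf\<close>; all other products contain a lower component of c v, divisible by q by
      induction.\<close>
    proof (induction e rule: less_induct)
      case (less e)
      have eq: "(\<Sum>v\<in>V. Cst (v b) * \<psi> (hcomp e (c v))) = 0" if b: "b \<in> B" for b
      proof -
        have split: "hcomp e (c v * cf (\<eta> v) b)
            = (\<Sum>k<e. hcomp k (c v) * hcomp (e - k) (cf (\<eta> v) b)) + Cst (v b) * hcomp e (c v)"
          if "v \<in> V" for v
          unfolding hcomp_mult using lookup_vec[OF that b]
          by (simp add: hcomp_0 mult.commute flip: lessThan_Suc_atMost)
        have "q dvd hcomp e (\<Sum>v\<in>V. c v * cf (\<eta> v) b)"
          by (rule dvd_hcomp[OF q dv[OF b]])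
        also have "hcomp e (\<Sum>v\<in>V. c v * cf (\<eta> v) b) = (\<Sum>v\<in>V. \<Sum>k<e. hcomp k (c v) * hcomp (e - k) (cf (\<eta> v) b))
            + (\<Sum>v\<in>V. Cst (v b) * hcomp e (c v))"
          unfolding hcomp_sum sum.distrib[symmetric] by (rule sum.cong[OF refl split])
        finally have d: "q dvd \<dots>" .
        have "q dvd (\<Sum>v\<in>V. \<Sum>k<e. hcomp k (c v) * hcomp (e - k) (cf (\<eta> v) b))"
          using less by (intro dvd_sum dvd_mult2) auto
        then have "q dvd (\<Sum>v\<in>V. Cst (v b) * hcomp e (c v))"
          using d by (simp add: dvd_add_right_iff)
        then show ?thesis unfolding psi psi_sum psi_mult .
      qed
      have "\<psi> (hcomp e (c v)) = 0" if "v \<in> V" for v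
      \<comment> \<open>For each monomial t the coefficients of the images under \<psi> form a
        scalar relation between the vectors in V, which are independent.\<close>
      proof (intro poly_mapping_eqI)
        fix t
        have zero: "(\<Sum>v\<in>V. ?sc (Poly_Mapping.lookup (\<psi> (hcomp e (c v))) t) v) = 0"
        proof
          fix b
          have "(\<Sum>v\<in>V. Poly_Mapping.lookup (\<psi> (hcomp e (c v))) t * v b) = 0"
          proof (cases "b \<in> B")
            case True
            show ?thesis
              using arg_cong[OF eq[OF True], of "\<lambda>f. Poly_Mapping.lookup f t"]
              by (simp add: lookup_sum lookup_Cst_mult mult.commute)
          next
            case False
            then show ?thesis using V_out by (simp add: sum.neutral)
          qed
          then show "(\<Sum>v\<in>V. ?sc (Poly_Mapping.lookup (\<psi> (hcomp e (c v))) t) v) b = 0 b"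
            by (simp add: sum_app)
        qed
        have all: "\<forall>u. (\<Sum>v\<in>V. ?sc (u v) v) = 0 \<longrightarrow> (\<forall>v\<in>V. u v = 0)"
          using V(2) finV unfolding vs.independent_explicit_finite_subsets by blast
        show "Poly_Mapping.lookup (\<psi> (hcomp e (c v))) t = Poly_Mapping.lookup 0 t"
          using all[THEN spec, THEN mp, OF zero] that by simp
      qed
      then show ?case using psi by blast
    qed
    then have h: "q dvd hcomp e (c v)" for e using v by blast
    obtain N where "\<And>M. M \<ge> N \<Longrightarrow> (\<Sum>d\<le>M. hcomp d (c v)) = c v" using sum_hcomp by blast
    then have "c v = (\<Sum>d\<le>N. hcomp d (c v))" by simp
    also have "q dvd \<dots>" using h by (intro dvd_sum)
    finally show ?thesis .
  qed
  have sp: "\<theta> \<in> spn q (\<eta> ` V)" if "\<theta> \<in> M" "homogT d \<theta>" for d \<theta>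
    using that
  proof (induction d arbitrary: \<theta> rule: less_induct)
    case (less d)
    have "vec \<theta> \<in> vs.span V" using V(3) less.prems by (auto simp: W_def)
    then obtain \<kappa> where \<kappa>: "vec \<theta> = (\<Sum>v\<in>V. ?sc (\<kappa> v) v)"
      unfolding vs.span_finite[OF finV] by auto
    \<comment> \<open>The coefficients left after the constant combination \<open>\<kappa>\<close>
      is removed have no constant term. In degree d they therefore meet only components of B of
      smaller degree, to which the induction hypothesis applies.\<close>
    define e where "e b = cf \<theta> b - (\<Sum>v\<in>V. Cst (\<kappa> v) * cf (\<eta> v) b)" for b
    have e0: "hcomp 0 (e b) = 0" if b: "b \<in> B" for b
    proof -
      have "Poly_Mapping.lookup (e b) 0 = vec \<theta> b - (\<Sum>v\<in>V. \<kappa> v * v b)"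
        using lookup_vec b by (simp add: e_def lookup_minus lookup_sum lookup_Cst_mult vec_def)
      also have "\<dots> = 0" unfolding \<kappa> sum_app by simp
      finally show ?thesis by (simp add: hcomp_0)
    qed
    have "cong_der q (\<lambda>i. \<theta> i - (\<Sum>v\<in>V. Cst (\<kappa> v) * \<eta> v i))
        (\<lambda>i. (\<Sum>b\<in>B. cf \<theta> b * b i) - (\<Sum>b\<in>B. (\<Sum>v\<in>V. Cst (\<kappa> v) * cf (\<eta> v) b) * b i))"
      by (intro cong_der_diff cf comb less.prems)
    then have "cong_der q (\<lambda>i. \<theta> i - (\<Sum>v\<in>V. Cst (\<kappa> v) * \<eta> v i)) (\<lambda>i. \<Sum>b\<in>B. e b * b i)"
      by (simp add: e_def left_diff_distrib sum_subtractf)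
    then have "cong_der q (\<lambda>i. hcomp d (\<theta> i - (\<Sum>v\<in>V. Cst (\<kappa> v) * \<eta> v i))) (\<lambda>i. hcomp d (\<Sum>b\<in>B. e b * b i))"
      unfolding cong_der_def hcomp_diff[symmetric] using dvd_hcomp[OF q] by blast
    moreover have "hcomp d (\<theta> i - (\<Sum>v\<in>V. Cst (\<kappa> v) * \<eta> v i)) = \<theta> i - (\<Sum>v\<in>V. Cst (\<kappa> v) * hcomp d (\<eta> v i))" for i
      using less.prems(2) by (simp add: homogT_def homog_def hcomp_diff hcomp_sum hcomp_Cst_mult)
    moreover have "hcomp d (\<Sum>b\<in>B. e b * b i) = (\<Sum>b\<in>B. \<Sum>k\<le>d. hcomp k (e b) * hcomp (d - k) (b i))" for i
      by (simp only: hcomp_sum hcomp_mult)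
    ultimately have "cong_der q (\<lambda>i. \<theta> i - (\<Sum>v\<in>V. Cst (\<kappa> v) * hcomp d (\<eta> v i)))
        (\<lambda>i. \<Sum>b\<in>B. \<Sum>k\<le>d. hcomp k (e b) * hcomp (d - k) (b i))"
      by (simp only:)
    then have c: "cong_der q \<theta> (\<lambda>i. (\<Sum>v\<in>V. Cst (\<kappa> v) * hcomp d (\<eta> v i)) + (\<Sum>b\<in>B. \<Sum>k\<le>d. hcomp k (e b) * hcomp (d - k) (b i)))"
      by (simp add: cong_der_def diff_diff_eq)
    have s1: "(\<lambda>i. hcomp d (\<eta> v i)) \<in> spn q (\<eta> ` V)" if v: "v \<in> V" for v
    proof -
      obtain d' where d': "homogT d' (\<eta> v)" using \<eta>(2)[OF v] by blast
      have "hcomp d (\<eta> v i) = (if d = d' then \<eta> v i else 0)" for i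
        using hcomp_homog[of d' "\<eta> v i" d] d' by (simp add: homogT_def)
      then have "(\<lambda>i. hcomp d (\<eta> v i)) = (if d = d' then \<eta> v else (\<lambda>i. 0))"
        by auto
      then show ?thesis using spn_base[of "\<eta> ` V" "\<eta> v" q] finV v by (simp add: spn_zero)
    qed
    have s2: "(\<lambda>i. hcomp k (e b) * hcomp (d - k) (b i)) \<in> spn q (\<eta> ` V)" if "b \<in> B" "k \<le> d" for b k
    proof (cases "k = 0")
      case True
      then show ?thesis using e0[OF that(1)] by (simp add: spn_zero)
    next
      case False
      then have "(\<lambda>i. hcomp (d - k) (b i)) \<in> spn q (\<eta> ` V)"
        using that BM by (intro less.IH[of "d - k"] M_hcomp homogT_hcomp) auto
      then show ?thesis by (rule spn_mult)
    qed
    show ?case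
      by (rule spn_cong[OF c]) (intro spn_add spn_sum spn_mult s1 s2; simp)
  qed
  have "\<theta> \<in> spn q (\<eta> ` V)" if "\<theta> \<in> M" for \<theta>
  proof -
    obtain N where "\<And>i. (\<Sum>d\<le>N. hcomp d (\<theta> i)) = \<theta> i" using sum_hcomp_fun by blast
    then have "\<theta> = (\<lambda>i. \<Sum>d\<le>N. hcomp d (\<theta> i))" by simp
    moreover have "(\<lambda>i. \<Sum>d\<le>N. hcomp d (\<theta> i)) \<in> spn q (\<eta> ` V)"
      using that by (intro spn_sum sp[OF M_hcomp homogT_hcomp])
    ultimately show ?thesis by simp
  qed
  moreover have "q dvd c b" if "cong_der q (\<lambda>i. \<Sum>b\<in>\<eta> ` V. c b * b i) (\<lambda>i. 0)" "b \<in> \<eta> ` V" for c b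
    using that indep'[of "c \<circ> \<eta>"] by (auto simp: sum.reindex[OF inj])
  ultimately have "is_basis q M (\<eta> ` V)"
    using finV \<eta>(1) unfolding is_basis_def by blast
  then show ?thesis using that \<eta>(2) by blast
qed

section \<open>Interpolation\<close>

text \<open>Hermite interpolation: near the root -c of t + c, the polynomial g has to agree with the
  constant -c to order \<open>\<mu> c\<close>. In the pencil below, c encodes a hyperplane and g a
  component of the derivation sought. One order is gained at a time by adding a multiple of the
  product of the conditions already met.\<close>

lemma interpolation:
  fixes C :: "'a::field set"
  assumes C: "finite C" and n: "(\<Sum>c\<in>C. \<mu> c) = n"
  shows "\<exists>g. degree g \<le> n \<and> (\<forall>c\<in>C. [:c, 1:] ^ \<mu> c dvd g + [:c:])"
  using n
proof (induction n arbitrary: \<mu>)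
  case 0
  then have "\<mu> c = 0" if "c \<in> C" for c using C that by simp
  then show ?case by (intro exI[of _ 0]) simp
next
  case (Suc n)
  have "\<exists>c0\<in>C. \<mu> c0 \<noteq> 0" using Suc.prems by (metis sum.neutral nat.distinct(1))
  then obtain c0 where c0: "c0 \<in> C" "\<mu> c0 \<noteq> 0" by blast
  define \<mu>' where "\<mu>' = \<mu>(c0 := \<mu> c0 - 1)"
  have "(\<Sum>c\<in>C. \<mu> c) = \<mu> c0 + (\<Sum>c\<in>C - {c0}. \<mu> c)" by (rule sum.remove[OF C c0(1)])
  moreover have "(\<Sum>c\<in>C. \<mu>' c) = \<mu>' c0 + (\<Sum>c\<in>C - {c0}. \<mu>' c)" by (rule sum.remove[OF C c0(1)])
  moreover have "(\<Sum>c\<in>C - {c0}. \<mu>' c) = (\<Sum>c\<in>C - {c0}. \<mu> c)" by (rule sum.cong) (auto simp: \<mu>'_def)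
  ultimately have n': "(\<Sum>c\<in>C. \<mu>' c) = n" using Suc.prems c0(2) by (simp add: \<mu>'_def)
  obtain g where g: "degree g \<le> n" "\<And>c. c \<in> C \<Longrightarrow> [:c, 1:] ^ \<mu>' c dvd g + [:c:]"
    using Suc.IH[OF n'] by blast
  define P where "P = (\<Prod>c\<in>C. [:c, 1:] ^ \<mu>' c)"
  define P' where "P' = (\<Prod>c\<in>C - {c0}. [:c, 1:] ^ \<mu>' c)"
  have P: "P = [:c0, 1:] ^ \<mu>' c0 * P'" unfolding P_def P'_def by (rule prod.remove[OF C c0(1)])
  have deg_P: "degree P \<le> n"
  proof -
    have "degree P \<le> (\<Sum>c\<in>C. degree ([:c, 1:] ^ \<mu>' c))"
      unfolding P_def by (rule order_trans[OF degree_prod_sum_le[OF C]]) simp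
    also have "\<dots> = n" unfolding degree_linear_power n' ..
    finally show ?thesis .
  qed
  obtain r where r: "g + [:c0:] = [:c0, 1:] ^ \<mu>' c0 * r" using g(2)[OF c0(1)] by (rule dvdE)
  have P'_nz: "poly P' (- c0) \<noteq> 0"
    unfolding P'_def poly_prod using C by (simp add: eq_neg_iff_add_eq_0 add.commute)
  \<comment> \<open>Chosen so that the quotient r of g + c0, corrected by the multiple of P',
    acquires the root -c0.\<close>
  define \<kappa> where "\<kappa> = - poly r (- c0) / poly P' (- c0)"
  have "[:- (- c0), 1:] dvd r + smult \<kappa> P'"
    using P'_nz unfolding poly_eq_0_iff_dvd[symmetric] by (simp add: \<kappa>_def)
  then have "[:c0, 1:] ^ \<mu>' c0 * [:c0, 1:] dvd [:c0, 1:] ^ \<mu>' c0 * (r + smult \<kappa> P')"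
    by (intro mult_dvd_mono) simp_all
  moreover have "[:c0, 1:] ^ \<mu>' c0 * [:c0, 1:] = [:c0, 1:] ^ \<mu> c0"
    using c0(2) by (metis \<mu>'_def fun_upd_same power_minus_mult zero_less_iff_neq_zero)
  moreover have "[:c0, 1:] ^ \<mu>' c0 * (r + smult \<kappa> P') = g + smult \<kappa> P + [:c0:]"
    unfolding distrib_left r[symmetric] P by simp
  ultimately have at_c0: "[:c0, 1:] ^ \<mu> c0 dvd g + smult \<kappa> P + [:c0:]" by simp
  have "[:c, 1:] ^ \<mu> c dvd g + smult \<kappa> P + [:c:]" if c: "c \<in> C" "c \<noteq> c0" for c
  proof -
    have eq: "\<mu>' c = \<mu> c" using c(2) by (simp add: \<mu>'_def)
    have "[:c, 1:] ^ \<mu>' c dvd smult \<kappa> P" unfolding P_def by (rule dvd_smult[OF dvd_prodI[OF C c(1)]])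
    with g(2)[OF c(1)] have "[:c, 1:] ^ \<mu>' c dvd (g + [:c:]) + smult \<kappa> P" by (rule dvd_add)
    then show ?thesis unfolding eq by (simp only: add_ac)
  qed
  moreover have "degree (g + smult \<kappa> P) \<le> Suc n"
    using g(1) deg_P by (intro degree_add_le) (auto intro: order_trans[OF degree_smult_le])
  ultimately show ?case using at_c0 by (intro exI[of _ "g + smult \<kappa> P"]) blast
qed

text \<open>The form x^N p(y / x). Coefficients above N are discarded, hence the degree bounds in
  the lemmas; N may exceed the degree.\<close>

definition homogenize :: "('n::finite, 'a::field) pol \<Rightarrow> ('n, 'a) pol \<Rightarrow> nat \<Rightarrow> 'a poly \<Rightarrow> ('n, 'a) pol" where
  "homogenize x y N p = (\<Sum>k\<le>N. Cst (coeff p k) * y ^ k * x ^ (N - k))"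

lemma homogenize_add: "homogenize x y N (p + q) = homogenize x y N p + homogenize x y N q"
  by (simp add: homogenize_def Cst_simps distrib_right sum.distrib)

lemma homogenize_const: "homogenize x y N [:c:] = Cst c * x ^ N"
proof -
  have "homogenize x y N [:c:] = (\<Sum>k\<le>N. if k = 0 then Cst c * x ^ N else 0)"
    unfolding homogenize_def by (rule sum.cong) (auto simp: coeff_pCons split: nat.split)
  then show ?thesis by simp
qed

lemma homogenize_linear_mult:
  assumes "degree p \<le> N"
  shows "homogenize x y (Suc N) ([:c, 1:] * p) = (y + Cst c * x) * homogenize x y N p"
proof -
  have "homogenize x y (Suc N) (smult c p) = Cst c * x * homogenize x y N p"
  proof -
    have "coeff p (Suc N) = 0" using assms by (intro coeff_eq_0) simp
    then have "homogenize x y (Suc N) (smult c p) = (\<Sum>k\<le>N. Cst (c * coeff p k) * y ^ k * x ^ (Suc N - k))"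
      by (simp add: homogenize_def)
    also have "\<dots> = Cst c * x * homogenize x y N p"
      unfolding homogenize_def sum_distrib_left
      by (rule sum.cong) (auto simp: Cst_simps Suc_diff_le mult_ac)
    finally show ?thesis .
  qed
  moreover have "homogenize x y (Suc N) (pCons 0 p) = y * homogenize x y N p"
    unfolding homogenize_def sum.atMost_Suc_shift sum_distrib_left by (simp add: mult_ac)
  moreover have "[:c, 1:] * p = smult c p + pCons 0 p" by simp
  ultimately show ?thesis by (simp add: homogenize_add distrib_right)
qed

lemma homogenize_linear_power_mult:
  assumes "degree p \<le> N"
  shows "homogenize x y (k + N) ([:c, 1:] ^ k * p) = (y + Cst c * x) ^ k * homogenize x y N p"
proof (induction k)
  case (Suc k)
  have "degree ([:c, 1:] ^ k * p) \<le> k + N"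
    using degree_mult_le[of "[:c, 1:] ^ k" p] assms by (simp add: degree_linear_power)
  then have "homogenize x y (Suc (k + N)) ([:c, 1:] * ([:c, 1:] ^ k * p)) = (y + Cst c * x) * homogenize x y (k + N) ([:c, 1:] ^ k * p)"
    by (rule homogenize_linear_mult)
  then show ?case using Suc by (simp only: power_Suc mult.assoc add_Suc)
qed simp

lemma homogenize_dvd:
  assumes "degree p \<le> N" "[:c, 1:] ^ k dvd p"
  shows "(y + Cst c * x) ^ k dvd homogenize x y N p"
proof (cases "p = 0")
  case True
  then show ?thesis by (simp add: homogenize_def Cst_simps)
next
  case False
  obtain h where h: "p = [:c, 1:] ^ k * h" using assms(2) by (rule dvdE)
  then have "h \<noteq> 0" using False by auto
  then have "degree p = k + degree h"
    unfolding h by (subst degree_mult_eq) (auto simp: degree_linear_power)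
  then have "degree h \<le> N - k" "N = k + (N - k)" using assms(1) by auto
  then show ?thesis using homogenize_linear_power_mult[of h "N - k" x y k c] h by (metis dvd_triv_left)
qed

section \<open>Arrangements with a heavy hyperplane\<close>

locale heavy_arrangement =
  fixes A :: "('n::finite \<Rightarrow> 'a::field) set set" and m :: "('n \<Rightarrow> 'a) set \<Rightarrow> nat"
    and H0 :: "('n \<Rightarrow> 'a) set"
  assumes multi: "multiarrangement A m" and H0: "H0 \<in> A" and heavy: "heavy A m H0"
begin

abbreviation "al H \<equiv> defform H"
abbreviation "l H \<equiv> linf (defform H)"
abbreviation "R \<equiv> A - {H0}"

text \<open>\<open>pw A\<close> is the defining polynomial of the multiarrangement. A partial
  product clears the conditions of D at the hyperplanes of C.\<close>

definition pw :: "('n \<Rightarrow> 'a) set set \<Rightarrow> ('n, 'a) pol" where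
  "pw C = (\<Prod>H\<in>C. l H ^ m H)"

abbreviation "Q0 \<equiv> pw R"

lemma finA: "finite A"
  using multi by (simp add: multiarrangement_def)

lemma form:
  assumes "H \<in> A" shows "\<exists>i. al H i \<noteq> 0" "v \<in> H \<longleftrightarrow> dot (al H) v = 0"
proof -
  have "hyperplane H" using multi assms by (simp add: multiarrangement_def)
  then have "(\<exists>i. al H i \<noteq> 0) \<and> H = {v. (\<Sum>i\<in>UNIV. al H i * v i) = 0}"
    unfolding hyperplane_def defform_def by (rule someI_ex)
  then show "\<exists>i. al H i \<noteq> 0" "v \<in> H \<longleftrightarrow> dot (al H) v = 0" by (auto simp: dot_def)
qed

lemma separate:
  assumes "H \<in> A" "H' \<in> A" "H \<noteq> H'"
  obtains v where "dot (al H) v = 0" "dot (al H') v = 1"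
proof -
  have "\<exists>v. dot (al H) v = 0 \<and> dot (al H') v \<noteq> 0"
  proof (rule ccontr)
    assume no: "\<not> ?thesis"
    obtain s where s: "\<And>i. al H' i = s * al H i"
      using dot_ker_subset[OF form(1)[OF assms(1)], of "al H'"] no by blast
    then have "s \<noteq> 0" using form(1)[OF assms(2)] by auto
    moreover have "dot (al H') v = s * dot (al H) v" for v
      using s by (simp add: dot_def sum_distrib_left mult.assoc)
    ultimately have "H = H'" using form(2)[OF assms(1)] form(2)[OF assms(2)] by auto
    then show False using assms(3) by simp
  qed
  then obtain v where v: "dot (al H) v = 0" "dot (al H') v \<noteq> 0" by blast
  have "dot b (\<lambda>i. inverse (dot (al H') v) * v i) = inverse (dot (al H') v) * dot b v" for b
    by (rule dot_scale)
  then show ?thesis using that[of "\<lambda>i. inverse (dot (al H') v) * v i"] v by simp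
qed

lemma l_nz: "H \<in> A \<Longrightarrow> l H \<noteq> 0"
  using form(1) by (simp add: linf_eq_0_iff)

lemma not_dvd:
  assumes "H \<in> A" "H' \<in> A" "H \<noteq> H'" shows "\<not> l H dvd l H'"
proof
  assume "l H dvd l H'"
  then obtain s where s: "\<forall>i. al H' i = s * al H i" using linf_dvd_linf form(1)[OF assms(1)] by blast
  obtain v where "dot (al H) v = 0" "dot (al H') v = 1" using separate[OF assms] .
  moreover have "dot (al H') v = s * dot (al H) v"
    using s by (simp add: dot_def sum_distrib_left mult.assoc)
  ultimately show False by simp
qed

lemma pw_dvd:
  assumes "C \<subseteq> A" "\<And>H. H \<in> C \<Longrightarrow> l H ^ m H dvd f" shows "pw C dvd f"
  unfolding pw_def
proof (rule prod_linf_power_dvd)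
  show "finite C" using assms(1) finA by (rule finite_subset)
qed (use assms form(1) not_dvd in blast)+

lemma dvd_pw: "C \<subseteq> A \<Longrightarrow> H \<in> C \<Longrightarrow> l H ^ m H dvd pw C"
  unfolding pw_def using finA finite_subset by (intro dvd_prodI) auto

lemma not_dvd_pw: assumes "C \<subseteq> A" "H \<in> A" "H \<notin> C" shows "\<not> l H dvd pw C"
proof
  assume "l H dvd pw C"
  then obtain H' where H': "H' \<in> C" "l H dvd l H' ^ m H'"
    unfolding pw_def linf_dvd_prod[OF form(1)[OF assms(2)] finite_subset[OF assms(1) finA]] ..
  have "l H dvd l H'" by (rule linf_dvd_power[OF form(1)[OF assms(2)] H'(2)])
  moreover have "H \<noteq> H'" "H' \<in> A" using H'(1) assms by auto
  ultimately show False using not_dvd assms(2) by blast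
qed

lemma pw_nz: "C \<subseteq> A \<Longrightarrow> pw C \<noteq> 0"
  unfolding pw_def using finA finite_subset l_nz by (subst pol_prod_eq_0_iff) auto

lemma pw_split: "C \<subseteq> A \<Longrightarrow> H \<in> C \<Longrightarrow> pw C = l H ^ m H * pw (C - {H})"
  unfolding pw_def using finA finite_subset by (intro prod.remove) auto

lemma homog_pw: "homog (sum m C) (pw C)"
  unfolding pw_def using homog_power[OF homog_linf] by (intro homog_prod) simp

lemma heavy_le: "(\<Sum>H\<in>R. m H) \<le> m H0"
  using heavy sum.remove[OF finA H0, of m] by (simp add: heavy_def total_mult_def)

section \<open>The graded modules D and D0\<close>

abbreviation "D \<equiv> Dmod A m"
abbreviation "D0 \<equiv> D0mod A m H0"

lemma D_iff: "\<theta> \<in> D \<longleftrightarrow> (\<forall>H\<in>A. l H ^ m H dvd der_app \<theta> (al H))"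
  by (simp add: Dmod_def)

lemma D0_iff: "\<theta> \<in> D0 \<longleftrightarrow> \<theta> \<in> D \<and> der_app \<theta> (al H0) = 0"
  by (simp add: D0mod_def)

lemma D_diff: "\<theta> \<in> D \<Longrightarrow> \<phi> \<in> D \<Longrightarrow> (\<lambda>i. \<theta> i - \<phi> i) \<in> D"
  and D_mult: "\<theta> \<in> D \<Longrightarrow> (\<lambda>i. f * \<theta> i) \<in> D"
  by (simp_all add: D_iff der_app_diff der_app_mult)

lemma D_sum: "(\<And>j. j \<in> J \<Longrightarrow> \<theta> j \<in> D) \<Longrightarrow> (\<lambda>i. \<Sum>j\<in>J. \<theta> j i) \<in> D"
  by (simp add: D_iff der_app_sum dvd_sum)

lemma homog_l_pow: "homog (k * 1) (l H ^ k)"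
  by (rule homog_power[OF homog_linf])

lemma D_hcomp: "\<theta> \<in> D \<Longrightarrow> (\<lambda>i. hcomp d (\<theta> i)) \<in> D"
  unfolding D_iff hcomp_der_app[symmetric] using dvd_hcomp[OF homog_l_pow] by blast

lemma D0_sum: "(\<And>j. j \<in> J \<Longrightarrow> \<theta> j \<in> D0) \<Longrightarrow> (\<lambda>i. \<Sum>j\<in>J. \<theta> j i) \<in> D0"
  by (simp add: D0_iff der_app_sum D_sum)

lemma D0_mult: "\<theta> \<in> D0 \<Longrightarrow> (\<lambda>i. f * \<theta> i) \<in> D0"
  by (simp add: D0_iff der_app_mult D_mult)

lemma D0_hcomp: "\<theta> \<in> D0 \<Longrightarrow> (\<lambda>i. hcomp d (\<theta> i)) \<in> D0"
  by (simp add: D0_iff D_hcomp hcomp_zero flip: hcomp_der_app)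

lemma pw_mult_in_D:
  assumes "C \<subseteq> A" "\<And>H. H \<in> A - C \<Longrightarrow> der_app \<theta> (al H) = 0"
  shows "(\<lambda>i. pw C * \<theta> i) \<in> D"
  unfolding D_iff der_app_mult
proof
  fix H assume "H \<in> A"
  then show "l H ^ m H dvd pw C * der_app \<theta> (al H)"
    using assms dvd_pw[OF assms(1), of H] by (cases "H \<in> C") auto
qed

section \<open>Saito's criterion and homogeneous bases of D\<close>

definition generates :: "('n \<Rightarrow> 'n \<Rightarrow> ('n, 'a) pol) \<Rightarrow> bool" where
  "generates E \<longleftrightarrow> (\<forall>i. E i \<in> D) \<and> (\<forall>\<theta>\<in>D. \<exists>c. \<theta> = (\<lambda>j. \<Sum>k\<in>UNIV. c k * E k j))"

text \<open>For each H, D contains a family with determinant pw A * pw (A - {H})^(l - 1), where l is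
  the number of coordinates. So the cofactor g of pw A in the determinant of E divides a power of pw
  (A - {H}), which is prime to the form of H; this for all H leaves only units.\<close>

lemma saito:
  assumes "generates E"
  obtains u where "u dvd 1" "dt E = pw A * u"
proof -
  have E: "\<And>i. E i \<in> D" and span: "\<And>\<theta>. \<theta> \<in> D \<Longrightarrow> \<exists>c. \<theta> = (\<lambda>j. \<Sum>k\<in>UNIV. c k * E k j)"
    using assms by (auto simp: generates_def)
  have "pw A dvd dt E"
  proof (rule pw_dvd[OF subset_refl])
    fix H assume H: "H \<in> A"
    show "l H ^ m H dvd dt E"
      using E H by (intro dvd_dt_if_dvd_der_app[OF form(1)[OF H]]) (simp add: D_iff)
  qed
  then obtain g where g: "dt E = pw A * g" ..
  have g_dvd: "g dvd pw (A - {H}) ^ (CARD('n) - 1)" if H: "H \<in> A" for H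
  proof -
    obtain p where p: "al H p \<noteq> 0" using form(1)[OF H] by blast
    \<comment> \<open>Row p is e_p; every other row is e_i - (a_i / a_p) e_p and annihilates the
      form of H, so multiplying it by pw (A - {H}) suffices. The determinant of w is 1.\<close>
    define w where "w = (\<lambda>i j. if j = p then (if i = p then 1 else - Cst (al H i / al H p)) else (of_bool (i = j) :: ('n, 'a) pol))"
    have w: "der_app (w i) (al H) = 0" if "i \<noteq> p" for i
    proof -
      have "w i = (\<lambda>j. Cst (of_bool (i = j) + - (al H i / al H p) * of_bool (p = j)))"
        using that by (auto simp: w_def fun_eq_iff Cst_simps)
      then have "der_app (w i) (al H) = Cst (dot (al H) (\<lambda>j. of_bool (i = j) + - (al H i / al H p) * of_bool (p = j)))"
        by (simp only: der_app_const)
      also have "dot (al H) (\<lambda>j. of_bool (i = j) + - (al H i / al H p) * of_bool (p = j)) = 0"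
        unfolding dot_add dot_scale dot_unit using p by simp
      finally show ?thesis by simp
    qed
    define \<zeta> where "\<zeta> i = (\<lambda>j. (if i = p then pw A else pw (A - {H})) * w i j)" for i
    have "\<zeta> i \<in> D" for i
      unfolding \<zeta>_def using w H pw_mult_in_D[of A] pw_mult_in_D[of "A - {H}" "w i"]
      by (cases "i = p") auto
    then have "\<forall>i. \<exists>c. \<zeta> i = (\<lambda>j. \<Sum>k\<in>UNIV. c k * E k j)" using span by blast
    from choice[OF this] obtain c where "\<forall>i. \<zeta> i = (\<lambda>j. \<Sum>k\<in>UNIV. c i k * E k j)" ..
    then have "\<zeta> = (\<lambda>i j. \<Sum>k\<in>UNIV. c i k * E k j)" by blast
    then have "dt \<zeta> = dt c * dt E" by (simp only: dt_mult)
    then have "dt E dvd dt \<zeta>" by simp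
    moreover have "dt \<zeta> = pw A * pw (A - {H}) ^ (CARD('n) - 1)"
    proof -
      have "dt w = 1" unfolding w_def by (subst dt_elementary) simp
      then have "dt \<zeta> = (\<Prod>i\<in>UNIV. if i = p then pw A else pw (A - {H}))"
        unfolding \<zeta>_def dt_rows_mult by simp
      also have "\<dots> = pw A * (\<Prod>i\<in>UNIV - {p}. if i = p then pw A else pw (A - {H}))"
        by (subst prod.remove[of _ p]) auto
      also have "(\<Prod>i\<in>UNIV - {p}. if i = p then pw A else pw (A - {H})) = (\<Prod>i\<in>UNIV - {p}. pw (A - {H}))"
        by (rule prod.cong) auto
      finally show ?thesis by simp
    qed
    ultimately show ?thesis unfolding g using pol_dvd_mult_cancel_left[OF pw_nz[OF subset_refl]] by metis
  qed
  have "g dvd 1"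
  \<comment> \<open>The instance H = H0 makes g a divisor of a power of Q0, and the instances H in R
    exclude every prime factor of Q0.\<close>
  proof (rule coprime_to_prod_imp_unit)
    show "finite R" using finA by simp
    show "\<exists>k. al H k \<noteq> 0" if "H \<in> R" for H using form(1) that by blast
    show "\<not> l H dvd g" if "H \<in> R" for H
    proof
      have H: "H \<in> A" using that by simp
      assume "l H dvd g"
      then have "l H dvd pw (A - {H}) ^ (CARD('n) - 1)" using g_dvd[OF H] by (rule dvd_trans)
      then have "l H dvd pw (A - {H})" by (rule linf_dvd_power[OF form(1)[OF H]])
      then show False using not_dvd_pw[of "A - {H}" H] H by simp
    qed
    show "g dvd (\<Prod>H\<in>R. l H ^ (m H * (CARD('n) - 1)))"
      using g_dvd[OF H0] by (simp add: pw_def prod_power_distrib power_mult)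
  qed
  then show ?thesis using that g by blast
qed

text \<open>The module contains pw A times all derivations, so a basis is finite and, by exchange,
  contains a family E with nonzero determinant indexed by the coordinates. Cramer's rule leaves no
  room for further basis elements.\<close>

lemma homogeneous_family_basis:
  assumes "free_multiarr A m"
  obtains E d where "generates E" "\<forall>i. homogT (d i) (E i)" "dt E \<noteq> 0"
proof -
  let ?Q = "pw A"
  define e where "e i = (\<lambda>j. ?Q * of_bool (i = j))" for i :: 'n
  have eD: "e i \<in> D" for i unfolding e_def by (rule pw_mult_in_D) auto
  have "(\<lambda>i. ?Q * \<theta> i) \<in> spn 0 (range e)" for \<theta>
  proof -
    have "\<theta> k * e k j = ?Q * (\<theta> k * of_bool (j = k))" for j k
      by (auto simp: e_def)
    then have "(\<lambda>j. ?Q * \<theta> j) = (\<lambda>j. \<Sum>k\<in>UNIV. \<theta> k * e k j)"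
      by (simp only: sum_distrib_left[symmetric] sum_of_bool_mult)
    moreover have "(\<lambda>j. \<Sum>k\<in>UNIV. \<theta> k * e k j) \<in> spn 0 (range e)"
      by (intro spn_sum spn_mult spn_base) auto
    ultimately show ?thesis by simp
  qed
  then obtain B0 where B0: "is_basis 0 D B0"
    using free_imp_is_basis[of 0 D "range e" ?Q] assms eD pw_nz[OF subset_refl]
    unfolding free_multiarr_def by auto
  \<comment> \<open>Over S itself q is 0, which counts as homogeneous of degree 1, and the embedding
    \<psi> is the identity.\<close>
  obtain B where B: "is_basis 0 D B" and hom: "\<And>b. b \<in> B \<Longrightarrow> \<exists>d. homogT d b"
  proof (rule homogeneous_basis[OF homog_zero _ _ _ _ B0])
    show "(0 dvd f) = (id f = 0)" for f :: "('n, 'a) pol" by simp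
  qed (auto intro: D_hcomp)
  have fin: "finite B" and BD: "B \<subseteq> D" and span: "D \<subseteq> spn 0 B"
    and indep: "\<And>c b. (\<lambda>i. \<Sum>b\<in>B. c b * b i) = (\<lambda>i. 0) \<Longrightarrow> b \<in> B \<Longrightarrow> c b = 0"
    using B unfolding is_basis_def cong_der_0 by auto
  have "\<forall>i. \<exists>c. e i = (\<lambda>j. \<Sum>b\<in>B. c b * b j)"
    using span eD unfolding spn_def cong_der_0 by blast
  from choice[OF this] obtain c where c: "\<forall>i. e i = (\<lambda>j. \<Sum>b\<in>B. c i b * b j)" ..
  have "dt e \<noteq> 0"
    unfolding e_def dt_rows_mult dt_one using pw_nz[OF subset_refl] by simp
  then obtain E where "\<forall>i. E i \<in> B" and dtE: "dt E \<noteq> 0"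
    by (rule dt_exchange[of B e c "\<lambda>b. b", OF fin _ c[rule_format]])
  then have E: "\<And>i. E i \<in> B" "dt E \<noteq> 0" by simp_all
  have "b \<in> range E" if b: "b \<in> B" for b
  proof (rule ccontr)
    assume nb: "b \<notin> range E"
    have injE: "inj E" using dt_eq_rows[of _ _ E] E(2) by (metis injI)
    \<comment> \<open>By Cramer's rule dt E * b is the combination of the E k with coefficients t k:
      a relation in which b has the nonzero coefficient dt E.\<close>
    define t where "t k = dt (E(k := b))" for k
    define c where "c x = (if x = b then dt E else - t (inv E x))" for x
    have rest: "(\<Sum>x\<in>B - {b}. (if x \<in> range E then c x else 0) * x j) = - (dt E * b j)" for j
    proof -
      have "(\<Sum>x\<in>B - {b}. (if x \<in> range E then c x else 0) * x j) = (\<Sum>x\<in>range E. c x * x j)"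
        using E(1) nb fin by (intro sum.mono_neutral_cong_right) auto
      also have "\<dots> = (\<Sum>k\<in>UNIV. c (E k) * E k j)" using sum.reindex[OF injE, of "\<lambda>x. c x * x j"] by simp
      also have "\<dots> = (\<Sum>k\<in>UNIV. - (t k * E k j))"
        using nb by (intro sum.cong) (auto simp: c_def inv_f_f[OF injE])
      also have "\<dots> = - (dt E * b j)"
        unfolding sum_negf t_def dt_adjugate ..
      finally show ?thesis .
    qed
    define c' where "c' x = (if x = b then dt E else if x \<in> range E then c x else 0)" for x
    have "(\<Sum>x\<in>B. c' x * x j) = 0" for j
    proof -
      have "(\<Sum>x\<in>B - {b}. c' x * x j) = (\<Sum>x\<in>B - {b}. (if x \<in> range E then c x else 0) * x j)"
        by (rule sum.cong) (auto simp: c'_def)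
      then show ?thesis
        using rest[of j] by (subst sum.remove[OF fin b]) (simp add: c'_def)
    qed
    then have "c' b = 0" using indep[of c' b] b by simp
    then show False using E(2) by (simp add: c'_def)
  qed
  then have BE: "B = range E" using E(1) by blast
  have injE: "inj E" using dt_eq_rows[of _ _ E] E(2) by (metis injI)
  have "\<exists>c. \<theta> = (\<lambda>j. \<Sum>k\<in>UNIV. c k * E k j)" if \<theta>: "\<theta> \<in> D" for \<theta>
  proof -
    obtain c where "\<theta> = (\<lambda>j. \<Sum>b\<in>B. c b * b j)"
      using span \<theta> unfolding spn_def cong_der_0 by blast
    then have "\<theta> = (\<lambda>j. \<Sum>k\<in>UNIV. c (E k) * E k j)"
      unfolding BE by (simp add: sum.reindex[OF injE])
    then show ?thesis by (rule exI[of _ "\<lambda>k. c (E k)"])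
  qed
  then have "generates E" using E(1) BD by (auto simp: generates_def)
  moreover have "\<forall>i. \<exists>d. homogT d (E i)" using hom E(1) by blast
  then obtain d where "\<forall>i. homogT (d i) (E i)" by metis
  ultimately show ?thesis using that E(2) by blast
qed

lemma const_vector: obtains v where "dot (al H0) v = 1"
proof -
  obtain p where "al H0 p \<noteq> 0" using form(1)[OF H0] by blast
  then have "dot (al H0) (\<lambda>j. inverse (al H0 p) * of_bool (p = j)) = 1"
    unfolding dot_scale dot_unit by simp
  then show ?thesis using that by blast
qed

lemma dt_const_row:
  assumes "\<And>i. i \<noteq> k \<Longrightarrow> der_app (\<eta> i) (al H0) = 0" "dot (al H0) v = 1"
  shows "dt (\<eta>(k := x)) = der_app x (al H0) * dt (\<eta>(k := (\<lambda>j. Cst (v j))))"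
  by (rule dt_eval[OF form(1)[OF H0] assms(1)]) (simp_all add: der_app_const assms(2) Cst_simps)

text \<open>The determinant does not depend on the constant vector v as long as its value on alpha
  is 1. For each H in R it can therefore be computed with a vector lying in H, and then every row
  satisfies the condition at H.\<close>

lemma Q0_dvd_dt:
  assumes E: "\<And>i. i \<noteq> k \<Longrightarrow> E i \<in> D0" and v: "dot (al H0) v = 1"
  shows "Q0 dvd dt (E(k := (\<lambda>j. Cst (v j))))"
proof (rule pw_dvd)
  fix H assume H: "H \<in> R"
  then obtain w where w: "dot (al H) w = 0" "dot (al H0) w = 1"
    using separate[of H H0] H0 by auto
  have "dt (E(k := (\<lambda>j. Cst (v j)))) = dt (E(k := (\<lambda>j. Cst (w j))))"
    by (subst dt_const_row[of k E w]) (use E v w in \<open>auto simp: D0_iff der_app_const Cst_simps\<close>)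
  also have "l H ^ m H dvd \<dots>"
  proof (rule dvd_dt_if_dvd_der_app)
    show "\<exists>i. al H i \<noteq> 0" using form(1) H by blast
    show "l H ^ m H dvd der_app ((E(k := (\<lambda>j. Cst (w j)))) i) (al H)" for i
      using E[of i] H w(1) by (cases "i = k") (auto simp: D0_iff D_iff der_app_const Cst_simps)
  qed
  finally show "l H ^ m H dvd dt (E(k := (\<lambda>j. Cst (v j))))" .
qed auto

text \<open>Heaviness enters by counting degrees: at most one member of a homogeneous basis that does not
  annihilate the form of H0 can have degree larger than m H0.\<close>

lemma free_imp_euler:
  assumes "free_multiarr A m"
  obtains E k c where "generates E" "c \<noteq> 0" "der_app (E k) (al H0) = Cst c * l H0 ^ m H0"
proof -
  obtain E d where gen: "generates E" and hom: "\<forall>i. homogT (d i) (E i)" and dt_nz: "dt E \<noteq> 0"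
    using homogeneous_family_basis[OF assms] .
  have E: "\<And>i. E i \<in> D" "\<And>i. homogT (d i) (E i)" "dt E \<noteq> 0"
    using gen hom dt_nz by (auto simp: generates_def)
  obtain u where u: "u dvd 1" "dt E = pw A * u" using saito[OF gen] .
  have "homog (sum d UNIV) (dt E)" using E(2) by (intro homog_dt) (simp add: homogT_def)
  then have hu: "homog (sum d UNIV) (u * pw A)" by (simp add: u(2) mult.commute)
  have nz: "u * pw A \<noteq> 0" using E(3) u(2) by (simp add: mult.commute)
  have "sum m A \<le> sum d UNIV" "homog (sum d UNIV - sum m A) u"
    using homog_quotient[OF hu homog_pw nz] by auto
  \<comment> \<open>The unit u is homogeneous of degree sum d - |m|, hence of degree 0.\<close>
  then have deg: "sum d UNIV = sum m A" using homog_unit[OF _ u(1)] by (metis diff_is_0_eq le_antisym)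
  have "l H0 ^ m H0 dvd der_app (E i) (al H0)" for i using E(1) H0 by (simp add: D_iff)
  then have "\<exists>h. der_app (E i) (al H0) = h * l H0 ^ m H0" for i by (auto simp: dvd_def mult.commute)
  then obtain h where h: "\<And>i. der_app (E i) (al H0) = h i * l H0 ^ m H0" by metis
  have hl: "homog (m H0) (l H0 ^ m H0)" using homog_l_pow[of "m H0" H0] by simp
  have hh: "homog (d i - m H0) (h i)" "m H0 \<le> d i" if "h i \<noteq> 0" for i
  proof -
    have "homog (d i) (h i * l H0 ^ m H0)"
      using E(2)[of i] h[of i] hcomp_der_app[of "d i" "E i" "al H0"] by (simp add: homogT_def homog_def)
    moreover have "h i * l H0 ^ m H0 \<noteq> 0" using that l_nz[OF H0] by simp
    ultimately show "homog (d i - m H0) (h i)" "m H0 \<le> d i" using homog_quotient[OF _ hl] by blast+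
  qed
  have "\<exists>i. h i \<noteq> 0"
  proof (rule ccontr)
    assume "\<nexists>i. h i \<noteq> 0"
    then have "dt E = 0" by (intro dt_eq_0_if_der_app[OF form(1)[OF H0]]) (simp add: h)
    then show False using E(3) by simp
  qed
  then obtain k where k: "h k \<noteq> 0" by blast
  have "\<exists>k. h k \<noteq> 0 \<and> d k = m H0"
  proof (cases "\<exists>i. i \<noteq> k \<and> h i \<noteq> 0")
    case True
    then obtain i where i: "i \<noteq> k" "h i \<noteq> 0" by blast
    \<comment> \<open>Both degrees are at least m H0 and their sum is at most |m| <= 2 m H0, so both
      equal m H0.\<close>
    have "d i + d k = sum d {i, k}" using i(1) by simp
    also have "\<dots> \<le> sum d UNIV" by (intro sum_mono2) auto
    also have "\<dots> \<le> 2 * m H0" using heavy deg by (simp add: heavy_def total_mult_def)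
    finally show ?thesis using hh(2)[OF k] hh(2)[OF i(2)] k by (intro exI[of _ k]) simp
  next
    case False
    \<comment> \<open>Here only E k has a nonzero value on alpha. Evaluating the determinant in row
      k and comparing with Saito's criterion shows that h k divides a unit.\<close>
    obtain v where v: "dot (al H0) v = 1" using const_vector .
    have D0: "E i \<in> D0" if "i \<noteq> k" for i using E(1) False that by (auto simp: D0_iff h)
    obtain s where s: "dt (E(k := (\<lambda>j. Cst (v j)))) = Q0 * s" using Q0_dvd_dt[OF D0 v] ..
    have "dt E = der_app (E k) (al H0) * dt (E(k := (\<lambda>j. Cst (v j))))"
      using dt_const_row[of k E v "E k"] D0 v by (simp add: D0_iff)
    also have "\<dots> = pw A * (h k * s)"
      unfolding s h pw_split[OF subset_refl H0] by (simp only: mult_ac)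
    finally have "u = h k * s" using u(2) pol_mult_left_cancel[OF pw_nz[OF subset_refl]] by metis
    then have "h k dvd 1" using u(1) dvd_mult_left by blast
    then have "d k - m H0 = 0" using homog_unit[OF hh(1)[OF k]] by metis
    then show ?thesis using hh(2)[OF k] k by (intro exI[of _ k]) simp
  qed
  then obtain k where k: "h k \<noteq> 0" "d k = m H0" by blast
  then have "h k = Cst (Poly_Mapping.lookup (h k) 0)" using hh(1)[OF k(1)] homog_0_Cst by simp
  moreover from this have "Poly_Mapping.lookup (h k) 0 \<noteq> 0" using k(1) by (metis Cst_simps(1))
  ultimately show ?thesis using that[OF gen] h by metis
qed

text \<open>The member with value c alpha^m0 clears the values of all others on alpha. Saito's
  criterion for the new family then gives the determinant, once alpha^m0 is cancelled.\<close>

lemma free_imp_D0_family: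
  assumes "free_multiarr A m"
  obtains E k g where "\<forall>i. i \<noteq> k \<longrightarrow> E i \<in> D0" "g dvd 1"
    "\<forall>v. dot (al H0) v = 1 \<longrightarrow> dt (E(k := (\<lambda>j. Cst (v j)))) = Q0 * g"
proof -
  obtain E k c where gen: "generates E" and c: "c \<noteq> 0"
    and ek: "der_app (E k) (al H0) = Cst c * l H0 ^ m H0"
    using free_imp_euler[OF assms] .
  have E: "\<And>i. E i \<in> D" and span: "\<And>\<theta>. \<theta> \<in> D \<Longrightarrow> \<exists>c. \<theta> = (\<lambda>j. \<Sum>k\<in>UNIV. c k * E k j)"
    using gen by (auto simp: generates_def)
  have "\<exists>h. der_app (E i) (al H0) = l H0 ^ m H0 * h" for i
    using E[of i] H0 by (auto simp: D_iff dvd_def)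
  then obtain h where h: "\<And>i. der_app (E i) (al H0) = l H0 ^ m H0 * h i" by metis
  \<comment> \<open>The value 0 at k keeps the member E k itself.\<close>
  define x where "x i = (if i = k then 0 else Cst (inverse c) * h i)" for i
  define F where "F i = (\<lambda>j. E i j - x i * E k j)" for i
  have FD: "F i \<in> D" for i unfolding F_def by (intro D_diff D_mult E)
  have Fk: "F k = E k" by (simp add: F_def x_def)
  have F0: "F i \<in> D0" if "i \<noteq> k" for i
  proof -
    have "der_app (F i) (al H0) = l H0 ^ m H0 * h i - Cst (inverse c) * h i * (Cst c * l H0 ^ m H0)"
      unfolding F_def der_app_diff der_app_mult h[of i] ek using that by (simp add: x_def)
    also have "\<dots> = l H0 ^ m H0 * h i - (Cst c * Cst (inverse c)) * (l H0 ^ m H0 * h i)"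
      by (simp only: mult_ac)
    finally show ?thesis using FD unfolding Cst_inverse[OF c] by (simp add: D0_iff)
  qed
  have "\<exists>c. \<theta> = (\<lambda>j. \<Sum>i\<in>UNIV. c i * F i j)" if \<theta>: "\<theta> \<in> D" for \<theta>
  proof -
    obtain c where c: "\<theta> = (\<lambda>j. \<Sum>i\<in>UNIV. c i * E i j)" using span[OF \<theta>] by blast
    define c' where "c' i = c i + (if i = k then (\<Sum>i\<in>UNIV. c i * x i) else 0)" for i
    have "(\<Sum>i\<in>UNIV. c' i * F i j) = \<theta> j" for j
    proof -
      have "(\<Sum>i\<in>UNIV. c' i * F i j)
          = (\<Sum>i\<in>UNIV. c i * F i j + (if i = k then (\<Sum>i\<in>UNIV. c i * x i) * F k j else 0))"
        by (rule sum.cong) (auto simp: c'_def distrib_right)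
      also have "\<dots> = (\<Sum>i\<in>UNIV. c i * F i j) + (\<Sum>i\<in>UNIV. c i * x i) * F k j"
        by (simp add: sum.distrib)
      also have "\<dots> = (\<Sum>i\<in>UNIV. c i * F i j + c i * x i * E k j)"
        by (simp add: sum.distrib sum_distrib_right Fk)
      also have "\<dots> = (\<Sum>i\<in>UNIV. c i * E i j)"
        by (rule sum.cong) (auto simp: F_def algebra_simps)
      finally show ?thesis using c by simp
    qed
    then show ?thesis by (intro exI[of _ c']) auto
  qed
  then have "generates F" using FD by (simp add: generates_def)
  then obtain u where u: "u dvd 1" "dt F = pw A * u" by (rule saito)
  show ?thesis
  proof (rule that)
    show "\<forall>i. i \<noteq> k \<longrightarrow> F i \<in> D0" using F0 by blast
    show "Cst (inverse c) * u dvd 1"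
      using u(1) Cst_dvd_one[of "inverse c"] c mult_dvd_mono[of "Cst (inverse c)" 1 u 1] by simp
    show "\<forall>v. dot (al H0) v = 1 \<longrightarrow> dt (F(k := (\<lambda>j. Cst (v j)))) = Q0 * (Cst (inverse c) * u)"
    proof (intro allI impI)
      fix v assume v: "dot (al H0) v = 1"
      have "dt F = der_app (F k) (al H0) * dt (F(k := (\<lambda>j. Cst (v j))))"
        using dt_const_row[of k F v "F k"] F0 v by (simp add: D0_iff)
      then have "l H0 ^ m H0 * (Cst c * dt (F(k := (\<lambda>j. Cst (v j))))) = l H0 ^ m H0 * (Q0 * u)"
        unfolding Fk ek u(2) pw_split[OF subset_refl H0] by (simp only: mult_ac)
      then have eq: "Cst c * dt (F(k := (\<lambda>j. Cst (v j)))) = Q0 * u"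
        using pol_mult_left_cancel l_nz[OF H0] by (metis pol_power_eq_0_iff)
      have "dt (F(k := (\<lambda>j. Cst (v j)))) = (Cst c * Cst (inverse c)) * dt (F(k := (\<lambda>j. Cst (v j))))"
        unfolding Cst_inverse[OF c] by simp
      also have "\<dots> = Cst (inverse c) * (Cst c * dt (F(k := (\<lambda>j. Cst (v j)))))" by (simp only: mult_ac)
      also have "\<dots> = Q0 * (Cst (inverse c) * u)" unfolding eq by (simp only: mult_ac)
      finally show "dt (F(k := (\<lambda>j. Cst (v j)))) = Q0 * (Cst (inverse c) * u)" .
    qed
  qed
qed

subsection \<open>The restriction of a free arrangement\<close>

abbreviation "el \<equiv> elim (al H0)"

lemma el_dvd: "l H0 dvd f \<longleftrightarrow> el f = 0"
  by (rule linf_dvd_iff_elim[OF form(1)[OF H0]])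

lemma el_lift: assumes "el g dvd el f" shows "\<exists>s. l H0 dvd f - g * s"
proof -
  obtain s where s: "el f = el g * s" using assms by (rule dvdE)
  have "el f = el (el g * s)" unfolding s[symmetric] elim_elim[OF form(1)[OF H0]] ..
  then have "el (f - g * s) = 0"
    by (simp add: elim_diff elim_mult elim_elim[OF form(1)[OF H0]])
  then show ?thesis using el_dvd by blast
qed

section \<open>Forms and multiplicities of the restriction\<close>

definition rep :: "('n \<Rightarrow> 'a) set \<Rightarrow> ('n \<Rightarrow> 'a) set" where
  "rep X = (SOME H. H \<in> R \<and> H0 \<inter> H = X)"

abbreviation "RX X \<equiv> {H \<in> R. X \<subseteq> H}"
abbreviation "mX \<equiv> restr_mult A m H0"

text \<open>\<open>rep\<close> repeats the choice made inside \<open>restr_form\<close>, so that the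
  two agree literally.\<close>

lemma restr_form_rep: "restr_form A H0 X = al (rep X)"
  by (simp add: restr_form_def rep_def)

lemma rep: assumes "X \<in> restr A H0" shows "rep X \<in> R" "H0 \<inter> rep X = X"
proof -
  have "\<exists>H. H \<in> R \<and> H0 \<inter> H = X" using assms by (auto simp: restr_def)
  then have "rep X \<in> R \<and> H0 \<inter> rep X = X" unfolding rep_def by (rule someI_ex)
  then show "rep X \<in> R" "H0 \<inter> rep X = X" by blast+
qed

text \<open>The hyperplanes through the intersection of H1 and H2 form a pencil. With y = 0 the form
  of H would be a multiple of that of H1, against H \<noteq> H1.\<close>

lemma form_pair:
  assumes "H1 \<in> A" "H2 \<in> A" "H1 \<noteq> H2" and H: "H \<in> A" "H1 \<inter> H2 \<subseteq> H" "H \<noteq> H1"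
  obtains x y where "y \<noteq> 0" "\<forall>i. al H i = x * al H1 i + y * al H2 i"
proof -
  obtain u where u: "dot (al H2) u = 0" "dot (al H1) u = 1"
    using separate[OF assms(2,1) assms(3)[symmetric]] .
  obtain w where w: "dot (al H1) w = 0" "dot (al H2) w = 1" using separate[OF assms(1-3)] .
  have ker: "dot (al H) v = 0" if "dot (al H1) v = 0" "dot (al H2) v = 0" for v
  proof -
    have "v \<in> H1 \<inter> H2" using that form(2)[OF assms(1)] form(2)[OF assms(2)] by simp
    then show ?thesis using H(2) form(2)[OF H(1)] by blast
  qed
  have eq: "\<forall>i. al H i = dot (al H) u * al H1 i + dot (al H) w * al H2 i"
    by (rule allI, rule form_in_span[OF u(2) u(1) w ker])
  have "dot (al H) w \<noteq> 0"
  proof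
    assume "dot (al H) w = 0"
    then have "l H = Cst (dot (al H) u) * l H1" using form_lincomb(2)[OF eq] by simp
    then have "l H1 dvd l H" by simp
    then show False using not_dvd[OF assms(1) H(1)] H(3) by auto
  qed
  then show ?thesis using that eq by blast
qed

lemma form_over_X:
  assumes X: "X \<in> restr A H0" and H: "H \<in> RX X"
  obtains x y where "y \<noteq> 0" "\<forall>i. al H i = x * al H0 i + y * al (rep X) i"
proof (rule form_pair)
  show "rep X \<in> A" "H0 \<noteq> rep X" "H0 \<inter> rep X \<subseteq> H" using rep[OF X] H by auto
qed (use H H0 that in auto)

text \<open>The multiplicity of X is defined by containment, while Q0 is grouped along the fibres of
  the map sending H to its trace on H0; both describe the same hyperplanes.\<close>

lemma RX_iff: assumes X: "X \<in> restr A H0" and H: "H \<in> R" shows "X \<subseteq> H \<longleftrightarrow> H0 \<inter> H = X"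
proof
  assume "X \<subseteq> H"
  then obtain x y where xy: "y \<noteq> 0" "\<forall>i. al H i = x * al H0 i + y * al (rep X) i"
    using form_over_X[OF X, of H] H by blast
  have "dot (al H) v = x * dot (al H0) v + y * dot (al (rep X)) v" for v
    by (rule form_lincomb(1)[OF xy(2)])
  then have "v \<in> H \<longleftrightarrow> v \<in> rep X" if "v \<in> H0" for v
    using that xy(1) form(2) H H0 rep(1)[OF X] by auto
  then show "H0 \<inter> H = X" using rep(2)[OF X] by blast
qed auto

lemma el_l_over_X:
  assumes "X \<in> restr A H0" "H \<in> RX X"
  shows "el (l H) dvd el (l (rep X))" "el (l (rep X)) dvd el (l H)"
proof -
  obtain x y where xy: "y \<noteq> 0" "\<forall>i. al H i = x * al H0 i + y * al (rep X) i"
    using form_over_X[OF assms] .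
  have eq: "el (l H) = Cst y * el (l (rep X))"
    by (simp add: form_lincomb(2)[OF xy(2)] elim_add elim_mult elim_Cst elim_self[OF form(1)[OF H0]])
  then show "el (l (rep X)) dvd el (l H)" by simp
  have "Cst (inverse y) * el (l H) = (Cst y * Cst (inverse y)) * el (l (rep X))"
    unfolding eq by (simp only: mult_ac)
  then have "el (l (rep X)) = Cst (inverse y) * el (l H)"
    unfolding Cst_inverse[OF xy(1)] by simp
  then show "el (l H) dvd el (l (rep X))" by simp
qed

lemma el_pw_RX:
  assumes "X \<in> restr A H0"
  shows "el (pw (RX X)) dvd el (l (rep X)) ^ mX X" "el (l (rep X)) ^ mX X dvd el (pw (RX X))"
proof -
  have "el (l (rep X)) ^ mX X = (\<Prod>H\<in>RX X. el (l (rep X)) ^ m H)"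
    by (simp add: restr_mult_def power_sum)
  moreover have "el (pw (RX X)) = (\<Prod>H\<in>RX X. el (l H) ^ m H)"
    by (simp add: pw_def elim_prod elim_power)
  ultimately show "el (pw (RX X)) dvd el (l (rep X)) ^ mX X" "el (l (rep X)) ^ mX X dvd el (pw (RX X))"
    using el_l_over_X[OF assms] by (auto intro!: prod_dvd_prod dvd_power_same)
qed

lemma Dres_iff:
  "\<theta> \<in> Dres A m H0 \<longleftrightarrow> l H0 dvd der_app \<theta> (al H0) \<and>
    (\<forall>X\<in>restr A H0. el (l (rep X)) ^ mX X dvd el (der_app \<theta> (al (rep X))))"
proof -
  have "(\<exists>g h. f = p * g + l H0 * h) \<longleftrightarrow> el p dvd el f" for f p
  proof
    assume "\<exists>g h. f = p * g + l H0 * h"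
    then show "el p dvd el f" by (auto simp: elim_add elim_mult elim_self[OF form(1)[OF H0]])
  next
    assume "el p dvd el f"
    then obtain s h where "f - p * s = l H0 * h" using el_lift unfolding dvd_def by blast
    then have "f = p * s + l H0 * h" by (simp add: algebra_simps)
    then show "\<exists>g h. f = p * g + l H0 * h" by blast
  qed
  then show ?thesis unfolding Dres_def restr_form_rep by (simp add: elim_power)
qed

text \<open>A derivation killing alpha takes proportional values on all forms of the pencil over X.
  The value on the form of \<open>rep X\<close> is thus divisible by l H ^ m H for every H over X,
  hence by their product, whose exponents add up to the multiplicity of X.\<close>

lemma D0_subset_Dres: "D0 \<subseteq> Dres A m H0"
proof
  fix \<delta> assume \<delta>: "\<delta> \<in> D0"
  show "\<delta> \<in> Dres A m H0" unfolding Dres_iff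
  proof (intro conjI ballI)
    show "l H0 dvd der_app \<delta> (al H0)" using \<delta> by (simp add: D0_iff)
    fix X assume X: "X \<in> restr A H0"
    have "pw (RX X) dvd der_app \<delta> (al (rep X))"
    proof (rule pw_dvd)
      fix H assume H: "H \<in> RX X"
      obtain x y where xy: "y \<noteq> 0" "\<forall>i. al H i = x * al H0 i + y * al (rep X) i"
        using form_over_X[OF X H] .
      have "der_app \<delta> (al H) = Cst y * der_app \<delta> (al (rep X))"
        using \<delta> form_lincomb(3)[OF xy(2)] by (simp add: D0_iff)
      then have "Cst (inverse y) * der_app \<delta> (al H) = (Cst y * Cst (inverse y)) * der_app \<delta> (al (rep X))"
        by (simp only: mult_ac)
      then have "der_app \<delta> (al (rep X)) = Cst (inverse y) * der_app \<delta> (al H)"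
        unfolding Cst_inverse[OF xy(1)] by simp
      moreover have "l H ^ m H dvd der_app \<delta> (al H)" using \<delta> H by (simp add: D0_iff D_iff)
      ultimately show "l H ^ m H dvd der_app \<delta> (al (rep X))" by simp
    qed auto
    then have "el (pw (RX X)) dvd el (der_app \<delta> (al (rep X)))" by (auto simp: dvd_def elim_mult)
    then show "el (l (rep X)) ^ mX X dvd el (der_app \<delta> (al (rep X)))"
      using el_pw_RX(2)[OF X] dvd_trans by blast
  qed
qed

lemma el_Q0: "el Q0 = (\<Prod>X\<in>restr A H0. el (pw (RX X)))"
proof -
  have "(\<Prod>X\<in>restr A H0. prod (\<lambda>H. el (l H) ^ m H) {H \<in> R. H0 \<inter> H = X}) = (\<Prod>H\<in>R. el (l H) ^ m H)"
    by (rule prod.group) (use finA in \<open>auto simp: restr_def\<close>)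
  moreover have "{H \<in> R. H0 \<inter> H = X} = RX X" if "X \<in> restr A H0" for X
    using RX_iff[OF that] by blast
  ultimately show ?thesis by (simp add: pw_def elim_prod elim_power)
qed

text \<open>Forms of different X stay non-proportional after alpha is eliminated, so their powers
  are pairwise coprime; their product is associated to the image of Q0.\<close>

lemma el_Q0_dvd:
  assumes "\<And>X. X \<in> restr A H0 \<Longrightarrow> el (l (rep X)) ^ mX X dvd f"
  shows "el Q0 dvd f"
proof -
  define \<gamma> where "\<gamma> X = (\<lambda>j. al (rep X) j - elim_coeff (al H0) (al (rep X)) * al H0 j)" for X
  have el: "el (l (rep X)) = linf (\<gamma> X)" for X by (simp add: \<gamma>_def elim_linf)
  have "(\<Prod>X\<in>restr A H0. linf (\<gamma> X) ^ mX X) dvd f"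
  proof (rule prod_linf_power_dvd)
    show "finite (restr A H0)" using finA by (simp add: restr_def)
    show "linf (\<gamma> X) ^ mX X dvd f" if "X \<in> restr A H0" for X using assms[OF that] el by simp
    show nz: "\<exists>i. \<gamma> X i \<noteq> 0" if X: "X \<in> restr A H0" for X
    proof -
      have "el (l (rep X)) \<noteq> 0"
        using not_dvd[OF H0, of "rep X"] rep(1)[OF X] by (auto simp flip: el_dvd)
      then show ?thesis unfolding el linf_eq_0_iff by blast
    qed
    show "\<not> linf (\<gamma> X) dvd linf (\<gamma> Y)" if X: "X \<in> restr A H0" and Y: "Y \<in> restr A H0" and ne: "X \<noteq> Y" for X Y
    proof
      assume "linf (\<gamma> X) dvd linf (\<gamma> Y)"
      then obtain s where s: "\<forall>i. \<gamma> Y i = s * \<gamma> X i" using linf_dvd_linf nz[OF X] by blast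
      \<comment> \<open>Undoing the elimination: proportionality modulo alpha puts the form of
        \<open>rep Y\<close> into the span of alpha and the form of \<open>rep X\<close>.\<close>
      define tX tY where "tX = elim_coeff (al H0) (al (rep X))" and "tY = elim_coeff (al H0) (al (rep Y))"
      have eq: "\<forall>i. al (rep Y) i = (tY - s * tX) * al H0 i + s * al (rep X) i"
        using s by (simp add: \<gamma>_def tX_def tY_def algebra_simps)
      note d = form_lincomb(1)[OF eq]
      have rX: "rep X \<in> A" and rY: "rep Y \<in> A" using rep(1) X Y by auto
      have "X \<subseteq> rep Y"
      proof
        fix v assume "v \<in> X"
        then have "v \<in> H0" "v \<in> rep X" using rep(2)[OF X] by auto
        then have "dot (al H0) v = 0" "dot (al (rep X)) v = 0"
          using form(2)[OF H0] form(2)[OF rX] by simp_all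
        then show "v \<in> rep Y" unfolding form(2)[OF rY] d by simp
      qed
      then have "H0 \<inter> rep Y = X" using RX_iff[OF X rep(1)[OF Y]] by simp
      then show False using rep(2)[OF Y] ne by simp
    qed
  qed
  moreover have "el Q0 dvd (\<Prod>X\<in>restr A H0. linf (\<gamma> X) ^ mX X)"
    unfolding el_Q0 el[symmetric] using el_pw_RX(1) by (rule prod_dvd_prod)
  ultimately show ?thesis by (rule dvd_trans[rotated])
qed

text \<open>Cramer's rule: the coefficients are determinants divisible by Q0 modulo the form of H0.\<close>

lemma Dres_span:
  assumes E: "\<And>i. i \<noteq> k \<Longrightarrow> E i \<in> D0" and g: "g dvd 1"
    and det: "\<And>v. dot (al H0) v = 1 \<Longrightarrow> dt (E(k := (\<lambda>j. Cst (v j)))) = Q0 * g"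
    and \<theta>: "\<theta> \<in> Dres A m H0"
  obtains c where "cong_der (l H0) \<theta> (\<lambda>j. \<Sum>i\<in>UNIV - {k}. c i * E i j)"
proof -
  obtain v where v: "dot (al H0) v = 1" using const_vector .
  \<comment> \<open>Since alpha divides \<theta>(alpha), this changes \<theta> only modulo alpha,
    and the result annihilates alpha exactly.\<close>
  define \<theta>' where "\<theta>' = (\<lambda>j. \<theta> j - der_app \<theta> (al H0) * Cst (v j))"
  have \<theta>'0: "der_app \<theta>' (al H0) = 0"
    unfolding \<theta>'_def der_app_diff der_app_mult der_app_const v by (simp add: Cst_simps)
  define F where "F = E(k := (\<lambda>j. Cst (v j)))"
  have E0: "der_app (E i) (al H0) = 0" if "i \<noteq> k" for i using E[OF that] by (simp add: D0_iff)
  have "dt (F(k := \<theta>')) = 0"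
    unfolding F_def using dt_const_row[of k E v \<theta>'] E0 v \<theta>'0 by simp
  have lift: "\<exists>s. l H0 dvd dt (F(i := \<theta>')) - Q0 * s" if i: "i \<noteq> k" for i
  proof (rule el_lift[OF el_Q0_dvd])
    fix X assume X: "X \<in> restr A H0"
    have r: "rep X \<in> A" "rep X \<noteq> H0" using rep[OF X] by auto
    \<comment> \<open>As in \<open>Q0_dvd_dt\<close>, the constant row is exchanged for a vector of
      the hyperplane at which divisibility is tested.\<close>
    obtain w where w: "dot (al (rep X)) w = 0" "dot (al H0) w = 1" using separate[OF r(1) H0 r(2)] .
    define G where "G = (E(i := \<theta>'))(k := (\<lambda>j. Cst (w j)))"
    have "F(i := \<theta>') = (E(i := \<theta>'))(k := (\<lambda>j. Cst (v j)))"
      using i by (auto simp: F_def)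
    then have FG: "dt (F(i := \<theta>')) = dt G"
      unfolding G_def using dt_const_row[of k "E(i := \<theta>')" w "\<lambda>j. Cst (v j)"] E0 \<theta>'0 v w(2)
      by (simp add: der_app_const Cst_simps)
    have "el (l (rep X)) ^ mX X dvd dt (\<lambda>i j. el (G i j))"
    proof (rule dvd_dt_if_dvd_der_app[OF form(1)[OF r(1)]])
      fix j
      have Ds: "el (l (rep X)) ^ mX X dvd el (der_app \<xi> (al (rep X)))" if "\<xi> \<in> Dres A m H0" for \<xi>
        using that X by (simp add: Dres_iff)
      consider "j = k" | "j = i" "j \<noteq> k" | "j \<noteq> i" "j \<noteq> k" by blast
      then have "el (l (rep X)) ^ mX X dvd el (der_app (G j) (al (rep X)))"
      proof cases
        case 1
        then show ?thesis using w(1) by (simp add: G_def der_app_const Cst_simps elim_zero)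
      next
        case 2
        have "el (der_app \<theta> (al H0)) = 0" using \<theta> by (simp add: Dres_iff el_dvd)
        then have "el (der_app \<theta>' (al (rep X))) = el (der_app \<theta> (al (rep X)))"
          unfolding \<theta>'_def der_app_diff der_app_mult by (simp add: elim_diff elim_mult)
        then show ?thesis using 2 Ds[OF \<theta>] by (simp add: G_def)
      next
        case 3
        then show ?thesis using Ds D0_subset_Dres E[of j] by (auto simp: G_def)
      qed
      then show "el (l (rep X)) ^ mX X dvd der_app (\<lambda>ja. el (G j ja)) (al (rep X))"
        unfolding elim_der_app .
    qed
    then show "el (l (rep X)) ^ mX X dvd el (dt (F(i := \<theta>')))"
      unfolding FG elim_dt .
  qed
  then obtain s where s: "\<And>i. i \<noteq> k \<Longrightarrow> l H0 dvd dt (F(i := \<theta>')) - Q0 * s i" by metis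
  obtain g' where g': "g * g' = 1" using g by (metis dvdE)
  have "l H0 dvd \<theta> j - (\<Sum>i\<in>UNIV - {k}. (g' * s i) * E i j)" for j
  proof -
    have "dt F * \<theta>' j = (\<Sum>i\<in>UNIV. dt (F(i := \<theta>')) * F i j)" by (rule dt_adjugate[symmetric])
    also have "\<dots> = (\<Sum>i\<in>UNIV - {k}. dt (F(i := \<theta>')) * E i j)"
      using \<open>dt (F(k := \<theta>')) = 0\<close> by (intro sum.mono_neutral_cong_right) (auto simp: F_def)
    finally have eq: "Q0 * g * \<theta>' j = (\<Sum>i\<in>UNIV - {k}. dt (F(i := \<theta>')) * E i j)"
      using det[OF v] by (simp add: F_def)
    have "l H0 dvd (\<Sum>i\<in>UNIV - {k}. (dt (F(i := \<theta>')) - Q0 * s i) * E i j)"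
      using s by (intro dvd_sum dvd_mult2) auto
    also have "\<dots> = Q0 * (g * \<theta>' j - (\<Sum>i\<in>UNIV - {k}. s i * E i j))"
      unfolding left_diff_distrib sum_subtractf eq[symmetric] right_diff_distrib sum_distrib_left by (simp only: mult.assoc)
    finally have "l H0 dvd g * \<theta>' j - (\<Sum>i\<in>UNIV - {k}. s i * E i j)"
      using linf_prime[OF form(1)[OF H0]] not_dvd_pw[OF _ H0, of R] by blast
    then have "l H0 dvd g' * (g * \<theta>' j - (\<Sum>i\<in>UNIV - {k}. s i * E i j))" by (rule dvd_mult)
    also have "\<dots> = (g * g') * \<theta>' j - (\<Sum>i\<in>UNIV - {k}. (g' * s i) * E i j)"
      unfolding right_diff_distrib sum_distrib_left by (simp only: mult_ac)
    finally have "l H0 dvd \<theta>' j - (\<Sum>i\<in>UNIV - {k}. (g' * s i) * E i j)" by (simp add: g')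
    moreover have "l H0 dvd der_app \<theta> (al H0) * Cst (v j)" using \<theta> by (simp add: Dres_iff)
    ultimately have "l H0 dvd (\<theta>' j - (\<Sum>i\<in>UNIV - {k}. (g' * s i) * E i j)) + der_app \<theta> (al H0) * Cst (v j)"
      by (rule dvd_add)
    then show ?thesis by (simp add: \<theta>'_def algebra_simps)
  qed
  then show ?thesis using that[of "\<lambda>i. g' * s i"] by (simp add: cong_der_def)
qed

text \<open>Generation and surjectivity come from \<open>Dres_span\<close>. For independence,
  Cramer's rule turns a relation modulo alpha into divisibility of x i * dt F by the prime alpha,
  which does not divide dt F = Q0 * g.\<close>

lemma free_imp_restr:
  assumes "free_multiarr A m"
  shows "free_restr A m H0" "res_surj A m H0"
proof -
  obtain E k g where "\<forall>i. i \<noteq> k \<longrightarrow> E i \<in> D0" and g: "g dvd 1"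
    and "\<forall>v. dot (al H0) v = 1 \<longrightarrow> dt (E(k := (\<lambda>j. Cst (v j)))) = Q0 * g"
    using free_imp_D0_family[OF assms] .
  then have E: "\<And>i. i \<noteq> k \<Longrightarrow> E i \<in> D0"
    and det: "\<And>v. dot (al H0) v = 1 \<Longrightarrow> dt (E(k := (\<lambda>j. Cst (v j)))) = Q0 * g"
    by simp_all
  obtain v where v: "dot (al H0) v = 1" using const_vector .
  define F where "F = E(k := (\<lambda>j. Cst (v j)))"
  have dtF: "dt F = Q0 * g" unfolding F_def by (rule det[OF v])
  have not_l: "\<not> l H0 dvd dt F"
  proof
    assume "l H0 dvd dt F"
    then have "l H0 dvd g"
      unfolding dtF linf_prime[OF form(1)[OF H0]] using not_dvd_pw[OF _ H0, of R] by blast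
    then have "l H0 dvd 1" using g by (rule dvd_trans)
    then show False by (simp add: el_dvd elim_one)
  qed
  show "res_surj A m H0" unfolding res_surj_def
  proof
    fix \<theta> assume "\<theta> \<in> Dres A m H0"
    then obtain c where "cong_der (l H0) \<theta> (\<lambda>j. \<Sum>i\<in>UNIV - {k}. c i * E i j)"
      using Dres_span[OF E g det] by blast
    moreover have "(\<lambda>j. \<Sum>i\<in>UNIV - {k}. c i * E i j) \<in> D0"
      using E by (intro D0_sum D0_mult) auto
    ultimately show "\<exists>\<delta>\<in>D0. cong_der (l H0) \<delta> \<theta>" using cong_der_sym by blast
  qed
  have inj: "inj_on E (UNIV - {k})"
  proof (rule inj_onI, rule ccontr)
    fix i j assume "i \<in> UNIV - {k}" "j \<in> UNIV - {k}" "E i = E j" "i \<noteq> j"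
    then have "dt F = 0" using dt_eq_rows[of i j F] by (simp add: F_def)
    then show False using not_l by simp
  qed
  have reidx: "(\<Sum>b\<in>E ` (UNIV - {k}). c b * b j) = (\<Sum>i\<in>UNIV - {k}. c (E i) * E i j)" for c j
    by (simp add: sum.reindex[OF inj])
  have "is_basis (l H0) (Dres A m H0) (E ` (UNIV - {k}))"
    unfolding is_basis_def
  proof (intro conjI allI impI ballI)
    show "E ` (UNIV - {k}) \<subseteq> Dres A m H0" using E D0_subset_Dres by auto
    show "Dres A m H0 \<subseteq> spn (l H0) (E ` (UNIV - {k}))"
    proof
      fix \<theta> assume "\<theta> \<in> Dres A m H0"
      then obtain c where c: "cong_der (l H0) \<theta> (\<lambda>j. \<Sum>i\<in>UNIV - {k}. c i * E i j)"
        using Dres_span[OF E g det] by blast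
      show "\<theta> \<in> spn (l H0) (E ` (UNIV - {k}))"
        by (rule spn_cong[OF c]) (intro spn_sum spn_mult spn_base; simp)
    qed
    fix c b assume c: "cong_der (l H0) (\<lambda>j. \<Sum>b\<in>E ` (UNIV - {k}). c b * b j) (\<lambda>j. 0)"
      and "b \<in> E ` (UNIV - {k})"
    then obtain i where i: "i \<noteq> k" "b = E i" by blast
    define x where "x j = (if j = k then 0 else c (E j))" for j
    have xF: "(\<Sum>r\<in>UNIV. x r * F r j) = (\<Sum>r\<in>UNIV - {k}. c (E r) * E r j)" for j
      by (rule sum.mono_neutral_cong_right) (auto simp: x_def F_def)
    have "\<forall>j. \<exists>y. (\<Sum>r\<in>UNIV. x r * F r j) = l H0 * y"
      using c unfolding xF cong_der_def reidx by (auto elim!: dvdE)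
    from choice[OF this] obtain y where y: "\<forall>j. (\<Sum>r\<in>UNIV. x r * F r j) = l H0 * y j" ..
    have "x i * dt F = dt (F(i := (\<lambda>j. l H0 * y j)))"
      unfolding dt_cramer_row[symmetric] using y by simp
    also have "\<dots> = l H0 * dt (F(i := y))" by (rule dt_row_mult)
    finally have "l H0 dvd x i * dt F" by simp
    then have "l H0 dvd x i" using not_l unfolding linf_prime[OF form(1)[OF H0]] by blast
    then show "l H0 dvd c b" using i by (simp add: x_def)
  qed simp
  then show "free_restr A m H0" unfolding free_restr_def by (rule is_basis_imp_free)
qed

subsection \<open>A basis of the derivations annihilating the form of the heavy hyperplane\<close>

lemma Dres_hcomp: assumes "\<theta> \<in> Dres A m H0" shows "(\<lambda>i. hcomp d (\<theta> i)) \<in> Dres A m H0"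
proof -
  have "\<exists>g' h'. hcomp d (l H ^ k * g + l H0 * h) = l H ^ k * g' + l H0 * h'" for H k g h
  proof -
    have "l H ^ k dvd hcomp d (l H ^ k * g)" by (rule dvd_hcomp[OF homog_l_pow]) simp
    moreover have "l H0 dvd hcomp d (l H0 * h)" by (rule dvd_hcomp[OF homog_linf]) simp
    ultimately show ?thesis unfolding hcomp_add by (metis dvdE)
  qed
  then show ?thesis
    using assms dvd_hcomp[OF homog_linf]
    unfolding Dres_def restr_form_rep mem_Collect_eq hcomp_der_app[symmetric] by metis
qed

lemma Dres_homogeneous_basis:
  assumes "free_restr A m H0"
  obtains B where "is_basis (l H0) (Dres A m H0) B" "\<forall>b\<in>B. \<exists>d. homogT d b"
proof -
  obtain p where p: "al H0 p \<noteq> 0" using form(1)[OF H0] by blast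
  \<comment> \<open>The projection e_i - (a_i / a_p) e_p into the kernel of alpha. Modulo alpha an
    element \<theta> of \<open>Dres\<close> is the sum of the \<theta> i * w i, so Q0 \<theta> is
    generated by the finitely many e i, which lie in D0.\<close>
  define w where "w i = (\<lambda>j. Cst (of_bool (i = j) + - (al H0 i / al H0 p) * of_bool (p = j)) :: ('n, 'a) pol)" for i
  define e where "e i = (\<lambda>j. Q0 * w i j)" for i
  have w0: "der_app (w i) (al H0) = 0" for i
  proof -
    have "dot (al H0) (\<lambda>j. of_bool (i = j) + - (al H0 i / al H0 p) * of_bool (p = j)) = 0"
      unfolding dot_add dot_scale dot_unit using p by simp
    then show ?thesis unfolding w_def der_app_const by simp
  qed
  have "e i \<in> D" for i
    unfolding e_def using w0 by (intro pw_mult_in_D) auto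
  then have "e i \<in> D0" for i
    by (simp add: D0_iff e_def der_app_mult w0)
  then have eD: "range e \<subseteq> Dres A m H0" using D0_subset_Dres by blast
  have "(\<lambda>j. Q0 * \<theta> j) \<in> spn (l H0) (range e)" if \<theta>: "\<theta> \<in> Dres A m H0" for \<theta>
  proof (rule spn_cong)
    have "(\<Sum>i\<in>UNIV. \<theta> i * w i j) = \<theta> j - Cst (of_bool (p = j) / al H0 p) * der_app \<theta> (al H0)" for j
    proof -
      have "\<theta> i * w i j = (if i = j then \<theta> j else 0) - Cst (of_bool (p = j) / al H0 p) * (Cst (al H0 i) * \<theta> i)" for i
        by (auto simp: w_def Cst_simps algebra_simps simp flip: Cst_simps(4))
      then show ?thesis by (simp add: sum_subtractf der_app_def sum_distrib_left)
    qed
    then have "l H0 dvd \<theta> j - (\<Sum>i\<in>UNIV. \<theta> i * w i j)" for j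
      using \<theta> by (simp add: Dres_iff)
    then have "l H0 dvd Q0 * (\<theta> j - (\<Sum>i\<in>UNIV. \<theta> i * w i j))" for j by (rule dvd_mult)
    then show "cong_der (l H0) (\<lambda>j. Q0 * \<theta> j) (\<lambda>j. \<Sum>i\<in>UNIV. \<theta> i * e i j)"
      unfolding cong_der_def by (simp add: e_def right_diff_distrib sum_distrib_left mult_ac)
    show "(\<lambda>j. \<Sum>i\<in>UNIV. \<theta> i * e i j) \<in> spn (l H0) (range e)"
      by (intro spn_sum spn_mult spn_base) auto
  qed
  then obtain B0 where B0: "is_basis (l H0) (Dres A m H0) B0"
    using free_imp_is_basis[OF assms[unfolded free_restr_def] _ eD, of Q0] not_dvd_pw[OF _ H0, of R]
    by auto
  obtain B where "is_basis (l H0) (Dres A m H0) B" "\<And>b. b \<in> B \<Longrightarrow> \<exists>d. homogT d b"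
    by (rule homogeneous_basis[OF homog_linf _ _ _ _ B0, of el])
      (auto simp: el_dvd elim_add elim_mult elim_Cst Dres_hcomp)
  then show ?thesis using that by blast
qed

text \<open>Consequently the kernel of the restriction map on D0 is alpha D0, as the Nakayama
  argument requires. It holds because alpha is prime to the forms of the other hyperplanes.\<close>

lemma D0_cancel_l:
  assumes "(\<lambda>i. l H0 * \<phi> i) \<in> D0" shows "\<phi> \<in> D0"
  unfolding D0_iff D_iff
proof (intro conjI ballI)
  have "l H0 * der_app \<phi> (al H0) = 0" using assms by (simp add: D0_iff der_app_mult)
  then show z: "der_app \<phi> (al H0) = 0" using l_nz[OF H0] by simp
  fix H assume H: "H \<in> A"
  show "l H ^ m H dvd der_app \<phi> (al H)"
  proof (cases "H = H0")
    case False
    have "l H ^ m H dvd l H0 * der_app \<phi> (al H)"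
      using assms H by (simp add: D0_iff D_iff der_app_mult)
    then show ?thesis
      by (rule linf_power_dvd_mult[OF form(1)[OF H] not_dvd[OF H H0 False]])
  qed (simp add: z)
qed

lemma power_dvd_all_imp_zero:
  assumes "\<And>k. l H0 ^ k dvd f" shows "f = 0"
proof (rule hcomp_eqI)
  fix d
  \<comment> \<open>The exponent d + 1 exceeds the degree of the component to be shown zero.\<close>
  obtain g where "f = l H0 ^ Suc d * g" using assms by (rule dvdE)
  then have "hcomp d f = hcomp d (g * l H0 ^ Suc d)" by (simp only: mult.commute)
  then show "hcomp d f = hcomp d 0"
    using hcomp_mult_homog[OF homog_l_pow[of "Suc d" H0], of d g] by (simp add: hcomp_zero)
qed

text \<open>Homogeneous lifts of a homogeneous basis generate by induction on the degree, and they are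
  independent because a relation could be divided by the form of H0 infinitely often.\<close>

lemma D0_basis:
  assumes "free_restr A m H0" "res_surj A m H0"
  obtains B where "is_basis 0 D0 B"
proof -
  obtain B where B: "is_basis (l H0) (Dres A m H0) B" and hom: "\<forall>b\<in>B. \<exists>d. homogT d b"
    using Dres_homogeneous_basis[OF assms(1)] .
  have fin: "finite B" and BD: "B \<subseteq> Dres A m H0" and span: "Dres A m H0 \<subseteq> spn (l H0) B"
    and indep: "\<And>c b. cong_der (l H0) (\<lambda>i. \<Sum>b\<in>B. c b * b i) (\<lambda>i. 0) \<Longrightarrow> b \<in> B \<Longrightarrow> l H0 dvd c b"
    using B unfolding is_basis_def by auto
  have "\<forall>b\<in>B. \<exists>\<delta> d. \<delta> \<in> D0 \<and> homogT d \<delta> \<and> cong_der (l H0) \<delta> b"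
  proof
    fix b assume b: "b \<in> B"
    then obtain d where d: "homogT d b" using hom by blast
    obtain \<delta> where \<delta>: "\<delta> \<in> D0" "cong_der (l H0) \<delta> b" using assms(2) BD b by (auto simp: res_surj_def)
    have "l H0 dvd hcomp d (\<delta> i) - b i" for i
      using dvd_hcomp[OF homog_linf, of "al H0" "\<delta> i - b i" d] \<delta>(2) d
      by (simp add: cong_der_def hcomp_diff homogT_def homog_def)
    then have "cong_der (l H0) (\<lambda>i. hcomp d (\<delta> i)) b" by (simp add: cong_der_def)
    then show "\<exists>\<delta> d. \<delta> \<in> D0 \<and> homogT d \<delta> \<and> cong_der (l H0) \<delta> b"
      using D0_hcomp[OF \<delta>(1)] homogT_hcomp by blast
  qed
  then obtain \<delta> d where "\<forall>b\<in>B. \<delta> b \<in> D0 \<and> homogT (d b) (\<delta> b) \<and> cong_der (l H0) (\<delta> b) b" by metis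
  then have \<delta>: "\<And>b. b \<in> B \<Longrightarrow> \<delta> b \<in> D0" "\<And>b i. b \<in> B \<Longrightarrow> homog (d b) (\<delta> b i)"
    "\<And>b. b \<in> B \<Longrightarrow> cong_der (l H0) (\<delta> b) b" by (auto simp: homogT_def)
  have lift: "cong_der (l H0) (\<lambda>i. \<Sum>b\<in>B. c b * \<delta> b i) (\<lambda>i. \<Sum>b\<in>B. c b * b i)" for c
    by (intro cong_der_sum cong_der_mult \<delta>(3))
  have indep': "c b = 0" if rel: "(\<lambda>i. \<Sum>b\<in>B. c b * \<delta> b i) = (\<lambda>i. 0)" and b: "b \<in> B" for c b
  proof (rule power_dvd_all_imp_zero)
    have "\<forall>b\<in>B. l H0 ^ k dvd c b" if "(\<lambda>i. \<Sum>b\<in>B. c b * \<delta> b i) = (\<lambda>i. 0)" for k c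
      using that
    proof (induction k arbitrary: c)
      case (Suc k)
      have "cong_der (l H0) (\<lambda>i. \<Sum>b\<in>B. c b * b i) (\<lambda>i. 0)"
        using cong_der_sym[OF lift[of c]] unfolding Suc.prems .
      then have "\<forall>b\<in>B. \<exists>c'. c b = l H0 * c'" using indep unfolding dvd_def by blast
      from bchoice[OF this] obtain c' where c': "\<forall>b\<in>B. c b = l H0 * c' b" ..
      have "(\<Sum>b\<in>B. c' b * \<delta> b i) = 0" for i
      proof -
        have "l H0 * (\<Sum>b\<in>B. c' b * \<delta> b i) = (\<Sum>b\<in>B. c b * \<delta> b i)"
          unfolding sum_distrib_left using c' by (intro sum.cong) (auto simp: mult.assoc)
        also have "\<dots> = 0" using Suc.prems by (rule fun_cong)
        finally show ?thesis using l_nz[OF H0] by simp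
      qed
      then have "\<forall>b\<in>B. l H0 ^ k dvd c' b" by (intro Suc.IH) simp
      then show ?case using c' by (simp add: mult_dvd_mono)
    qed simp
    then show "l H0 ^ k dvd c b" for k using rel b by blast
  qed
  have inj: "inj_on \<delta> B"
  proof (rule inj_onI, rule ccontr)
    fix b b' assume b: "b \<in> B" "b' \<in> B" "\<delta> b = \<delta> b'" "b \<noteq> b'"
    define c :: "_ \<Rightarrow> ('n, 'a) pol" where "c x = (if x = b then 1 else if x = b' then - 1 else 0)" for x
    have "(\<Sum>x\<in>B. c x * \<delta> x i) = (\<Sum>x\<in>{b, b'}. c x * \<delta> x i)" for i
      using b fin by (intro sum.mono_neutral_right) (auto simp: c_def)
    then have "(\<lambda>i. \<Sum>x\<in>B. c x * \<delta> x i) = (\<lambda>i. 0)" using b(3,4) by (simp add: c_def)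
    then have "c b = 0" using b(1) by (rule indep')
    then show False by (simp add: c_def)
  qed
  have sp: "\<theta> \<in> spn 0 (\<delta> ` B)" if "\<theta> \<in> D0" "\<And>i. homog n (\<theta> i)" for n \<theta>
    using that
  proof (induction n arbitrary: \<theta> rule: less_induct)
    case (less n)
    obtain c where "cong_der (l H0) \<theta> (\<lambda>i. \<Sum>b\<in>B. c b * b i)"
      using span D0_subset_Dres less.prems(1) unfolding spn_def by blast
    then have c: "cong_der (l H0) \<theta> (\<lambda>i. \<Sum>b\<in>B. c b * \<delta> b i)"
      using cong_der_sym[OF lift] cong_der_trans by blast
    \<comment> \<open>The components that make the combination homogeneous of degree n; the case
      distinction guards the truncated subtraction.\<close>
    define x where "x b = (if n < d b then 0 else hcomp (n - d b) (c b))" for b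
    define \<sigma> where "\<sigma> = (\<lambda>i. \<Sum>b\<in>B. x b * \<delta> b i)"
    have h\<sigma>: "hcomp n (\<Sum>b\<in>B. c b * \<delta> b i) = \<sigma> i" for i
      unfolding \<sigma>_def hcomp_sum by (intro sum.cong refl) (simp add: x_def hcomp_mult_homog[OF \<delta>(2)])
    have "l H0 dvd \<theta> i - \<sigma> i" for i
    proof -
      have "l H0 dvd hcomp n (\<theta> i - (\<Sum>b\<in>B. c b * \<delta> b i))"
        using c by (intro dvd_hcomp[OF homog_linf]) (simp add: cong_der_def)
      then show ?thesis using less.prems(2) by (simp add: hcomp_diff h\<sigma> homog_def)
    qed
    then have "\<forall>i. \<exists>f. \<theta> i - \<sigma> i = l H0 * f" by (simp add: dvd_def)
    from choice[OF this] obtain \<phi> where \<phi>: "\<forall>i. \<theta> i - \<sigma> i = l H0 * \<phi> i" ..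
    have \<sigma>D: "\<sigma> \<in> D0" unfolding \<sigma>_def by (intro D0_sum D0_mult \<delta>(1))
    have \<sigma>sp: "\<sigma> \<in> spn 0 (\<delta> ` B)"
      unfolding \<sigma>_def using fin by (intro spn_sum spn_mult spn_base) auto
    have "homog n (\<sigma> i)" for i using h\<sigma>[of i] homog_hcomp by metis
    then have h: "hcomp n (l H0 * \<phi> i) = l H0 * \<phi> i" for i
      using homog_diff[OF less.prems(2)] \<phi> unfolding homog_def by metis
    have eq: "\<theta> = (\<lambda>i. \<sigma> i + l H0 * \<phi> i)" using \<phi> by (auto simp: algebra_simps)
    have "(\<lambda>i. l H0 * \<phi> i) \<in> D0"
      using D_diff[of \<theta> \<sigma>] less.prems(1) \<sigma>D \<phi> der_app_diff[of \<theta> \<sigma> "al H0"] by (simp add: D0_iff)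
    then have \<phi>D: "\<phi> \<in> D0" by (rule D0_cancel_l)
    show ?case
    proof (cases n)
      \<comment> \<open>In degree 0 no nonzero polynomial is a multiple of alpha, so \<theta> is the
        combination \<sigma> itself.\<close>
      case 0
      then have "l H0 * \<phi> i = 0" for i
        using h[of i] hcomp_mult_homog[OF homog_linf[of "al H0"], of 0 "\<phi> i"] by (simp add: mult.commute)
      then have "\<theta> = \<sigma>" using eq l_nz[OF H0] by auto
      then show ?thesis using \<sigma>sp by simp
    next
      case (Suc n')
      have "l H0 * \<phi> i = l H0 * hcomp n' (\<phi> i)" for i
        using h[of i] hcomp_mult_homog[OF homog_linf[of "al H0"], of n "\<phi> i"] Suc by (simp add: mult.commute)
      then have eq': "\<theta> = (\<lambda>i. \<sigma> i + l H0 * hcomp n' (\<phi> i))" using eq by simp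
      have "(\<lambda>i. hcomp n' (\<phi> i)) \<in> spn 0 (\<delta> ` B)"
        using Suc by (intro less.IH[of n'] D0_hcomp \<phi>D homog_hcomp) simp
      then show ?thesis unfolding eq' by (intro spn_add \<sigma>sp spn_mult)
    qed
  qed
  have "D0 \<subseteq> spn 0 (\<delta> ` B)"
  proof
    fix \<theta> assume \<theta>: "\<theta> \<in> D0"
    obtain N where N: "\<And>i. (\<Sum>d\<le>N. hcomp d (\<theta> i)) = \<theta> i" using sum_hcomp_fun by blast
    have "(\<lambda>i. \<Sum>d\<le>N. hcomp d (\<theta> i)) \<in> spn 0 (\<delta> ` B)"
      by (intro spn_sum sp[OF D0_hcomp[OF \<theta>] homog_hcomp])
    then show "\<theta> \<in> spn 0 (\<delta> ` B)" by (simp add: N)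
  qed
  moreover have "0 dvd c b" if "cong_der 0 (\<lambda>i. \<Sum>b\<in>\<delta> ` B. c b * b i) (\<lambda>i. 0)" "b \<in> \<delta> ` B" for c b
    using that indep'[of "c \<circ> \<delta>"] by (auto simp: sum.reindex[OF inj] cong_der_0)
  ultimately have "is_basis 0 D0 (\<delta> ` B)"
    using fin \<delta>(1) unfolding is_basis_def by blast
  then show ?thesis using that by blast
qed

subsection \<open>The ideal of leading coefficients\<close>

definition lead :: "('n, 'a) pol set" where
  "lead = {i. \<exists>\<theta>\<in>D. der_app \<theta> (al H0) = i * l H0 ^ m H0}"

lemma pw_in_lead:
  assumes "C \<subseteq> R" "dot (al H0) v = 1" "\<And>H. H \<in> R - C \<Longrightarrow> dot (al H) v = 0"
  shows "pw C \<in> lead"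
proof -
  have "pw (insert H0 C) = l H0 ^ m H0 * pw C"
    using assms(1) H0 by (subst pw_split[of _ H0]) (auto intro!: arg_cong[of _ _ "\<lambda>C. _ * pw C"])
  then have "der_app (\<lambda>i. pw (insert H0 C) * Cst (v i)) (al H0) = pw C * l H0 ^ m H0"
    unfolding der_app_mult der_app_const by (simp add: assms(2) Cst_simps)
  moreover have "(\<lambda>i. pw (insert H0 C) * Cst (v i)) \<in> D"
    using assms H0 by (intro pw_mult_in_D) (auto simp: der_app_const)
  ultimately show ?thesis unfolding lead_def by blast
qed

text \<open>Thus for every H in R the ideal contains an explicit member that is prime to the form of
  H.\<close>

lemma pw_remove_in_lead: assumes "H \<in> R" shows "pw (R - {H}) \<in> lead"
proof -
  obtain v where "dot (al H) v = 0" "dot (al H0) v = 1" using separate[of H H0] assms H0 by auto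
  then show ?thesis by (intro pw_in_lead[of _ v]) auto
qed

text \<open>In codimension two along a subspace of H0 the arrangement is a pencil; there interpolation
  yields a derivation because of the heaviness of H0.\<close>

lemma lead_codim_two:
  assumes H: "H \<in> R" and H': "H' \<in> R" and ne: "H \<noteq> H'"
  obtains i where "i \<in> lead" "\<not> elim (al H) (l H') dvd elim (al H) i"
proof -
  let ?\<psi> = "elim (al H)"
  \<comment> \<open>The pencil through the intersection of H and H'. The factor P takes care of the
    remaining hyperplanes of R and is the member of \<open>lead\<close> to be exhibited.\<close>
  define S where "S = {K \<in> R. H \<inter> H' \<subseteq> K}"
  define P where "P = pw (R - S)"
  have HA: "H \<in> A" "H' \<in> A" using H H' by auto
  define \<gamma> where "\<gamma> K = (\<lambda>j. al K j - elim_coeff (al H) (al K) * al H j)" for K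
  have \<gamma>: "?\<psi> (l K) = linf (\<gamma> K)" for K by (simp add: \<gamma>_def elim_linf)
  have "?\<psi> (l H') \<noteq> 0"
    using not_dvd[OF HA ne] linf_dvd_iff_elim[OF form(1)[OF HA(1)]] by blast
  then have nz: "\<exists>i. \<gamma> H' i \<noteq> 0" unfolding \<gamma> linf_eq_0_iff by blast
  \<comment> \<open>Otherwise some K outside S would have its form in the span of the forms of H and
    H', hence belong to the pencil.\<close>
  have "\<not> ?\<psi> (l H') dvd ?\<psi> P"
  proof
    assume "?\<psi> (l H') dvd ?\<psi> P"
    then have d: "linf (\<gamma> H') dvd (\<Prod>K\<in>R - S. linf (\<gamma> K) ^ m K)"
      by (simp add: P_def pw_def elim_prod elim_power \<gamma>)
    have "finite (R - S)" using finA by simp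
    from d[unfolded linf_dvd_prod[OF nz this]] obtain K where
      K: "K \<in> R - S" "linf (\<gamma> H') dvd linf (\<gamma> K) ^ m K" ..
    have "linf (\<gamma> H') dvd linf (\<gamma> K)" by (rule linf_dvd_power[OF nz K(2)])
    then obtain s where s: "\<forall>i. \<gamma> K i = s * \<gamma> H' i" using linf_dvd_linf[OF nz] by blast
    define t t' where "t = elim_coeff (al H) (al K)" and "t' = elim_coeff (al H) (al H')"
    have "\<forall>i. al K i = (t - s * t') * al H i + s * al H' i"
      using s by (simp add: \<gamma>_def t_def t'_def algebra_simps)
    note d = form_lincomb(1)[OF this]
    have "H \<inter> H' \<subseteq> K"
    proof
      fix v assume "v \<in> H \<inter> H'"
      then have "dot (al H) v = 0" "dot (al H') v = 0" using form(2)[OF HA(1)] form(2)[OF HA(2)] by simp_all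
      then show "v \<in> K" using form(2)[of K] K(1) d by simp
    qed
    then show False using K(1) by (auto simp: S_def)
  qed
  moreover have "P \<in> lead"
  proof (cases "H \<inter> H' \<subseteq> H0")
    case False
    \<comment> \<open>A constant vector lying in all hyperplanes of S but not in H0 already gives
      the derivation.\<close>
    then obtain u where u: "u \<in> H" "u \<in> H'" "dot (al H0) u \<noteq> 0" using form(2)[OF H0] by blast
    define v where "v i = inverse (dot (al H0) u) * u i" for i
    have dv: "dot a v = inverse (dot (al H0) u) * dot a u" for a unfolding v_def by (rule dot_scale)
    show ?thesis unfolding P_def
    proof (rule pw_in_lead)
      show "dot (al H0) v = 1" using u(3) by (simp add: dv)
      fix K assume K: "K \<in> R - (R - S)"
      then have "K \<in> S" "K \<in> A" by (auto simp: S_def)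
      then have "u \<in> K" using u by (auto simp: S_def)
      then show "dot (al K) v = 0" unfolding form(2)[OF \<open>K \<in> A\<close>] by (simp add: dv)
    qed auto
  next
    case True
    \<comment> \<open>Now H0 belongs to the pencil, and alpha together with the form of H can serve
      as its coordinates.\<close>
    obtain x1 y1 where "y1 \<noteq> 0" "\<forall>i. al H0 i = x1 * al H i + y1 * al H' i"
      using form_pair[OF HA ne H0 True] H by blast
    note d0 = this(1) form_lincomb(1)[OF this(2)]
    have ker: "H0 \<inter> H \<subseteq> K" if K: "K \<in> S" for K
    proof
      fix v assume v: "v \<in> H0 \<inter> H"
      then have "dot (al H) v = 0" "dot (al H0) v = 0" using form(2)[OF HA(1)] form(2)[OF H0] by simp_all
      then have "dot (al H') v = 0" using d0(2)[of v] d0(1) by simp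
      then have "v \<in> H \<inter> H'" using v form(2)[OF HA(2)] by simp
      then show "v \<in> K" using K by (auto simp: S_def)
    qed
    have "\<forall>K\<in>S. \<exists>X Y. Y \<noteq> 0 \<and> (\<forall>i. al K i = X * al H0 i + Y * al H i)"
    proof
      fix K assume K: "K \<in> S"
      then have "K \<in> A" "K \<noteq> H0" "H0 \<noteq> H" using H by (auto simp: S_def)
      then show "\<exists>X Y. Y \<noteq> 0 \<and> (\<forall>i. al K i = X * al H0 i + Y * al H i)"
        using form_pair[OF H0 HA(1) _ _ ker[OF K]] by metis
    qed
    then obtain X Y where XY: "\<And>K. K \<in> S \<Longrightarrow> Y K \<noteq> 0"
      "\<And>K. K \<in> S \<Longrightarrow> \<forall>i. al K i = X K * al H0 i + Y K * al H i" by metis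
    \<comment> \<open>Up to a unit, the form of K is that of H plus c K times alpha.\<close>
    define c where "c K = X K / Y K" for K
    have lK: "l K = Cst (Y K) * (l H + Cst (c K) * l H0)" if K: "K \<in> S" for K
      unfolding form_lincomb(2)[OF XY(2)[OF K]] distrib_left mult.assoc[symmetric] Cst_simps(4)[symmetric]
      using XY(1)[OF K] by (simp add: c_def)
    have inj: "inj_on c S"
    proof (rule inj_onI, rule ccontr)
      fix K K' assume K: "K \<in> S" "K' \<in> S" "c K = c K'" "K \<noteq> K'"
      have "Cst (Y K) dvd (1 :: ('n, 'a) pol)" using XY(1)[OF K(1)] by (rule Cst_dvd_one)
      then have "l K dvd 1 * (l H + Cst (c K) * l H0)"
        unfolding lK[OF K(1)] by (rule mult_dvd_mono) simp
      then have "l K dvd l K'" using lK[OF K(2)] K(3) by simp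
      then show False using not_dvd[of K K'] K by (auto simp: S_def)
    qed
    have finS: "finite S" using finA by (simp add: S_def)
    define \<mu> where "\<mu> x = m (inv_into S c x)" for x
    have \<mu>: "\<mu> (c K) = m K" if "K \<in> S" for K using inv_into_f_f[OF inj that] by (simp add: \<mu>_def)
    have sum_\<mu>: "(\<Sum>x\<in>c ` S. \<mu> x) = (\<Sum>K\<in>S. m K)" using \<mu> by (simp add: sum.reindex[OF inj])
    obtain g where g: "degree g \<le> (\<Sum>K\<in>S. m K)" "\<forall>x\<in>c ` S. [:x, 1:] ^ \<mu> x dvd g + [:x:]"
      using interpolation[OF finite_imageI[OF finS] sum_\<mu>] by blast
    have "(\<Sum>K\<in>S. m K) \<le> (\<Sum>K\<in>R. m K)"
      using finA by (intro sum_mono2) (auto simp: S_def)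
    \<comment> \<open>Heaviness leaves room to homogenize g in degree m H0.\<close>
    then have deg: "degree g \<le> m H0" using g(1) heavy_le by simp
    define G where "G = homogenize (l H0) (l H) (m H0) g"
    have G: "(l H + Cst (c K) * l H0) ^ m K dvd G + Cst (c K) * l H0 ^ m H0" if K: "K \<in> S" for K
    proof -
      have "degree (g + [:c K:]) \<le> m H0" using deg by (intro degree_add_le) simp_all
      moreover have "[:c K, 1:] ^ m K dvd g + [:c K:]"
        using bspec[OF g(2), of "c K"] K \<mu>[OF K] by simp
      ultimately have "(l H + Cst (c K) * l H0) ^ m K dvd homogenize (l H0) (l H) (m H0) (g + [:c K:])"
        by (rule homogenize_dvd)
      then show ?thesis by (simp add: G_def homogenize_add homogenize_const)
    qed
    have "H0 \<noteq> H" using H by blast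
    obtain u where u: "dot (al H) u = 0" "dot (al H0) u = 1" using separate[OF HA(1) H0] \<open>H0 \<noteq> H\<close> by metis
    obtain w where w: "dot (al H0) w = 0" "dot (al H) w = 1" using separate[OF H0 HA(1) \<open>H0 \<noteq> H\<close>] .
    \<comment> \<open>Up to the factor P, the value is alpha^m0 on alpha and G on the form of H,
      hence G + c alpha^m0 on the form with parameter c. These are the interpolation conditions in
      homogeneous form.\<close>
    define \<theta> where "\<theta> = (\<lambda>j. P * (l H0 ^ m H0 * Cst (u j) + G * Cst (w j)))"
    have val: "der_app \<theta> a = P * (l H0 ^ m H0 * Cst (dot a u) + G * Cst (dot a w))" for a
      unfolding \<theta>_def der_app_mult der_app_add der_app_const ..
    have "\<theta> \<in> D" unfolding D_iff
    proof
      fix K assume K: "K \<in> A"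
      consider "K = H0" | "K \<in> S" | "K \<in> R - S" using K by blast
      then show "l K ^ m K dvd der_app \<theta> (al K)"
      proof cases
        case 1
        then show ?thesis by (simp add: val u w Cst_simps)
      next
        case 2
        note d = form_lincomb(1)[OF XY(2)[OF 2]]
        have "der_app \<theta> (al K) = P * (l H0 ^ m H0 * Cst (X K) + G * Cst (Y K))"
          by (simp add: val d u w)
        also have "X K = Y K * c K" using XY(1)[OF 2] by (simp add: c_def)
        also have "P * (l H0 ^ m H0 * Cst (Y K * c K) + G * Cst (Y K)) = P * Cst (Y K) * (G + Cst (c K) * l H0 ^ m H0)"
          by (simp add: Cst_simps algebra_simps)
        finally have val': "der_app \<theta> (al K) = \<dots>" .
        have "Cst (Y K) ^ m K dvd (1 ^ m K :: ('n, 'a) pol)"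
          by (intro dvd_power_same Cst_dvd_one XY(1) 2)
        then have "l K ^ m K dvd 1 * (G + Cst (c K) * l H0 ^ m H0)"
          unfolding lK[OF 2] power_mult_distrib using G[OF 2] by (intro mult_dvd_mono) simp_all
        then show ?thesis unfolding val' by (intro dvd_mult) simp
      next
        case 3
        have "l K ^ m K dvd P" unfolding P_def using 3 by (intro dvd_pw) auto
        then show ?thesis unfolding val by (rule dvd_mult2)
      qed
    qed
    moreover have "der_app \<theta> (al H0) = P * l H0 ^ m H0" by (simp add: val u w Cst_simps)
    ultimately show ?thesis unfolding lead_def by blast
  qed
  ultimately show ?thesis using that by blast
qed

section \<open>Removing linear factors, and the derivation with value alpha^m0 on alpha\<close>

lemma pw_induct:
  assumes "C \<subseteq> A" "P 1" "\<And>H s. H \<in> C \<Longrightarrow> P s \<Longrightarrow> P (l H * s)"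
  shows "P (pw C)"
proof -
  have pow: "P (l H ^ k * s)" if "H \<in> C" "P s" for H k s
    using that by (induction k) (auto simp: mult.assoc assms(3))
  have "P (pw C')" if "C' \<subseteq> C" for C'
    using finite_subset[OF that finite_subset[OF assms(1) finA]] that
  proof (induction C' rule: finite_induct)
    case empty
    then show ?case using assms(2) by (simp add: pw_def)
  next
    case (insert H C')
    then have "P (l H ^ m H * pw C')" by (intro pow) auto
    then show ?case using insert.hyps by (simp add: pw_def)
  qed
  then show ?thesis by blast
qed

text \<open>Modulo l H the relation reads l H' s d = i r. For a member i of \<open>lead\<close> not
  divisible by l H' modulo l H, primality forces l H' to divide r, and then l H' cancels for all
  pairs at once.\<close>

lemma strip_factor:
  assumes H: "H \<in> R" and H': "H' \<in> R" "H' \<noteq> H"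
    and lead: "\<And>i. i \<in> lead \<Longrightarrow> \<exists>d. (i, d) \<in> S"
    and rel: "\<And>i d. (i, d) \<in> S \<Longrightarrow> l H dvd l H' * s * d - i * r"
  obtains t where "\<And>i d. (i, d) \<in> S \<Longrightarrow> l H dvd s * d - i * t"
proof -
  have a: "\<exists>i. al H i \<noteq> 0" using form(1) H by blast
  let ?\<psi> = "elim (al H)"
  note psi = linf_dvd_iff_elim[OF a]
  obtain i0 where i0: "i0 \<in> lead" "\<not> ?\<psi> (l H') dvd ?\<psi> i0"
    using lead_codim_two[OF H H'(1) H'(2)[symmetric]] .
  obtain d0 where d0: "(i0, d0) \<in> S" using lead[OF i0(1)] by blast
  have "\<not> l H dvd l H'" using not_dvd H H' by blast
  then have nz: "?\<psi> (l H') \<noteq> 0" using psi by blast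
  define \<gamma> where "\<gamma> = (\<lambda>j. al H' j - elim_coeff (al H) (al H') * al H j)"
  have \<gamma>: "?\<psi> (l H') = linf \<gamma>" by (simp add: \<gamma>_def elim_linf)
  then have \<gamma>_nz: "\<exists>j. \<gamma> j \<noteq> 0" using nz by (simp add: linf_eq_0_iff)
  have "?\<psi> (l H') * (?\<psi> s * ?\<psi> d0) = ?\<psi> i0 * ?\<psi> r"
    using rel[OF d0] by (simp add: psi elim_diff elim_mult mult.assoc)
  then have "linf \<gamma> dvd ?\<psi> i0 * ?\<psi> r" unfolding \<gamma> by (metis dvd_triv_left)
  then have "linf \<gamma> dvd ?\<psi> r" using i0(2) unfolding linf_prime[OF \<gamma>_nz] \<gamma> by blast
  then obtain t where t: "?\<psi> r = ?\<psi> (l H') * t" unfolding \<gamma> by (rule dvdE)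
  \<comment> \<open>The quotient t need not be free of the eliminated variable; applying the
    retraction once more replaces it by its image.\<close>
  have "?\<psi> r = ?\<psi> (?\<psi> r)" by (simp add: elim_elim[OF a])
  also have "\<dots> = ?\<psi> (l H') * ?\<psi> t" unfolding t elim_mult elim_elim[OF a] ..
  finally have r: "?\<psi> r = ?\<psi> (l H') * ?\<psi> t" .
  have "l H dvd s * d - i * t" if "(i, d) \<in> S" for i d
  proof -
    have "?\<psi> (l H') * ?\<psi> (s * d) = ?\<psi> i * (?\<psi> (l H') * ?\<psi> t)"
      using rel[OF that] by (simp add: psi elim_diff elim_mult r mult.assoc)
    then have "?\<psi> (l H') * ?\<psi> (s * d) = ?\<psi> (l H') * ?\<psi> (i * t)" by (simp add: elim_mult mult_ac)
    then have "?\<psi> (s * d) = ?\<psi> (i * t)" using pol_mult_left_cancel[OF nz] by blast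
    then show ?thesis by (simp add: psi elim_diff)
  qed
  then show ?thesis using that by blast
qed

lemma strip_all_factors:
  assumes H: "H \<in> R"
    and lead: "\<And>i. i \<in> lead \<Longrightarrow> \<exists>d. (i, d) \<in> S"
    and rel: "\<And>i d. (i, d) \<in> S \<Longrightarrow> l H dvd pw (R - {H}) * d - i * r"
  obtains t where "\<And>i d. (i, d) \<in> S \<Longrightarrow> l H dvd d - i * t"
proof -
  \<comment> \<open>Here s is the denominator still present. The numerator r is quantified inside
    because each cancellation changes it.\<close>
  define P where "P s = (\<forall>r. (\<forall>(i, d)\<in>S. l H dvd s * d - i * r) \<longrightarrow> (\<exists>t. \<forall>(i, d)\<in>S. l H dvd d - i * t))" for s
  have "P (pw (R - {H}))"
  proof (rule pw_induct)
    show "P 1" by (auto simp: P_def)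
    fix H' s assume H': "H' \<in> R - {H}" and s: "P s"
    show "P (l H' * s)" unfolding P_def
    proof (intro allI impI)
      fix r assume "\<forall>(i, d)\<in>S. l H dvd l H' * s * d - i * r"
      then have r: "\<And>i d. (i, d) \<in> S \<Longrightarrow> l H dvd l H' * s * d - i * r" by blast
      have H'': "H' \<in> R" "H' \<noteq> H" using H' by auto
      obtain t where "\<And>i d. (i, d) \<in> S \<Longrightarrow> l H dvd s * d - i * t"
        using strip_factor[OF H H'' lead r] by blast
      then show "\<exists>t. \<forall>(i, d)\<in>S. l H dvd d - i * t" using s unfolding P_def by blast
    qed
  qed auto
  then show ?thesis using rel that unfolding P_def by blast
qed

text \<open>The relation \<open>good\<close> is the graph of a homomorphism from the ideal \<open>lead\<close> to the free module
  on B modulo Q0. Removing the linear factors of Q0 one at a time shows that it is multiplication by a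
  vector: the quotient by the prime ideal of a linear form is factorial, and no ideal generated by two
  of the forms contains \<open>lead\<close>.\<close>

lemma euler_derivation:
  assumes B: "is_basis 0 D0 B"
  obtains \<theta> where "\<theta> \<in> D" "der_app \<theta> (al H0) = l H0 ^ m H0"
proof -
  have fin: "finite B" and BD: "B \<subseteq> D0" and span: "D0 \<subseteq> spn 0 B"
    and indep: "\<And>c b. (\<lambda>i. \<Sum>b\<in>B. c b * b i) = (\<lambda>i. 0) \<Longrightarrow> b \<in> B \<Longrightarrow> c b = 0"
    using B unfolding is_basis_def cong_der_0 by auto
  have expand: "\<exists>c. \<theta> = (\<lambda>j. \<Sum>b\<in>B. c b * b j)" if "\<theta> \<in> D0" for \<theta>
    using span that unfolding spn_def cong_der_0 by blast
  obtain v where v: "dot (al H0) v = 1" using const_vector .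
  \<comment> \<open>A reference derivation with value Q0 alpha^m0 on alpha, so that Q0 \<theta> - i
    E annihilates alpha whenever \<theta> has value i alpha^m0.\<close>
  define E where "E = (\<lambda>j. pw A * (Cst (v j) :: ('n, 'a) pol))"
  have E: "E \<in> D" unfolding E_def by (intro pw_mult_in_D) auto
  have E0: "der_app E (al H0) = Q0 * l H0 ^ m H0"
    unfolding E_def der_app_mult der_app_const v pw_split[OF subset_refl H0] by (simp add: Cst_simps mult.commute)
  define good where "good \<theta> i c \<longleftrightarrow> \<theta> \<in> D \<and> der_app \<theta> (al H0) = i * l H0 ^ m H0 \<and>
      (\<forall>j. Q0 * \<theta> j - i * E j = (\<Sum>b\<in>B. c b * b j))" for \<theta> i c
  have ex: "\<exists>\<theta> c. good \<theta> i c" if i: "i \<in> lead" for i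
  proof -
    obtain \<theta> where \<theta>: "\<theta> \<in> D" "der_app \<theta> (al H0) = i * l H0 ^ m H0" using i by (auto simp: lead_def)
    have "(\<lambda>j. Q0 * \<theta> j - i * E j) \<in> D0"
      using \<theta> E E0 by (simp add: D0_iff D_diff D_mult der_app_diff der_app_mult)
    then obtain c where "(\<lambda>j. Q0 * \<theta> j - i * E j) = (\<lambda>j. \<Sum>b\<in>B. c b * b j)" using expand by blast
    then have "good \<theta> i c" using \<theta> unfolding good_def by (metis (no_types))
    then show ?thesis by blast
  qed
  \<comment> \<open>In k (Q0 \<theta> - i E) - i (Q0 \<theta>' - k E) the terms with E cancel, and
    what remains is Q0 times an element of D0.\<close>
  have cross: "Q0 dvd k * c b - i * c' b" if 1: "good \<theta> i c" and 2: "good \<theta>' k c'" and b: "b \<in> B" for \<theta> \<theta>' i k c c' b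
  proof -
    define \<xi> where "\<xi> = (\<lambda>j. k * \<theta> j - i * \<theta>' j)"
    have "\<xi> \<in> D0"
      using 1 2 unfolding \<xi>_def good_def D0_iff
      by (auto intro!: D_diff D_mult simp: der_app_diff der_app_mult)
    then obtain e where e: "\<xi> = (\<lambda>j. \<Sum>b\<in>B. e b * b j)" using expand by blast
    have "(\<Sum>b\<in>B. (k * c b - i * c' b - Q0 * e b) * b j) = 0" for j
    proof -
      have "(\<Sum>b\<in>B. (k * c b - i * c' b - Q0 * e b) * b j)
          = k * (\<Sum>b\<in>B. c b * b j) - i * (\<Sum>b\<in>B. c' b * b j) - Q0 * (\<Sum>b\<in>B. e b * b j)"
        by (simp add: left_diff_distrib sum_subtractf sum_distrib_left mult.assoc)
      also have "(\<Sum>b\<in>B. c b * b j) = Q0 * \<theta> j - i * E j" using 1 by (simp add: good_def)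
      also have "(\<Sum>b\<in>B. c' b * b j) = Q0 * \<theta>' j - k * E j" using 2 by (simp add: good_def)
      also have "(\<Sum>b\<in>B. e b * b j) = k * \<theta> j - i * \<theta>' j" using fun_cong[OF e, of j] by (simp add: \<xi>_def)
      finally show ?thesis by (simp add: algebra_simps)
    qed
    then have "k * c b - i * c' b - Q0 * e b = 0"
      using indep[of "\<lambda>b. k * c b - i * c' b - Q0 * e b" b] b by simp
    then show ?thesis by simp
  qed
  have "\<forall>b\<in>B. \<exists>x. \<forall>\<theta> i c. good \<theta> i c \<longrightarrow> Q0 dvd c b - i * x"
  proof
    fix b assume b: "b \<in> B"
    \<comment> \<open>T runs through partial products of Q0. The guard is needed because
      \<open>cross\<close> gives divisibility only by divisors of Q0.\<close>
    define P where "P T \<longleftrightarrow> (T dvd Q0 \<longrightarrow> (\<exists>x. \<forall>\<theta> i c. good \<theta> i c \<longrightarrow> T dvd c b - i * x))" for T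
    have "P Q0"
    proof (rule pw_induct)
      show "P 1" by (simp add: P_def)
      fix H T assume H: "H \<in> R" and T: "P T"
      show "P (l H * T)" unfolding P_def
      proof
        assume dvd: "l H * T dvd Q0"
        then have "T dvd Q0" by (rule dvd_mult_right)
        then obtain x where x: "\<And>\<theta> i c. good \<theta> i c \<Longrightarrow> T dvd c b - i * x" using T unfolding P_def by blast
        have "T \<noteq> 0" using dvd pw_nz[of R] by auto
        \<comment> \<open>The error left after division by T; it has to be made a multiple of i
          modulo the next factor l H.\<close>
        define S where "S = {(i, d). \<exists>\<theta> c. good \<theta> i c \<and> c b - i * x = T * d}"
        have lead: "\<exists>d. (i, d) \<in> S" if "i \<in> lead" for i
          using ex[OF that] x unfolding S_def dvd_def by blast
        \<comment> \<open>The pair at the known member pw (R - {H}) supplies numerator and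
          denominator of the multiplier modulo l H.\<close>
        obtain r where r: "(pw (R - {H}), r) \<in> S" using lead[OF pw_remove_in_lead[OF H]] by blast
        have rel: "l H dvd pw (R - {H}) * d - i * r" if d: "(i, d) \<in> S" for i d
        proof -
          let ?s = "pw (R - {H})"
          obtain \<theta> c where c: "good \<theta> i c" "c b - i * x = T * d" using d by (auto simp: S_def)
          obtain \<theta>' c' where c': "good \<theta>' ?s c'" "c' b - ?s * x = T * r" using r by (auto simp: S_def)
          have "l H * T dvd ?s * c b - i * c' b" using dvd_trans[OF dvd cross[OF c(1) c'(1) b]] .
          also have "?s * c b - i * c' b = ?s * (c b - i * x) - i * (c' b - ?s * x)"
            by (simp add: algebra_simps)
          also have "\<dots> = T * (?s * d - i * r)" unfolding c(2) c'(2) by (simp add: algebra_simps)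
          finally have "T * l H dvd T * (?s * d - i * r)" by (simp only: mult.commute)
          then show ?thesis using pol_dvd_mult_cancel_left[OF \<open>T \<noteq> 0\<close>] by blast
        qed
        obtain t where t: "\<And>i d. (i, d) \<in> S \<Longrightarrow> l H dvd d - i * t"
          using strip_all_factors[OF H lead rel] by blast
        have "l H * T dvd c b - i * (x + T * t)" if c: "good \<theta> i c" for \<theta> i c
        proof -
          obtain d where d: "c b - i * x = T * d" using x[OF c] by (rule dvdE)
          then have "(i, d) \<in> S" using c by (auto simp: S_def)
          then have "l H * T dvd (d - i * t) * T" using t by (intro mult_dvd_mono) auto
          also have "(d - i * t) * T = (c b - i * x) - i * (T * t)" unfolding d by (simp add: algebra_simps)
          also have "\<dots> = c b - i * (x + T * t)" by (simp add: algebra_simps)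
          finally show ?thesis .
        qed
        then show "\<exists>x. \<forall>\<theta> i c. good \<theta> i c \<longrightarrow> l H * T dvd c b - i * x" by blast
      qed
    qed auto
    then show "\<exists>x. \<forall>\<theta> i c. good \<theta> i c \<longrightarrow> Q0 dvd c b - i * x" unfolding P_def by simp
  qed
  from bchoice[OF this] obtain x where x: "\<forall>b\<in>B. \<forall>\<theta> i c. good \<theta> i c \<longrightarrow> Q0 dvd c b - i * x b" ..
  \<comment> \<open>E corrected by the multiplier x: for each i in \<open>lead\<close>, i W is Q0
    times a derivation in D.\<close>
  define W where "W j = E j + (\<Sum>b\<in>B. x b * b j)" for j
  have scaled: "\<exists>\<theta>'. \<theta>' \<in> D \<and> der_app \<theta>' (al H0) = i * l H0 ^ m H0 \<and> (\<forall>j. Q0 * \<theta>' j = i * W j)"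
    if i: "i \<in> lead" for i
  proof -
    obtain \<theta> c where c: "good \<theta> i c" using ex[OF i] by blast
    have "\<forall>b\<in>B. \<exists>e. c b - i * x b = Q0 * e" using x c unfolding dvd_def by blast
    from bchoice[OF this] obtain e where e: "\<forall>b\<in>B. c b - i * x b = Q0 * e b" ..
    define \<epsilon> where "\<epsilon> = (\<lambda>j. \<Sum>b\<in>B. e b * b j)"
    have \<epsilon>: "\<epsilon> \<in> D0" unfolding \<epsilon>_def using BD by (intro D0_sum D0_mult) auto
    have "Q0 * (\<theta> j - \<epsilon> j) = i * W j" for j
    proof -
      have "Q0 * \<epsilon> j = (\<Sum>b\<in>B. (c b - i * x b) * b j)"
        unfolding \<epsilon>_def sum_distrib_left using e by (intro sum.cong) (auto simp: mult.assoc)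
      also have "\<dots> = (\<Sum>b\<in>B. c b * b j) - i * (\<Sum>b\<in>B. x b * b j)"
        by (simp add: left_diff_distrib sum_subtractf sum_distrib_left mult.assoc)
      also have "(\<Sum>b\<in>B. c b * b j) = Q0 * \<theta> j - i * E j" using c by (simp add: good_def)
      finally show ?thesis by (simp add: W_def algebra_simps)
    qed
    moreover have "(\<lambda>j. \<theta> j - \<epsilon> j) \<in> D" using c \<epsilon> by (intro D_diff) (auto simp: good_def D0_iff)
    moreover have "der_app (\<lambda>j. \<theta> j - \<epsilon> j) (al H0) = i * l H0 ^ m H0"
      using c \<epsilon> by (simp add: der_app_diff good_def D0_iff)
    ultimately show ?thesis by blast
  qed
  \<comment> \<open>At H use the member i = pw (R - {H}), which is prime to l H; the full power of l
    H in Q0 must then divide W.\<close>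
  have "Q0 dvd W j" for j
  proof (rule pw_dvd)
    fix H assume H: "H \<in> R"
    obtain \<theta>' where \<theta>': "pw (R - {H}) * W j = Q0 * \<theta>' j" using scaled[OF pw_remove_in_lead[OF H]] by metis
    have "l H ^ m H dvd pw (R - {H}) * W j" unfolding \<theta>' using dvd_pw[of R H] H by (intro dvd_mult2) auto
    then show "l H ^ m H dvd W j"
      by (rule linf_power_dvd_mult[rotated 2]) (use H form(1) not_dvd_pw[of "R - {H}" H] in auto)
  qed auto
  then have "\<forall>j. \<exists>\<theta>. W j = Q0 * \<theta>" by (simp add: dvd_def)
  from choice[OF this] obtain \<theta>0 where \<theta>0: "\<forall>j. W j = Q0 * \<theta>0 j" ..
  have Q0_nz: "Q0 \<noteq> 0" by (rule pw_nz) auto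
  have "W = (\<lambda>j. Q0 * \<theta>0 j)" using \<theta>0 by blast
  then have "Q0 * der_app \<theta>0 (al H0) = der_app W (al H0)"
    by (simp only: der_app_mult)
  also have "\<dots> = der_app E (al H0) + der_app (\<lambda>j. \<Sum>b\<in>B. x b * b j) (al H0)"
    unfolding der_app_add[symmetric] W_def ..
  also have "der_app (\<lambda>j. \<Sum>b\<in>B. x b * b j) (al H0) = 0"
    unfolding der_app_sum der_app_mult using BD by (intro sum.neutral) (auto simp: D0_iff)
  finally have "Q0 * der_app \<theta>0 (al H0) = Q0 * l H0 ^ m H0" unfolding E0 by simp
  then have val: "der_app \<theta>0 (al H0) = l H0 ^ m H0" using pol_mult_left_cancel[OF Q0_nz] by blast
  have "\<theta>0 \<in> D" unfolding D_iff
  proof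
    fix H assume H: "H \<in> A"
    show "l H ^ m H dvd der_app \<theta>0 (al H)"
    proof (cases "H = H0")
      case False
      then have HR: "H \<in> R" using H by simp
      \<comment> \<open>The multiple pw (R - {H}) \<theta>0 lies in D, and its factor is prime to l
        H, so \<theta>0 inherits the condition at H.\<close>
      obtain \<theta>' where \<theta>': "\<theta>' \<in> D" "\<forall>j. Q0 * \<theta>' j = pw (R - {H}) * W j"
        using scaled[OF pw_remove_in_lead[OF HR]] by blast
      have "Q0 * \<theta>' j = Q0 * (pw (R - {H}) * \<theta>0 j)" for j
        using \<theta>'(2) \<theta>0 by (simp add: mult_ac)
      then have "\<theta>' = (\<lambda>j. pw (R - {H}) * \<theta>0 j)" using pol_mult_left_cancel[OF Q0_nz] by blast
      then have "l H ^ m H dvd pw (R - {H}) * der_app \<theta>0 (al H)"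
        using \<theta>'(1) H by (simp add: D_iff der_app_mult)
      then show ?thesis
        by (rule linf_power_dvd_mult[rotated 2]) (use H form(1)[OF H] not_dvd_pw[of "R - {H}" H] in auto)
    qed (simp add: val)
  qed
  then show ?thesis using that val by blast
qed

text \<open>The derivation \<theta>0 splits off: subtracting f \<theta>0, where f is the leading
  coefficient of \<theta>, leads into D0, and evaluating a relation at alpha isolates the
  coefficient of \<theta>0.\<close>

lemma restr_imp_free:
  assumes "free_restr A m H0" "res_surj A m H0"
  shows "free_multiarr A m"
proof -
  obtain B where B: "is_basis 0 D0 B" using D0_basis[OF assms] .
  then have fin: "finite B" and BD: "B \<subseteq> D0" and span: "D0 \<subseteq> spn 0 B"
    and indep: "\<And>c b. (\<lambda>i. \<Sum>b\<in>B. c b * b i) = (\<lambda>i. 0) \<Longrightarrow> b \<in> B \<Longrightarrow> c b = 0"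
    unfolding is_basis_def cong_der_0 by auto
  obtain \<theta>0 where \<theta>0: "\<theta>0 \<in> D" "der_app \<theta>0 (al H0) = l H0 ^ m H0" using euler_derivation[OF B] .
  have pow_nz: "l H0 ^ m H0 \<noteq> 0" using l_nz[OF H0] by simp
  have nB: "\<theta>0 \<notin> B" using BD \<theta>0(2) pow_nz by (auto simp: D0_iff)
  have "is_basis 0 D (insert \<theta>0 B)"
    unfolding is_basis_def cong_der_0
  proof (intro conjI allI impI ballI)
    show "insert \<theta>0 B \<subseteq> D" using BD \<theta>0(1) by (auto simp: D0_iff)
    show "D \<subseteq> spn 0 (insert \<theta>0 B)"
    proof
      fix \<theta> assume \<theta>: "\<theta> \<in> D"
      then obtain f where f: "der_app \<theta> (al H0) = l H0 ^ m H0 * f" using H0 by (auto simp: D_iff elim: dvdE)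
      have "(\<lambda>j. \<theta> j - f * \<theta>0 j) \<in> D0"
        using \<theta> \<theta>0 f by (simp add: D0_iff D_diff D_mult der_app_diff der_app_mult)
      then have "(\<lambda>j. \<theta> j - f * \<theta>0 j) \<in> spn 0 (insert \<theta>0 B)"
        using span spn_mono[of "insert \<theta>0 B" B 0] fin by blast
      moreover have "\<theta>0 \<in> spn 0 (insert \<theta>0 B)" using fin by (intro spn_base) auto
      ultimately have "(\<lambda>j. (\<theta> j - f * \<theta>0 j) + f * \<theta>0 j) \<in> spn 0 (insert \<theta>0 B)"
        by (intro spn_add spn_mult)
      then show "\<theta> \<in> spn 0 (insert \<theta>0 B)" by simp
    qed
    fix c b assume rel: "(\<lambda>i. \<Sum>b\<in>insert \<theta>0 B. c b * b i) = (\<lambda>i. 0)" and b: "b \<in> insert \<theta>0 B"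
    have rel': "c \<theta>0 * \<theta>0 i + (\<Sum>b\<in>B. c b * b i) = 0" for i
      using fun_cong[OF rel, of i] fin nB by simp
    have "der_app (\<lambda>i. c \<theta>0 * \<theta>0 i + (\<Sum>b\<in>B. c b * b i)) (al H0) = 0"
      unfolding rel' by (simp add: der_app_def)
    moreover have "der_app (\<lambda>i. \<Sum>b\<in>B. c b * b i) (al H0) = 0"
      unfolding der_app_sum der_app_mult using BD by (intro sum.neutral) (auto simp: D0_iff)
    ultimately have "c \<theta>0 * l H0 ^ m H0 = 0" unfolding der_app_add der_app_mult \<theta>0(2) by simp
    then have c0: "c \<theta>0 = 0" using l_nz[OF H0] by simp
    then have "(\<lambda>i. \<Sum>b\<in>B. c b * b i) = (\<lambda>i. 0)" using rel' by simp
    then show "0 dvd c b" using indep[of c b] b c0 by auto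
  qed (use fin in simp)
  then show ?thesis unfolding free_multiarr_def by (rule is_basis_imp_free)
qed

end

theorem theorem3p10:
  fixes A :: "('n::finite \<Rightarrow> 'a::field) set set"
    and m :: "('n \<Rightarrow> 'a) set \<Rightarrow> nat"
    and H0 :: "('n \<Rightarrow> 'a) set"
  assumes "multiarrangement A m"
    and "H0 \<in> A"
    and "heavy A m H0"
  shows "free_multiarr A m \<longleftrightarrow> (free_restr A m H0 \<and> res_surj A m H0)"
proof -
  interpret heavy_arrangement A m H0 using assms by unfold_locales
  show ?thesis using free_imp_restr restr_imp_free by blast
qed

end
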